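(* Let $\Gamma$ be an RTP-tree (rational $3$-tuple tree), let $Q$ be a quiver obtained from $\Gamma$ by choosing an orientation of every edge, and let $\mathbf{a}=(a_v)_{v\in Q_0}$ be a sincere root in the triple root system $R(\Gamma)$ (that is, $a_v\ge 1$ for all $v$ and $\sum_v a_vE_v\in R(\Gamma)$). Then the discriminant $D$ in the representation space $\mathrm{Rep}(Q,\mathbf{a})$ over $\mathbb{C}$ is a linear free divisor, for every choice of the orientation.
   Context: Weighted trees. Let $\Gamma$ be a finite tree with vertices $E_v$, each with an integer weight $w_v\ge 2$. On $\bigoplus_v\mathbb{Z}E_v$ consider the symmetric bilinear (intersection) form with $(E_v\cdot E_v)=-w_v$ and, for $v\ne u$, $(E_v\cdot E_u)=1$ if $E_v,E_u$ are joined by an edge and $0$ otherwise; assume it is negative definite. Elements $Y=\sum m_vE_v$ are called divisors; a non-zero $Y$ is positive (negative) if all $m_v\ge 0$ (all $m_v\le 0$). The Artin cycle $Z$ is the smallest positive divisor with $(Z\cdot E_v)\le 0$ for all $v$. The tree $\Gamma$ is a rational $m$-tuple tree if $p_a(Y):=\frac12\left[(Y\cdot Y)+\sum_v m_v(w_v-2)\right]+1\le 0$ for all positive divisors $Y=\sum m_vE_v$, and $(Z\cdot Z)=-m$. An RTP-tree is a rational $3$-tuple tree; it has a unique vertex $E_0$ of weight $3$ and all other vertices have weight $2$. Triple root system: $R(\Gamma)$ is the set of all positive and negative divisors $Y$ with $(Y\cdot Y)=-2$ or $(Y\cdot Y)=-3$. A divisor $\sum a_vE_v$ is identified with the vector $\mathbf{a}=(a_v)$.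 Quivers. For a quiver $Q$ with vertex set $Q_0$, arrow set $Q_1$ (arrow $\alpha$ from $t\alpha$ to $h\alpha$) and dimension vector $\mathbf{a}\in\mathbb{N}^{Q_0}$, put $\mathrm{Rep}(Q,\mathbf{a})=\prod_{\alpha\in Q_1}\mathrm{Hom}(\mathbb{C}^{a_{t\alpha}},\mathbb{C}^{a_{h\alpha}})$ and $\mathrm{GL}(Q,\mathbf{a})=\prod_{v\in Q_0}\mathrm{GL}_{a_v}(\mathbb{C})$, acting by $(g_v)\cdot(A_\alpha)=(g_{h\alpha}A_\alpha g_{t\alpha}^{-1})$. Let $\mathrm{PGL}(Q,\mathbf{a})=\mathrm{GL}(Q,\mathbf{a})/\mathbb{C}^*\mathrm{id}$, where the subgroup $\mathbb{C}^*\mathrm{id}$ acts trivially. In the situation considered, $\mathrm{PGL}(Q,\mathbf{a})$ and $\mathrm{Rep}(Q,\mathbf{a})$ have the same dimension $N$. Let $\chi_1,\dots,\chi_N$ be the (linear) vector fields on $\mathrm{Rep}(Q,\mathbf{a})\cong\mathbb{C}^N$ given by the infinitesimal action of a basis of the Lie algebra of $\mathrm{PGL}(Q,\mathbf{a})$, and let $\Delta$ be the $N\times N$ matrix of their coefficients with respect to $\partial/\partial x_1,\dots,\partial/\partial x_N$. The discriminant $D$ is the divisor defined by $\det\Delta$. Linear free divisor: a reduced hypersurface $D\subset\mathbb{C}^N$ is a free divisor if the module $\mathrm{Der}(-\log D)$ of logarithmic vector fields (vector fields $\chi$ with $\chi(I(D))\subset I(D)$, where $I(D)$ is the ideal of $D$)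 is locally free of rank $N$; it is a linear free divisor if moreover $\mathrm{Der}(-\log D)$ has a basis of vector fields of the form $\sum_{i,j}\xi_{ij}x_j\frac{\partial}{\partial x_i}$ with $\xi_{ij}\in\mathbb{C}$. *)

theory Defs
  imports
    Complex_Main
    "HOL-Library.Poly_Mapping"
    "HOL-Computational_Algebra.Squarefree"
    "Jordan_Normal_Form.Determinant"
begin

section \<open>Trees, divisors and the triple root system\<close>

text \<open>A graph is given by a vertex set and a symmetric, irreflexive adjacency relation, so each
  undirected edge occurs in \<open>E\<close> as two ordered pairs.\<close>

definition graph_cycle :: "('v \<times> 'v) set \<Rightarrow> 'v list \<Rightarrow> bool" where
  "graph_cycle E p \<longleftrightarrow> 3 \<le> length p \<and> distinct p \<and>
     (\<forall>i<length p. (p ! i, p ! (Suc i mod length p)) \<in> E)"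

definition finite_tree :: "'v set \<Rightarrow> ('v \<times> 'v) set \<Rightarrow> bool" where
  "finite_tree V E \<longleftrightarrow>
     finite V \<and> V \<noteq> {} \<and> E \<subseteq> V \<times> V \<and> sym E \<and> irrefl E \<and>
     (\<forall>u\<in>V. \<forall>v\<in>V. (u, v) \<in> E\<^sup>*) \<and> (\<nexists>p. graph_cycle E p)"

text \<open>Divisors are the elements of the free abelian group on \<open>V\<close>: integer functions
  vanishing off \<open>V\<close>.\<close>

definition divisors :: "'v set \<Rightarrow> ('v \<Rightarrow> int) set" where
  "divisors V = {Y. \<forall>v. v \<notin> V \<longrightarrow> Y v = 0}"

definition vertex_form :: "('v \<times> 'v) set \<Rightarrow> ('v \<Rightarrow> nat) \<Rightarrow> 'v \<Rightarrow> 'v \<Rightarrow> int" where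
  "vertex_form E w u v = (if u = v then - int (w v) else if (u, v) \<in> E then 1 else 0)"

definition intersection ::
  "'v set \<Rightarrow> ('v \<times> 'v) set \<Rightarrow> ('v \<Rightarrow> nat) \<Rightarrow> ('v \<Rightarrow> int) \<Rightarrow> ('v \<Rightarrow> int) \<Rightarrow> int" where
  "intersection V E w X Y = (\<Sum>u\<in>V. \<Sum>v\<in>V. X u * Y v * vertex_form E w u v)"

definition vertex_divisor :: "'v \<Rightarrow> 'v \<Rightarrow> int" where
  "vertex_divisor v = (\<lambda>u. if u = v then 1 else 0)"

definition weighted_tree :: "'v set \<Rightarrow> ('v \<times> 'v) set \<Rightarrow> ('v \<Rightarrow> nat) \<Rightarrow> bool" where
  "weighted_tree V E w \<longleftrightarrow> finite_tree V E \<and> (\<forall>v\<in>V. 2 \<le> w v) \<and>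
     (\<forall>Y\<in>divisors V. Y \<noteq> (\<lambda>_. 0) \<longrightarrow> intersection V E w Y Y < 0)"

definition positive_divisor :: "'v set \<Rightarrow> ('v \<Rightarrow> int) \<Rightarrow> bool" where
  "positive_divisor V Y \<longleftrightarrow> Y \<in> divisors V \<and> Y \<noteq> (\<lambda>_. 0) \<and> (\<forall>v\<in>V. 0 \<le> Y v)"

definition negative_divisor :: "'v set \<Rightarrow> ('v \<Rightarrow> int) \<Rightarrow> bool" where
  "negative_divisor V Y \<longleftrightarrow> Y \<in> divisors V \<and> Y \<noteq> (\<lambda>_. 0) \<and> (\<forall>v\<in>V. Y v \<le> 0)"

definition anti_nef :: "'v set \<Rightarrow> ('v \<times> 'v) set \<Rightarrow> ('v \<Rightarrow> nat) \<Rightarrow> ('v \<Rightarrow> int) \<Rightarrow> bool" where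
  "anti_nef V E w Y \<longleftrightarrow> (\<forall>v\<in>V. intersection V E w Y (vertex_divisor v) \<le> 0)"

definition artin_cycle :: "'v set \<Rightarrow> ('v \<times> 'v) set \<Rightarrow> ('v \<Rightarrow> nat) \<Rightarrow> ('v \<Rightarrow> int) \<Rightarrow> bool" where
  "artin_cycle V E w Z \<longleftrightarrow> positive_divisor V Z \<and> anti_nef V E w Z \<and>
     (\<forall>Y. positive_divisor V Y \<and> anti_nef V E w Y \<longrightarrow> (\<forall>v\<in>V. Z v \<le> Y v))"

definition arithmetic_genus ::
  "'v set \<Rightarrow> ('v \<times> 'v) set \<Rightarrow> ('v \<Rightarrow> nat) \<Rightarrow> ('v \<Rightarrow> int) \<Rightarrow> rat" where
  "arithmetic_genus V E w Y =
     of_int (intersection V E w Y Y + (\<Sum>v\<in>V. Y v * (int (w v) - 2))) / 2 + 1"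

definition rational_tuple_tree ::
  "nat \<Rightarrow> 'v set \<Rightarrow> ('v \<times> 'v) set \<Rightarrow> ('v \<Rightarrow> nat) \<Rightarrow> bool" where
  "rational_tuple_tree m V E w \<longleftrightarrow> weighted_tree V E w \<and>
     (\<forall>Y. positive_divisor V Y \<longrightarrow> arithmetic_genus V E w Y \<le> 0) \<and>
     (\<exists>Z. artin_cycle V E w Z \<and> intersection V E w Z Z = - int m)"

abbreviation RTP_tree :: "'v set \<Rightarrow> ('v \<times> 'v) set \<Rightarrow> ('v \<Rightarrow> nat) \<Rightarrow> bool" where
  "RTP_tree \<equiv> rational_tuple_tree 3"

definition triple_root_system ::
  "'v set \<Rightarrow> ('v \<times> 'v) set \<Rightarrow> ('v \<Rightarrow> nat) \<Rightarrow> ('v \<Rightarrow> int) set" where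
  "triple_root_system V E w = {Y. (positive_divisor V Y \<or> negative_divisor V Y) \<and>
     (intersection V E w Y Y = -2 \<or> intersection V E w Y Y = -3)}"


section \<open>Polynomials, vector fields and linear free divisors\<close>

text \<open>Polynomials in countably many variables \<open>x\<^sub>0, x\<^sub>1, \<dots>\<close>; the coordinate ring of
  \<open>\<complex>\<^sup>N\<close> is the subring \<^term>\<open>poly_ring N\<close> of polynomials in the first \<open>N\<close> of them.\<close>

type_synonym cpoly = "(nat \<Rightarrow>\<^sub>0 nat) \<Rightarrow>\<^sub>0 complex"

definition poly_const :: "complex \<Rightarrow> cpoly" where
  "poly_const c = Poly_Mapping.single 0 c"

definition poly_var :: "nat \<Rightarrow> cpoly" where
  "poly_var i = Poly_Mapping.single (Poly_Mapping.single i 1) 1"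

definition poly_ring :: "nat \<Rightarrow> cpoly set" where
  "poly_ring N = {p. \<forall>m\<in>Poly_Mapping.keys p. Poly_Mapping.keys m \<subseteq> {..<N}}"

definition poly_eval :: "cpoly \<Rightarrow> (nat \<Rightarrow> complex) \<Rightarrow> complex" where
  "poly_eval p x = (\<Sum>m\<in>Poly_Mapping.keys p. Poly_Mapping.lookup p m *
     (\<Prod>i\<in>Poly_Mapping.keys m. x i ^ Poly_Mapping.lookup m i))"

definition partial_deriv :: "nat \<Rightarrow> cpoly \<Rightarrow> cpoly" where
  "partial_deriv i p = (\<Sum>m\<in>Poly_Mapping.keys p.
     Poly_Mapping.single (m - Poly_Mapping.single i 1)
       (of_nat (Poly_Mapping.lookup m i) * Poly_Mapping.lookup p m))"

text \<open>A vector field \<open>\<Sum>i<N. \<chi>\<^sub>i \<partial>/\<partial>x\<^sub>i\<close> is its coefficient function, set to zero from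
  index \<open>N\<close> on.\<close>

type_synonym vfield = "nat \<Rightarrow> cpoly"

definition vector_fields :: "nat \<Rightarrow> vfield set" where
  "vector_fields N = {\<chi>. (\<forall>i<N. \<chi> i \<in> poly_ring N) \<and> (\<forall>i\<ge>N. \<chi> i = 0)}"

definition apply_field :: "nat \<Rightarrow> vfield \<Rightarrow> cpoly \<Rightarrow> cpoly" where
  "apply_field N \<chi> g = (\<Sum>i<N. \<chi> i * partial_deriv i g)"

definition linear_field :: "nat \<Rightarrow> vfield \<Rightarrow> bool" where
  "linear_field N \<chi> \<longleftrightarrow> (\<exists>\<xi> :: nat \<Rightarrow> nat \<Rightarrow> complex.
     \<chi> = (\<lambda>i. if i < N then \<Sum>j<N. poly_const (\<xi> i j) * poly_var j else 0))"

definition divisor_ideal :: "nat \<Rightarrow> cpoly \<Rightarrow> cpoly set" where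
  "divisor_ideal N f = {f * h | h. h \<in> poly_ring N}"

definition log_fields :: "nat \<Rightarrow> cpoly set \<Rightarrow> vfield set" where
  "log_fields N I = {\<chi> \<in> vector_fields N. \<forall>g\<in>I. apply_field N \<chi> g \<in> I}"

definition combination :: "(nat \<Rightarrow> cpoly) \<Rightarrow> vfield list \<Rightarrow> vfield" where
  "combination c \<delta>s = (\<lambda>i. \<Sum>k<length \<delta>s. c k * (\<delta>s ! k) i)"

definition field_span :: "nat \<Rightarrow> vfield list \<Rightarrow> vfield set" where
  "field_span N \<delta>s = {combination c \<delta>s | c. \<forall>k<length \<delta>s. c k \<in> poly_ring N}"

definition field_independent :: "nat \<Rightarrow> vfield list \<Rightarrow> bool" where
  "field_independent N \<delta>s \<longleftrightarrow>
     (\<forall>c. (\<forall>k<length \<delta>s. c k \<in> poly_ring N) \<and> combination c \<delta>s = (\<lambda>_. 0) \<longrightarrow>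
        (\<forall>k<length \<delta>s. c k = 0))"

definition module_basis :: "nat \<Rightarrow> vfield set \<Rightarrow> vfield list \<Rightarrow> bool" where
  "module_basis N M \<delta>s \<longleftrightarrow>
     set \<delta>s \<subseteq> M \<and> field_independent N \<delta>s \<and> M \<subseteq> field_span N \<delta>s"

text \<open>Every point has a principal open neighbourhood \<open>s \<noteq> 0\<close> over which the localisation \<open>M\<^sub>s\<close>
  is free of rank \<open>r\<close>.  Denominators are cleared: \<open>M\<close> is torsion free, so a basis of \<open>M\<^sub>s\<close> can be
  taken in \<open>M\<close>, and it generates \<open>M\<^sub>s\<close> iff each element of \<open>M\<close> times some power of \<open>s\<close>
  lies in its polynomial span.\<close>

definition locally_free :: "nat \<Rightarrow> nat \<Rightarrow> vfield set \<Rightarrow> bool" where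
  "locally_free N r M \<longleftrightarrow> (\<forall>x. \<exists>s\<in>poly_ring N. poly_eval s x \<noteq> 0 \<and>
     (\<exists>\<delta>s. length \<delta>s = r \<and> set \<delta>s \<subseteq> M \<and> field_independent N \<delta>s \<and>
        (\<forall>\<chi>\<in>M. \<exists>n. (\<lambda>i. s ^ n * \<chi> i) \<in> field_span N \<delta>s)))"

text \<open>The divisor \<open>f = 0\<close> in \<open>\<complex>\<^sup>N\<close> is a reduced hypersurface iff \<open>f\<close> is non-zero and squarefree.
  Factors of a non-zero element of \<^term>\<open>poly_ring N\<close> lie in \<^term>\<open>poly_ring N\<close>, so squarefreeness
  in \<^typ>\<open>cpoly\<close> is squarefreeness in the coordinate ring.  The empty divisor (\<open>f\<close> constant) is
  not excluded here: it occurs as the discriminant of the one-vertex tree, where \<open>N = 0\<close>.  For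
  \<open>N > 0\<close> it is never a linear free divisor, as then all vector fields are logarithmic.\<close>

definition free_divisor :: "nat \<Rightarrow> cpoly \<Rightarrow> bool" where
  "free_divisor N f \<longleftrightarrow> f \<in> poly_ring N \<and> f \<noteq> 0 \<and> squarefree f \<and>
     locally_free N N (log_fields N (divisor_ideal N f))"

definition linear_free_divisor :: "nat \<Rightarrow> cpoly \<Rightarrow> bool" where
  "linear_free_divisor N f \<longleftrightarrow> free_divisor N f \<and>
     (\<exists>\<delta>s. module_basis N (log_fields N (divisor_ideal N f)) \<delta>s \<and>
        (\<forall>\<delta>\<in>set \<delta>s. linear_field N \<delta>))"


section \<open>Quiver representations and the discriminant\<close>

text \<open>An orientation picks one of the two pairs of each edge; the pair \<open>(t, h)\<close> is the arrow
  from \<open>t\<close> to \<open>h\<close>.\<close>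

definition orientation :: "('v \<times> 'v) set \<Rightarrow> ('v \<times> 'v) set \<Rightarrow> bool" where
  "orientation E Q \<longleftrightarrow> Q \<union> Q\<inverse> = E \<and> Q \<inter> Q\<inverse> = {}"

type_synonym 'v coord = "('v \<times> 'v) \<times> nat \<times> nat"

text \<open>The coordinate \<open>((t, h), i, j)\<close> on \<open>Rep(Q, a)\<close> is the \<open>(i, j)\<close> entry of the
  \<open>a h \<times> a t\<close> matrix of the arrow \<open>(t, h)\<close>.\<close>

definition rep_coords :: "('v \<times> 'v) set \<Rightarrow> ('v \<Rightarrow> nat) \<Rightarrow> 'v coord set" where
  "rep_coords Q a = {((t, h), i, j) | t h i j. (t, h) \<in> Q \<and> i < a h \<and> j < a t}"

definition rep_dim :: "('v \<times> 'v) set \<Rightarrow> ('v \<Rightarrow> nat) \<Rightarrow> nat" where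
  "rep_dim Q a = card (rep_coords Q a)"

text \<open>The Lie algebra of \<open>GL(Q, a)\<close>, and a list of elements whose classes form a
  basis of its quotient by \<open>\<complex> id\<close>, the Lie algebra of \<open>PGL(Q, a)\<close>.\<close>

definition gl_algebra :: "'v set \<Rightarrow> ('v \<Rightarrow> nat) \<Rightarrow> ('v \<Rightarrow> complex mat) set" where
  "gl_algebra V a = {\<xi>. \<forall>v\<in>V. \<xi> v \<in> carrier_mat (a v) (a v)}"

definition gl_combination ::
  "('v \<Rightarrow> nat) \<Rightarrow> (nat \<Rightarrow> complex) \<Rightarrow> ('v \<Rightarrow> complex mat) list \<Rightarrow> 'v \<Rightarrow> complex mat" where
  "gl_combination a c B v = mat (a v) (a v) (\<lambda>(i, j). \<Sum>k<length B. c k * (B ! k) v $$ (i, j))"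

definition equal_mod_id ::
  "'v set \<Rightarrow> ('v \<Rightarrow> nat) \<Rightarrow> ('v \<Rightarrow> complex mat) \<Rightarrow> ('v \<Rightarrow> complex mat) \<Rightarrow> bool" where
  "equal_mod_id V a \<xi> \<eta> \<longleftrightarrow> (\<exists>l. \<forall>v\<in>V. \<xi> v = \<eta> v + l \<cdot>\<^sub>m 1\<^sub>m (a v))"

definition pgl_basis :: "'v set \<Rightarrow> ('v \<Rightarrow> nat) \<Rightarrow> ('v \<Rightarrow> complex mat) list \<Rightarrow> bool" where
  "pgl_basis V a B \<longleftrightarrow> set B \<subseteq> gl_algebra V a \<and>
     (\<forall>c. equal_mod_id V a (gl_combination a c B) (\<lambda>v. 0\<^sub>m (a v) (a v)) \<longrightarrow>
        (\<forall>k<length B. c k = 0)) \<and>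
     (\<forall>\<xi>\<in>gl_algebra V a. \<exists>c. equal_mod_id V a \<xi> (gl_combination a c B))"

text \<open>Differentiating \<open>g \<cdot> A = g\<^sub>h A g\<^sub>t\<^sup>-\<^sup>1\<close> at the identity in direction
  \<open>(X, Y) = (\<xi>\<^sub>h, \<xi>\<^sub>t)\<close>.  It is stated over any ring, because the coefficients of
  the vector field of \<open>\<xi>\<close> arise by applying it to matrices of coordinate functions.\<close>

definition inf_action :: "'r::comm_ring_1 mat \<Rightarrow> 'r mat \<Rightarrow> 'r mat \<Rightarrow> 'r mat" where
  "inf_action X Y A = X * A - A * Y"

lemma inf_action_derivative:
  fixes G H G' :: "complex \<Rightarrow> complex mat"
  assumes H: "\<And>s. H s \<in> carrier_mat m m" "H 0 = 1\<^sub>m m" "X \<in> carrier_mat m m"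
      "\<And>i j. i < m \<Longrightarrow> j < m \<Longrightarrow>
         ((\<lambda>s. H s $$ (i, j)) has_field_derivative X $$ (i, j)) (at 0)"
    and G: "\<And>s. G s \<in> carrier_mat n n" "G 0 = 1\<^sub>m n" "Y \<in> carrier_mat n n"
      "\<And>i j. i < n \<Longrightarrow> j < n \<Longrightarrow>
         ((\<lambda>s. G s $$ (i, j)) has_field_derivative Y $$ (i, j)) (at 0)"
    and G': "\<And>s. G' s \<in> carrier_mat n n" "\<And>s. G s * G' s = 1\<^sub>m n"
      "\<And>i j. i < n \<Longrightarrow> j < n \<Longrightarrow>
         ((\<lambda>s. G' s $$ (i, j)) has_field_derivative D i j) (at 0)"
    and A: "A \<in> carrier_mat m n" and ij: "i < m" "j < n"
  shows "((\<lambda>s. (H s * A * G' s) $$ (i, j)) has_field_derivative inf_action X Y A $$ (i, j)) (at 0)"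
proof -
  have prod_entry: "(P * R) $$ (i, j) = (\<Sum>k<q. P $$ (i, k) * R $$ (k, j))"
    if "P \<in> carrier_mat p q" "R \<in> carrier_mat q r" "i < p" "j < r"
    for P R :: "complex mat" and p q r i j
    using that by (auto simp: scalar_prod_def lessThan_atLeast0 intro!: sum.cong)
  have G'0: "G' 0 = 1\<^sub>m n"
    using G'(2)[of 0] G(2) G'(1)[of 0] by simp
  have D: "D k j = - Y $$ (k, j)" if k: "k < n" for k
  proof -
    have "((\<lambda>s. \<Sum>l<n. G s $$ (k, l) * G' s $$ (l, j)) has_field_derivative
        (\<Sum>l<n. Y $$ (k, l) * G' 0 $$ (l, j) + D l j * G 0 $$ (k, l))) (at 0)"
      using k ij by (intro DERIV_sum DERIV_mult G(4) G'(3)) auto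
    moreover have "(\<lambda>s. \<Sum>l<n. G s $$ (k, l) * G' s $$ (l, j)) = (\<lambda>_. 1\<^sub>m n $$ (k, j))"
      by (simp add: G'(2) flip: prod_entry[OF G(1) G'(1) k ij(2)])
    ultimately have "(\<Sum>l<n. Y $$ (k, l) * G' 0 $$ (l, j) + D l j * G 0 $$ (k, l)) = 0"
      using DERIV_unique[OF _ DERIV_const] by simp
    moreover have "(\<Sum>l<n. Y $$ (k, l) * G' 0 $$ (l, j) + D l j * G 0 $$ (k, l)) =
        (\<Sum>l<n. (if l = j then Y $$ (k, l) else 0) + (if k = l then D l j else 0))"
      using k ij by (intro sum.cong) (auto simp: G'0 G(2))
    ultimately show ?thesis
      using k ij by (simp add: sum.distrib add_eq_0_iff2)
  qed
  have deriv_HA: "((\<lambda>s. (H s * A) $$ (i, k)) has_field_derivative (X * A) $$ (i, k)) (at 0)"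
    if k: "k < n" for k
  proof -
    have "((\<lambda>s. \<Sum>l<m. H s $$ (i, l) * A $$ (l, k)) has_field_derivative
        (\<Sum>l<m. X $$ (i, l) * A $$ (l, k))) (at 0)"
      using ij by (intro DERIV_sum DERIV_cmult_right H(4)) auto
    then show ?thesis
      by (simp add: prod_entry[OF H(1) A ij(1) k] prod_entry[OF H(3) A ij(1) k])
  qed
  have HA: "H s * A \<in> carrier_mat m n" for s
    by (rule mult_carrier_mat[OF H(1) A])
  have "((\<lambda>s. \<Sum>k<n. (H s * A) $$ (i, k) * G' s $$ (k, j)) has_field_derivative
      (\<Sum>k<n. (X * A) $$ (i, k) * G' 0 $$ (k, j) + D k j * (H 0 * A) $$ (i, k))) (at 0)"
    using ij by (intro DERIV_sum DERIV_mult deriv_HA G'(3)) auto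
  moreover have "(\<Sum>k<n. (X * A) $$ (i, k) * G' 0 $$ (k, j) + D k j * (H 0 * A) $$ (i, k)) =
      (\<Sum>k<n. (if k = j then (X * A) $$ (i, k) else 0) - A $$ (i, k) * Y $$ (k, j))"
    using ij A by (intro sum.cong) (auto simp: G'0 H(2) D)
  moreover have "\<dots> = inf_action X Y A $$ (i, j)"
    using ij A H(3) G(3) prod_entry[OF A G(3) ij]
    by (simp add: sum_subtractf inf_action_def)
  ultimately show ?thesis
    by (simp add: prod_entry[OF HA G'(1) ij])
qed

text \<open>The numbering \<open>e\<close> of the coordinates identifies \<open>Rep(Q, a)\<close> with \<open>\<complex>\<^sup>N\<close>.\<close>

definition generic_mat ::
  "('v \<times> 'v) set \<Rightarrow> ('v \<Rightarrow> nat) \<Rightarrow> (nat \<Rightarrow> 'v coord) \<Rightarrow> 'v \<times> 'v \<Rightarrow> cpoly mat" where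
  "generic_mat Q a e \<alpha> = mat (a (snd \<alpha>)) (a (fst \<alpha>))
     (\<lambda>(i, j). poly_var (inv_into {..<rep_dim Q a} e (\<alpha>, i, j)))"

definition action_field ::
  "('v \<times> 'v) set \<Rightarrow> ('v \<Rightarrow> nat) \<Rightarrow> (nat \<Rightarrow> 'v coord) \<Rightarrow> ('v \<Rightarrow> complex mat) \<Rightarrow> vfield" where
  "action_field Q a e \<xi> l = (if l < rep_dim Q a
     then case e l of ((t, h), i, j) \<Rightarrow>
       inf_action (map_mat poly_const (\<xi> h)) (map_mat poly_const (\<xi> t)) (generic_mat Q a e (t, h))
         $$ (i, j)
     else 0)"

text \<open>Recall that \<^const>\<open>det\<close> is zero on matrices that are not square; for a basis \<open>B\<close> the matrix is
  square iff \<open>PGL(Q, a)\<close> and \<open>Rep(Q, a)\<close> have the same dimension.\<close>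

definition coefficient_matrix ::
  "('v \<times> 'v) set \<Rightarrow> ('v \<Rightarrow> nat) \<Rightarrow> (nat \<Rightarrow> 'v coord) \<Rightarrow> ('v \<Rightarrow> complex mat) list \<Rightarrow> cpoly mat" where
  "coefficient_matrix Q a e B =
     mat (length B) (rep_dim Q a) (\<lambda>(k, l). action_field Q a e (B ! k) l)"

definition discriminant ::
  "('v \<times> 'v) set \<Rightarrow> ('v \<Rightarrow> nat) \<Rightarrow> (nat \<Rightarrow> 'v coord) \<Rightarrow> ('v \<Rightarrow> complex mat) list \<Rightarrow> cpoly" where
  "discriminant Q a e B = det (coefficient_matrix Q a e B)"

end

theory Submission
  imports Defs
    "HOL-Library.Function_Algebras"
    "HOL-Algebra.Algebraic_Closure_Type"
    "Jordan_Normal_Form.Char_Poly"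
begin

text \<open>A sincere root has value \<open>1\<close> at the vertex of weight \<open>3\<close>, and the genus condition says that
  the Tits form of the quiver is positive on all smaller dimension vectors, although the quiver
  need not be Dynkin.  Ringel's argument then shows that every representation \<open>y\<close> of these
  dimensions, over any field, is a sum of representations without self-extensions.  Consequently a
  tangent direction whose class modulo the orbit of \<open>y\<close> commutes with the endomorphisms of \<open>y\<close> is
  tangent to the orbit.

  Derivations of the field of definition of a generic point \<open>y\<close> give such directions:
  differentiate the equation \<open>\<xi> y = 0\<close> of an endomorphism \<open>\<xi>\<close>.  For the generic point of the
  representation space this shows that there is an open orbit, so that \<open>f = det \<Delta>\<close> is not
  zero.  For the points of the discriminant on the generic line \<open>x + t v\<close> it shows that \<open>f (x + t
  v)\<close> has only simple roots in \<open>t\<close>. Its leading coefficient is the constant \<open>f v\<close>.  Hence \<open>f\<close> is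
  squarefree, and \<open>f\<close> divides \<open>g\<close> as soon as it divides all products of \<open>g\<close> with partial
  derivatives of \<open>f\<close>; Saito's criterion follows with Cramer's rule.\<close>

text \<open>Put q(d) for the sum of the squares d_v^2 minus the sum of the products d_h d_t over the
  arrows. For 0 \<le> d \<le> a the entry d_0 at the vertex of weight 3 is 0 or 1, so d_0^2 = d_0,
  and the terms of that vertex cancel in the genus: p_a(d) = 1 - q(d). Hence p_a \<le> 0 is exactly
  q(d) \<ge> 1. For the root itself, self-intersection -3 means q(a) = 1, which is the equality of
  the dimensions of PGL and Rep. The obstacle is that q is controlled only on this box. No
  classification of the representations of the quiver can be used, only arguments that stay among
  subrepresentations and summands, whose dimension vectors remain below a. This is why everything
  rests on Ringel's induction and on one dimension count for representations whose non-zero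
  endomorphisms are all invertible. Orbit dimensions and components of the discriminant are not
  treated geometrically. A generic point is a tuple of elements of a large field, and derivations of
  that field supply tangent vectors by pure algebra. The price is that one has to recognise when
  such a vector is tangent to the orbit; commuting with endomorphisms is the criterion.\<close>

hide_const (open) Polynomial_Divisibility.poly_ring Polynomials.degree Polynomials.lead_coeff
  up_ring.coeff up_ring.monom

section \<open>Representations over a ring of graded endomorphisms\<close>

lemma mult_assoc_extend:
  fixes a b c x :: "'a::semigroup_mult"
  shows "a * b = c \<Longrightarrow> a * (b * x) = c * x"
  by (simp flip: mult.assoc)

text \<open>\<open>'g\<close> models families of linear maps at the vertices and \<open>'r\<close> families along the arrows; \<open>hd\<close>
  and \<open>tl\<close> pull a vertex family back along the head and the tail of the arrows.  A graded subspace
  is represented by an idempotent \<open>e\<close>, a representation on it by \<open>A = e A e\<close>.  Subspaces are not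
  required to be spanned by coordinate vectors, so kernels and images need no change of basis.\<close>

locale rep_rings =
  fixes hd tl :: "'g::ring \<Rightarrow> 'r::ring" and u :: 'g and rk :: "'g \<Rightarrow> nat"
  assumes hd_add: "hd (x + y) = hd x + hd y" and tl_add: "tl (x + y) = tl x + tl y"
    and hd_mult: "hd (x * y) = hd x * hd y" and tl_mult: "tl (x * y) = tl x * tl y"
    and regular: "\<exists>g. x * g * x = x"
    and rk_mult_right: "u * t = t \<Longrightarrow> t * u = t \<Longrightarrow> rk (x * t) \<le> rk t"
    and rk_mult_left: "u * t = t \<Longrightarrow> t * u = t \<Longrightarrow> rk (t * x) \<le> rk t"
    and rk_eq_right: "u * t = t \<Longrightarrow> t * u = t \<Longrightarrow> rk (x * t) = rk t \<Longrightarrow> \<exists>l. l * x * t = t"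
    and rk_eq_left: "u * t = t \<Longrightarrow> t * u = t \<Longrightarrow> rk (t * x) = rk t \<Longrightarrow> \<exists>r. t * x * r = t"
    and brick: "\<lbrakk>u * e = e; e * u = e; e * e = e; e \<noteq> 0; hd e * A = A; A * tl e = A;
       \<And>\<phi>. e * \<phi> = \<phi> \<Longrightarrow> \<phi> * e = \<phi> \<Longrightarrow> hd \<phi> * A = A * tl \<phi> \<Longrightarrow> \<phi> \<noteq> 0 \<Longrightarrow> rk \<phi> = rk e;
       hd e * \<psi> = \<psi>; \<psi> * tl e = \<psi>\<rbrakk> \<Longrightarrow> \<exists>\<xi>. \<psi> = hd \<xi> * A - A * tl \<xi>"
begin

definition rep :: "'g \<Rightarrow> 'r \<Rightarrow> bool" where
  "rep e A \<longleftrightarrow> u * e = e \<and> e * u = e \<and> e * e = e \<and> hd e * A = A \<and> A * tl e = A"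

definition End :: "'g \<Rightarrow> 'r \<Rightarrow> 'g set" where
  "End e A = {\<phi>. e * \<phi> = \<phi> \<and> \<phi> * e = \<phi> \<and> hd \<phi> * A = A * tl \<phi>}"

text \<open>Vanishing of the self-extensions: \<open>Ext^1\<close> of quiver representations is the
  cokernel of \<open>\<xi> \<mapsto> hd \<xi> * A - A * tl \<xi>\<close>. The family
  \<open>\<xi>\<close> may be arbitrary, since replacing it by \<open>e * \<xi> * e\<close> gives
  the same \<open>\<psi>\<close>.\<close>

definition rigid :: "'g \<Rightarrow> 'r \<Rightarrow> bool" where
  "rigid e A \<longleftrightarrow> (\<forall>\<psi>. hd e * \<psi> = \<psi> \<longrightarrow> \<psi> * tl e = \<psi> \<longrightarrow> (\<exists>\<xi>. \<psi> = hd \<xi> * A - A * tl \<xi>))"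

definition indecomposable :: "'g \<Rightarrow> 'r \<Rightarrow> bool" where
  "indecomposable e A \<longleftrightarrow> (\<forall>f\<in>End e A. f * f = f \<longrightarrow> f = 0 \<or> f = e)"

lemma hd_0 [simp]: "hd 0 = 0" and tl_0 [simp]: "tl 0 = 0"
  using hd_add[of 0 0] tl_add[of 0 0] by simp_all

lemma hd_diff: "hd (x - y) = hd x - hd y" and tl_diff: "tl (x - y) = tl x - tl y"
  using hd_add[of "x - y" y] tl_add[of "x - y" y] by (simp_all add: algebra_simps)

lemmas hom_simps = hd_add tl_add hd_diff tl_diff hd_mult tl_mult

lemma EndD:
  assumes "\<phi> \<in> End e A"
  shows "e * \<phi> = \<phi>" "\<phi> * e = \<phi>" "hd \<phi> * A = A * tl \<phi>"
    "e * (\<phi> * x) = \<phi> * x" "\<phi> * (e * x) = \<phi> * x"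
  using assms by (auto simp: End_def mult_assoc_extend)

lemma End_carrier:
  assumes "rep e A" "\<phi> \<in> End e A"
  shows "u * \<phi> = \<phi>" "\<phi> * u = \<phi>"
proof -
  have e: "u * e = e" "e * u = e" "e * \<phi> = \<phi>" "\<phi> * e = \<phi>" using assms by (auto simp: rep_def End_def)
  have "u * (e * \<phi>) = e * \<phi>" "(\<phi> * e) * u = \<phi> * e"
    by (simp_all only: e(2) mult.assoc) (simp only: e(1) flip: mult.assoc)
  then show "u * \<phi> = \<phi>" "\<phi> * u = \<phi>" by (simp_all only: e)
qed

lemma End_mult:
  assumes "\<phi> \<in> End e A" "\<psi> \<in> End e A"
  shows "\<phi> * \<psi> \<in> End e A"
proof -
  have "hd (\<phi> * \<psi>) * A = hd \<phi> * (hd \<psi> * A)" by (simp add: hom_simps mult.assoc)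
  also have "\<dots> = hd \<phi> * A * tl \<psi>" by (simp only: EndD(3)[OF assms(2)] mult.assoc)
  also have "\<dots> = A * tl (\<phi> * \<psi>)" by (simp only: EndD(3)[OF assms(1)] mult.assoc hom_simps)
  finally show ?thesis
    using assms by (auto simp: End_def mult.assoc mult_assoc_extend)
qed

lemma End_unit: "rep e A \<Longrightarrow> e \<in> End e A"
  by (simp add: rep_def End_def)

lemma End_diff: "\<phi> \<in> End e A \<Longrightarrow> \<psi> \<in> End e A \<Longrightarrow> \<phi> - \<psi> \<in> End e A"
  by (simp add: End_def hom_simps algebra_simps)

text \<open>Fitting's lemma at index one: the hypotheses make image and kernel of
  \<open>\<theta>\<close> complementary, and \<open>f\<close> projects onto the image along the
  kernel. Of its two forms, \<open>e * l * \<theta>\<close> shows that \<open>A\<close> preserves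
  the kernel (\<open>fA1\<close>) and \<open>\<theta> * (r * e)\<close> that it preserves the image
  (\<open>fA2\<close>).\<close>

lemma strongly_regular_idempotent:
  assumes r: "rep e A" and t: "\<theta> \<in> End e A" and l: "l * \<theta> * \<theta> = \<theta>" and r: "\<theta> * \<theta> * r = \<theta>"
  shows "\<exists>f\<in>End e A. f * f = f \<and> f * \<theta> = \<theta> \<and> (\<exists>l. l * \<theta> = f)"
proof -
  define f where "f = e * l * \<theta>"
  have ee: "e * e = e" "e * (e * x) = e * x" for x
    using assms by (auto simp: rep_def mult_assoc_extend)
  note t1 = EndD[OF t]
  have lt: "l * (\<theta> * \<theta>) = \<theta>" "\<theta> * (\<theta> * r) = \<theta>" using assms by (simp_all add: mult.assoc)
  have f2: "f = \<theta> * r"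
    unfolding f_def by (metis lt mult.assoc t1(1))
  have f2': "f = \<theta> * (r * e)"
    unfolding mult.assoc[symmetric] f2[symmetric] by (simp add: f_def mult.assoc t1)
  have ft: "f * \<theta> = \<theta>" "\<theta> * f = \<theta>"
    by (simp add: f_def mult.assoc lt t1) (simp add: f2 mult.assoc lt)
  have ff: "f * f = f"
    by (metis f2 ft(1) mult.assoc)
  have fA1: "hd f * A = hd f * A * tl f"
  proof -
    have "hd f * A = hd (e * l) * A * tl \<theta>" by (simp add: f_def hom_simps mult.assoc t1)
    also have "\<dots> = hd (e * l) * A * tl (\<theta> * f)" by (simp add: ft)
    also have "\<dots> = hd (e * l) * (A * tl \<theta>) * tl f" by (simp only: hom_simps mult.assoc)
    also have "\<dots> = hd f * A * tl f" unfolding t1(3)[symmetric]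
      by (simp add: f_def hom_simps mult.assoc)
    finally show ?thesis .
  qed
  have fA2: "A * tl f = hd f * A * tl f"
  proof -
    have "A * tl f = hd \<theta> * A * tl (r * e)" by (subst f2', simp add: hom_simps t1 flip: mult.assoc)
    also have "\<dots> = hd (f * \<theta>) * A * tl (r * e)" by (simp add: ft)
    also have "\<dots> = hd f * (hd \<theta> * A) * tl (r * e)" by (simp only: hom_simps mult.assoc)
    also have "\<dots> = hd f * A * tl f" unfolding t1(3) by (subst (2) f2', simp add: hom_simps mult.assoc)
    finally show ?thesis .
  qed
  have "f \<in> End e A"
    unfolding End_def using fA1[folded fA2] by (simp add: f_def mult.assoc ee t1)
  then show ?thesis using ff ft f_def by blast
qed

text \<open>Ringel's argument: let \<open>\<theta>\<close> be a non-zero, non-invertible endomorphism of least rank.  Then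
  \<open>\<theta>\<^sup>2 = 0\<close>, so the image \<open>\<omega>\<close> of \<open>\<theta>\<close> lies in its kernel \<open>\<kappa>\<close>, and \<open>\<omega>\<close> projects injectively to some
  indecomposable summand \<open>k\<close> of the kernel.  By induction \<open>k\<close> is rigid, hence so is every pair
  \<open>(\<omega>, k)\<close>, and the pushout of \<open>0 \<rightarrow> \<kappa> \<rightarrow> e \<rightarrow> \<omega> \<rightarrow> 0\<close> along \<open>\<kappa> \<rightarrow> k\<close> splits: \<open>k\<close> is a summand of \<open>e\<close>.\<close>

lemma rigid_if_indecomposable:
  assumes "rep e A" "e \<noteq> 0" "indecomposable e A"
  shows "rigid e A"
  using assms
proof (induction "rk e" arbitrary: e A rule: less_induct)
  case less
  note ind = less.prems(3)[unfolded indecomposable_def, rule_format]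
  show ?case
  proof (cases "\<forall>\<phi>\<in>End e A. \<phi> \<noteq> 0 \<longrightarrow> rk \<phi> = rk e")
    case True
    show ?thesis
      unfolding rigid_def
    proof (intro allI impI)
      fix \<psi> assume \<psi>: "hd e * \<psi> = \<psi>" "\<psi> * tl e = \<psi>"
      have e: "u * e = e" "e * u = e" "e * e = e" "hd e * A = A" "A * tl e = A"
        using less.prems(1) by (auto simp: rep_def)
      have "rk \<phi> = rk e" if "e * \<phi> = \<phi>" "\<phi> * e = \<phi>" "hd \<phi> * A = A * tl \<phi>" "\<phi> \<noteq> 0" for \<phi>
        using True that by (simp add: End_def)
      from brick[OF e(1-3) less.prems(2) e(4,5) this \<psi>]
      show "\<exists>\<xi>. \<psi> = hd \<xi> * A - A * tl \<xi>" .
    qed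
  next
    case False
    have e: "e * e = e" "u * e = e" "e * u = e" "hd e * A = A" "A * tl e = A"
      using less.prems(1) by (auto simp: rep_def)
    have rk_le: "rk \<phi> \<le> rk e" if "\<phi> \<in> End e A" for \<phi>
      using rk_mult_right[of e \<phi>] e EndD(2)[OF that] by simp
    obtain \<theta> where \<theta>: "\<theta> \<in> End e A" "\<theta> \<noteq> 0" "rk \<theta> < rk e"
      and min: "\<And>\<phi>. \<phi> \<in> End e A \<Longrightarrow> \<phi> \<noteq> 0 \<Longrightarrow> rk \<phi> < rk e \<Longrightarrow> rk \<theta> \<le> rk \<phi>"
    proof -
      let ?P = "\<lambda>\<phi>. \<phi> \<in> End e A \<and> \<phi> \<noteq> 0 \<and> rk \<phi> < rk e"
      from False obtain \<phi> where "?P \<phi>" using rk_le by (metis le_neq_implies_less)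
      from that ex_has_least_nat[of ?P, OF this, of rk] show ?thesis by blast
    qed
    note t1 = EndD[OF \<theta>(1)] End_carrier[OF less.prems(1) \<theta>(1)]
    \<comment> \<open>By minimality a non-zero square would have the rank of
      \<open>\<theta>\<close>, and the projection onto the image of \<open>\<theta>\<close> would be
      an idempotent endomorphism other than \<open>0\<close> and \<open>e\<close>.\<close>
    have sq0: "\<theta> * \<theta> = 0"
    proof (rule ccontr)
      assume nz: "\<theta> * \<theta> \<noteq> 0"
      have "rk (\<theta> * \<theta>) = rk \<theta>"
        using min[OF End_mult[OF \<theta>(1) \<theta>(1)] nz] rk_mult_right[of \<theta> \<theta>] t1 \<theta>(3) by simp
      then obtain l r where "l * \<theta> * \<theta> = \<theta>" "\<theta> * \<theta> * r = \<theta>"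
        using rk_eq_right[of \<theta> \<theta>] rk_eq_left[of \<theta> \<theta>] t1 by auto
      from strongly_regular_idempotent[OF less.prems(1) \<theta>(1) this]
      obtain f l where f: "f \<in> End e A" "f * f = f" "f * \<theta> = \<theta>" "l * \<theta> = f" by blast
      with ind[of f] \<theta>(2) have "f = e" by auto
      then have "rk e \<le> rk \<theta>" using rk_mult_right[of \<theta> l] t1 f by simp
      with \<theta>(3) show False by simp
    qed
    obtain g0 where g0: "\<theta> * g0 * \<theta> = \<theta>" using regular by blast
    define g where "g = e * (g0 * \<theta> * g0) * e"
    have ee: "e * (e * x) = e * x" for x by (simp add: e mult_assoc_extend)
    have g0': "\<theta> * (g0 * \<theta>) = \<theta>" "\<theta> * (g0 * (\<theta> * x)) = \<theta> * x" for x
      using g0 by (metis mult.assoc)+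
    have g: "e * g = g" "g * e = g" "\<theta> * (g * \<theta>) = \<theta>" "g * (\<theta> * g) = g" 
      "\<theta> * (g * (\<theta> * x)) = \<theta> * x" "g * (\<theta> * (g * x)) = g * x" for x
      by (simp_all add: g_def mult.assoc e ee t1 g0')
    \<comment> \<open>Projections chosen vertex by vertex, in general not endomorphisms:
      \<open>\<kappa>\<close> onto the kernel of \<open>\<theta>\<close>, \<open>p\<close> onto a
      complement of it, \<open>\<omega>\<close> onto the image.\<close>
    define p \<kappa> \<omega> where "p = g * \<theta>" and "\<kappa> = e - p" and "\<omega> = \<theta> * g"
    have tk: "\<theta> * \<kappa> = 0" by (simp add: \<kappa>_def p_def algebra_simps t1 g)
    have pp: "p * p = p" "e * p = p" "p * e = p" "\<theta> * p = \<theta>"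
      by (simp_all add: p_def mult.assoc g t1 mult_assoc_extend[OF g(1)])
    have kk: "\<kappa> * \<kappa> = \<kappa>" "e * \<kappa> = \<kappa>" "\<kappa> * e = \<kappa>" "\<kappa> * p = 0" "p * \<kappa> = 0" "\<kappa> + p = e"
      by (simp_all add: \<kappa>_def algebra_simps pp e)
    have kt: "\<kappa> * \<theta> = \<theta>"
      by (simp add: \<kappa>_def p_def algebra_simps t1 sq0 mult.assoc)
    have ko: "\<kappa> * \<omega> = \<omega>" by (simp add: \<omega>_def kt flip: mult.assoc)
    have ot: "\<omega> * \<theta> = \<theta>" by (simp add: \<omega>_def mult.assoc g)
    have kAk: "hd \<kappa> * (A * tl \<kappa>) = A * tl \<kappa>"
    proof -
      have "hd \<theta> * A * tl \<kappa> = A * tl (\<theta> * \<kappa>)" by (simp only: t1 hom_simps mult.assoc)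
      then have "hd g * (hd \<theta> * A * tl \<kappa>) = 0" by (simp add: tk)
      then show ?thesis
        by (simp add: \<kappa>_def p_def hom_simps algebra_simps e mult.assoc)
           (simp add: e flip: mult.assoc)
    qed
    have repK: "rep \<kappa> (A * tl \<kappa>)"
      unfolding rep_def using kAk kk e
      by (simp add: mult.assoc flip: tl_mult) (metis kk(2,3) e(2,3) mult.assoc)
    \<comment> \<open>Least rank stands in for a decomposition of the kernel into indecomposables:
      if \<open>k\<close> splits, one of the two summands still does not kill
      \<open>\<omega>\<close>, so by minimality it is all of \<open>k\<close>.\<close>
    obtain k where k: "k \<in> End \<kappa> (A * tl \<kappa>)" "k * k = k" "k * \<omega> \<noteq> 0"
      and kmin: "\<And>f. f \<in> End \<kappa> (A * tl \<kappa>) \<Longrightarrow> f * f = f \<Longrightarrow> f * \<omega> \<noteq> 0 \<Longrightarrow> rk k \<le> rk f"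
    proof -
      let ?P = "\<lambda>f. f \<in> End \<kappa> (A * tl \<kappa>) \<and> f * f = f \<and> f * \<omega> \<noteq> 0"
      have "?P \<kappa>" using repK kk ko ot \<theta>(2) by (auto simp: End_unit)
      from that ex_has_least_nat[of ?P, OF this, of rk] show ?thesis by blast
    qed
    note k1 = EndD[OF k(1)] End_carrier[OF repK k(1)]
    have kke: "e * k = k" "k * e = k" using k1(1,2) kk by (metis mult.assoc)+
    have kA: "hd k * (A * tl \<kappa>) = A * tl k" 
      using k1(3) by (simp add: mult.assoc k1 flip: tl_mult)
    have kAk': "hd k * (A * tl k) = A * tl k"
    proof -
      have "hd k * (A * tl k) = hd k * (A * tl (\<kappa> * k))" by (simp only: k1(1))
      also have "\<dots> = hd k * (A * tl \<kappa>) * tl k" by (simp only: hom_simps mult.assoc)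
      also have "\<dots> = A * tl (k * k)" by (simp only: kA hom_simps mult.assoc)
      finally show ?thesis by (simp only: k)
    qed
    have repk: "rep k (A * tl k)"
      unfolding rep_def using kAk' k k1 by (simp add: mult.assoc flip: tl_mult)
    have sub: "f \<in> End \<kappa> (A * tl \<kappa>)" if f: "f \<in> End k (A * tl k)" for f
    proof -
      note f1 = EndD[OF f]
      have "hd f * (A * tl \<kappa>) = hd f * (hd k * (A * tl \<kappa>))"
        by (simp add: f1 flip: mult.assoc hd_mult)
      also have "\<dots> = A * tl f"
        using f1(3) by (simp add: kA mult.assoc f1 flip: tl_mult)
      also have "\<dots> = A * tl \<kappa> * tl f"
        by (metis f1(1) k1(1) mult.assoc tl_mult)
      finally show ?thesis
        unfolding End_def using f1 k1 by simp (metis f1(1,2) k1(1,2) mult.assoc)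
    qed
    have indk: "indecomposable k (A * tl k)"
      unfolding indecomposable_def
    proof (intro ballI impI)
      fix f assume f: "f \<in> End k (A * tl k)" and ff: "f * f = f"
      note f1 = EndD[OF f]
      have eq: "l = k" if l: "l \<in> End k (A * tl k)" "l * l = l" "l * \<omega> \<noteq> 0" for l
      proof -
        have "rk (l * k) = rk k"
          using kmin[OF sub[OF l(1)] l(2,3)] rk_mult_right[of k l] k1 by (simp add: EndD[OF l(1)])
        then obtain m where "m * l * k = k" using rk_eq_right[of k l] k1 by auto
        then have "m * l = k" by (simp add: EndD[OF l(1)] mult.assoc)
        then show ?thesis
          by (metis EndD(1)[OF l(1)] l(2) mult.assoc)
      qed
      have "k - f \<in> End k (A * tl k)" by (intro End_diff End_unit repk f)
      moreover have "(k - f) * (k - f) = k - f" by (simp add: algebra_simps f1 ff k)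
      moreover have "f * \<omega> \<noteq> 0 \<or> (k - f) * \<omega> \<noteq> 0" using k(3) by (auto simp: algebra_simps)
      ultimately have "f = k \<or> k - f = k" using eq f ff by blast
      then show "f = 0 \<or> f = k" by auto
    qed
    have "k \<noteq> 0" using k(3) by auto
    have kp: "k * p = 0" by (metis k1(2) kk(4) mult.assoc mult_zero_right)
    have "rk k < rk e"
    proof (rule ccontr)
      assume "\<not> rk k < rk e"
      then have "rk (k * e) = rk e" using rk_mult_right[of e k] e kke by simp
      then obtain l where "l * k * e = e" using rk_eq_right[of e k] e by auto
      then have "e * p = 0" by (metis kp pp(2) mult.assoc mult_zero_right)
      with \<theta>(2) pp show False by simp
    qed
    with less.hyps[OF _ repk \<open>k \<noteq> 0\<close> indk] have rig: "rigid k (A * tl k)" .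
    \<comment> \<open>Minimality of \<open>\<theta>\<close> is applied to this endomorphism: it has
      the rank of \<open>\<theta>\<close>, so \<open>k\<close> is injective on the image of
      \<open>\<theta>\<close>, and \<open>l\<close> below inverts it there.\<close>
    have kt_End: "k * \<theta> \<in> End e A"
    proof -
      have "hd (k * \<theta>) * A = hd k * (A * tl (\<kappa> * \<theta>))"
        by (simp add: kt) (simp add: hom_simps mult.assoc t1)
      also have "\<dots> = (hd k * (A * tl \<kappa>)) * tl \<theta>"
        by (simp only: hom_simps mult.assoc)
      also have "\<dots> = A * tl (k * \<theta>)"
        by (simp add: kA) (simp only: hom_simps mult.assoc)
      finally show ?thesis
        unfolding End_def using kke t1 by (simp add: mult.assoc mult_assoc_extend)
    qed
    have "k * \<theta> \<noteq> 0"
      using k(3) by (auto simp: \<omega>_def simp flip: mult.assoc)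
    moreover have "rk (k * \<theta>) \<le> rk \<theta>" by (rule rk_mult_right) (simp_all add: t1)
    ultimately have "rk (k * \<theta>) = rk \<theta>"
      using min[OF kt_End] \<theta>(3) by simp
    then obtain l where l: "l * k * \<theta> = \<theta>" using rk_eq_right[of \<theta> k] t1 by auto
    \<comment> \<open>\<open>hd k * A * tl g\<close> is the cocycle of the pushed-out sequence,
      living on the image of \<open>\<theta>\<close>. As any family along the arrows is a cocycle,
      composition with \<open>l * k\<close> extends it to \<open>k\<close>, where rigidity
      applies.\<close>
    define \<psi> where "\<psi> = hd k * A * tl (g * l * k)"
    have "hd k * \<psi> = \<psi>" "\<psi> * tl k = \<psi>"
      by (simp_all add: \<psi>_def k flip: hd_mult tl_mult mult.assoc)
         (simp add: k mult.assoc flip: tl_mult)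
    with rig obtain \<xi>0 where \<xi>0: "\<psi> = hd \<xi>0 * (A * tl k) - A * tl k * tl \<xi>0"
      unfolding rigid_def by blast
    define \<xi> where "\<xi> = k * \<xi>0 * k"
    have \<xi>: "\<psi> = hd \<xi> * A * tl k - A * tl \<xi>"
    proof -
      have "\<psi> = hd k * \<psi> * tl k" by (simp add: \<open>hd k * \<psi> = \<psi>\<close> \<open>\<psi> * tl k = \<psi>\<close>)
      also have "\<dots> = hd k * (hd \<xi>0 * (A * tl k)) * tl k - hd k * (A * tl k * tl \<xi>0) * tl k"
        by (simp add: \<xi>0 algebra_simps)
      also have "hd k * (hd \<xi>0 * (A * tl k)) * tl k = hd (k * \<xi>0) * (hd k * (A * tl k))"
        by (simp add: kAk' hom_simps mult.assoc) (simp add: k flip: tl_mult)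
      also have "\<dots> = hd \<xi> * A * tl k" by (simp add: \<xi>_def hom_simps mult.assoc)
      also have "hd k * (A * tl k * tl \<xi>0) * tl k = hd k * (A * tl k) * tl (\<xi>0 * k)"
        by (simp add: hom_simps mult.assoc)
      also have "\<dots> = A * tl \<xi>" by (simp add: kAk' \<xi>_def hom_simps mult.assoc)
      finally show ?thesis .
    qed
    have \<xi>k: "k * \<xi> = \<xi>" "\<xi> * k = \<xi>"
      by (simp_all add: \<xi>_def mult.assoc k mult_assoc_extend[OF k(2)])
    \<comment> \<open>The projection \<open>k\<close> fails to commute with \<open>A\<close> by
      \<open>hd k * A * tl p\<close>, and \<open>\<xi> * \<theta>\<close> has the same defect. The
      difference is an idempotent endomorphism of \<open>e\<close> with image \<open>k\<close>,
      against indecomposability.\<close>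
    define \<rho> where "\<rho> = k - \<xi> * \<theta>"
    have "hd (\<xi> * \<theta>) * A - A * tl (\<xi> * \<theta>) = hd k * A - A * tl k"
    proof -
      have "hd k * A * tl p = \<psi> * tl (k * \<theta>)"
      proof -
        have "\<psi> * tl (k * \<theta>) = hd k * A * tl (g * (l * (k * k) * \<theta>))"
          by (simp only: \<psi>_def hom_simps mult.assoc)
        also have "\<dots> = hd k * A * tl (g * \<theta>)" by (simp add: k l)
        finally show ?thesis by (simp add: p_def)
      qed
      also have "\<dots> = hd \<xi> * (A * tl (k * k * \<theta>)) - A * tl (\<xi> * k * \<theta>)"
        by (simp only: \<xi> hom_simps mult.assoc left_diff_distrib)
      also have "\<dots> = hd \<xi> * (A * tl (k * \<theta>)) - A * tl (\<xi> * \<theta>)"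
        by (simp add: k \<xi>k)
      also have "A * tl (k * \<theta>) = hd (k * \<theta>) * A" using EndD(3)[OF kt_End] by simp
      also have "hd \<xi> * (hd (k * \<theta>) * A) = hd (\<xi> * k * \<theta>) * A" by (simp only: hom_simps mult.assoc)
      finally have 1: "hd k * A * tl p = hd (\<xi> * \<theta>) * A - A * tl (\<xi> * \<theta>)" by (simp add: \<xi>k)
      have "hd k * A = hd k * (A * tl (\<kappa> + p))" by (simp add: kk e)
      also have "\<dots> = A * tl k + hd k * A * tl p"
        by (simp add: hom_simps distrib_left kA mult.assoc)
      finally show ?thesis using 1 by simp
    qed
    then have "hd \<rho> * A = A * tl \<rho>"
      by (simp add: \<rho>_def hd_diff tl_diff algebra_simps)
    moreover have "e * \<rho> = \<rho>" "\<rho> * e = \<rho>"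
      unfolding \<rho>_def using kke t1 \<xi>k by (simp_all add: algebra_simps) (metis kke(1) mult.assoc)
    ultimately have "\<rho> \<in> End e A" by (simp add: End_def)
    moreover have rk: "\<rho> * \<kappa> = k" by (simp add: \<rho>_def left_diff_distrib mult.assoc tk k1)
    moreover have kr: "k * \<rho> = \<rho>" by (simp add: \<rho>_def right_diff_distrib k mult_assoc_extend[OF
      \<xi>k(1)])
    moreover have kr': "\<kappa> * \<rho> = \<rho>" by (metis kr k1(1) mult.assoc)
    moreover have "\<rho> * \<rho> = \<rho>" by (metis kr kr' rk mult.assoc)
    ultimately have "\<rho> = 0 \<or> \<rho> = e" using ind by blast
    moreover have "\<rho> \<noteq> 0" using rk \<open>k \<noteq> 0\<close> by auto
    moreover have "\<rho> \<noteq> e"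
    proof
      assume "\<rho> = e"
      with kr' kk(3) have "\<kappa> = e" by simp
      with tk t1(2) \<theta>(2) show False by simp
    qed
    ultimately show ?thesis by blast
  qed
qed

section \<open>Extension classes that commute with all endomorphisms\<close>

lemma summand:
  assumes r: "rep e A" and f: "f \<in> End e A" "f * f = f"
  shows "rep f (A * tl f)" "End f (A * tl f) \<subseteq> End e A"
proof -
  note f1 = EndD[OF f(1)] End_carrier[OF r f(1)]
  show "rep f (A * tl f)"
    unfolding rep_def using f f1 by (simp add: mult.assoc flip: tl_mult f1(3))
      (simp add: f(2) f1(3)[symmetric] flip: mult.assoc hd_mult)
  show "End f (A * tl f) \<subseteq> End e A"
  proof
    fix x assume x: "x \<in> End f (A * tl f)"
    note x1 = EndD[OF x]
    have "hd x * A = hd x * (hd f * A)" by (simp add: x1 flip: mult.assoc hd_mult)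
    also have "\<dots> = hd x * (A * tl f)" by (simp add: f1)
    also have "\<dots> = A * tl x" by (simp add: x1 mult.assoc flip: tl_mult)
    finally show "x \<in> End e A"
      unfolding End_def using x1(1,2) f1(1,2) by simp (metis mult.assoc)
  qed
qed

text \<open>Induction by splitting \<open>e\<close> with an idempotent endomorphism \<open>f\<close>
  and \<open>g = e - f\<close>. The off-diagonal blocks of \<open>\<tau>\<close> are coboundaries
  because \<open>hd f * (hd f * \<tau> - \<tau> * tl f) * tl g = hd f * \<tau> * tl g\<close>. A
  diagonal block still commutes, modulo coboundaries, with the endomorphisms of its summand.
  Indecomposable pieces have no self-extensions at all.\<close>

theorem central_extension_trivial:
  assumes "rep e A" "hd e * \<tau> = \<tau>" "\<tau> * tl e = \<tau>"
    and "\<And>\<xi>. \<xi> \<in> End e A \<Longrightarrow> \<exists>\<eta>. hd \<xi> * \<tau> - \<tau> * tl \<xi> = hd \<eta> * A - A * tl \<eta>"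
  shows "\<exists>\<eta>. \<tau> = hd \<eta> * A - A * tl \<eta>"
  using assms
proof (induction "rk e" arbitrary: e A \<tau> rule: less_induct)
  case less
  show ?case
  proof (cases "e = 0 \<or> indecomposable e A")
    case True
    show ?thesis
    proof (cases "e = 0")
      case True
      then show ?thesis using less.prems by (intro exI[of _ 0]) auto
    next
      case False
      with True rigid_if_indecomposable[OF less.prems(1)] show ?thesis
        using less.prems unfolding rigid_def by blast
    qed
  next
    case False
    then obtain f where f: "f \<in> End e A" "f * f = f" "f \<noteq> 0" "f \<noteq> e"
      unfolding indecomposable_def by blast
    have e: "e * e = e" "u * e = e" "e * u = e" "hd e * A = A" "A * tl e = A"
      using less.prems(1) by (auto simp: rep_def)
    define g where "g = e - f"
    have g: "g \<in> End e A" "g * g = g" "g \<noteq> 0" "g \<noteq> e"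
      using f e unfolding g_def by (auto intro: End_diff End_unit less.prems simp: algebra_simps EndD)
    have compress: "hd a * (hd \<eta> * A - A * tl \<eta>) * tl b = hd (a * \<eta> * b) * A - A * tl (a * \<eta> * b)"
      if "a \<in> End e A" "b \<in> End e A" for a b \<eta>
    proof -
      have "hd a * (hd \<eta> * A - A * tl \<eta>) * tl b
        = hd (a * \<eta>) * (A * tl b) - (hd a * A) * tl (\<eta> * b)"
        by (simp only: hom_simps algebra_simps)
      also have "\<dots> = hd (a * \<eta>) * (hd b * A) - (A * tl a) * tl (\<eta> * b)"
        by (simp only: EndD(3)[OF that(1)] EndD(3)[OF that(2)])
      finally show ?thesis by (simp only: hom_simps mult.assoc)
    qed
    have diag: "\<exists>\<eta>. hd a * \<tau> * tl a = hd \<eta> * A - A * tl \<eta>"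
      if a: "a \<in> End e A" "a * a = a" "a \<noteq> e" for a
    proof -
      note a1 = EndD[OF a(1)] End_carrier[OF less.prems(1) a(1)]
      have "rk a < rk e"
      proof (rule ccontr)
        assume "\<not> rk a < rk e"
        then have "rk (a * e) = rk e" using rk_mult_right[of e a] e a1 by simp
        then obtain l where "l * a * e = e" using rk_eq_right[of e a] e by auto
        then have "l * a = e" by (simp add: mult.assoc a1)
        then have "a = e" by (metis a(2) a1(1) mult.assoc)
        with a show False by simp
      qed
      moreover have "hd a * (hd a * \<tau> * tl a) = hd a * \<tau> * tl a" 
        by (simp add: a flip: mult.assoc hd_mult)
      moreover have "hd a * \<tau> * tl a * tl a = hd a * \<tau> * tl a"
        by (simp add: a mult.assoc flip: tl_mult)
      moreover have "\<exists>\<eta>. hd \<xi> * (hd a * \<tau> * tl a) - (hd a * \<tau> * tl a) * tl \<xi>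
          = hd \<eta> * (A * tl a) - A * tl a * tl \<eta>" if x: "\<xi> \<in> End a (A * tl a)" for \<xi>
      proof -
        note x1 = EndD[OF x]
        obtain \<eta> where \<eta>: "hd \<xi> * \<tau> - \<tau> * tl \<xi> = hd \<eta> * A - A * tl \<eta>"
          using less.prems(4) x summand(2)[OF less.prems(1) a(1,2)] by blast
        have "hd \<xi> * (hd a * \<tau> * tl a) - (hd a * \<tau> * tl a) * tl \<xi>
            = hd (\<xi> * a) * \<tau> * tl a - hd a * \<tau> * tl (a * \<xi>)"
          by (simp only: hom_simps mult.assoc)
        also have "\<dots> = hd (a * \<xi>) * \<tau> * tl a - hd a * \<tau> * tl (\<xi> * a)"
          by (simp add: x1)
        also have "\<dots> = hd a * (hd \<xi> * \<tau> - \<tau> * tl \<xi>) * tl a"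
          by (simp only: hom_simps algebra_simps)
        also have "\<dots> = hd (a * \<eta> * a) * A - A * tl (a * \<eta> * a)"
          unfolding \<eta> by (rule compress[OF a(1) a(1)])
        also have "\<dots> = hd (a * \<eta>) * (hd a * A) - A * tl (a * a * \<eta> * a)"
          by (simp only: a(2)) (simp only: hom_simps mult.assoc)
        also have "hd (a * \<eta>) * (hd a * A) = hd (a * \<eta>) * (hd (a * a) * A)" by (simp add: a)
        also have "\<dots> = hd (a * \<eta>) * (hd a * (A * tl a))" by (simp add: hom_simps mult.assoc a1)
        also have "\<dots> - A * tl (a * a * \<eta> * a) = hd (a * \<eta> * a) * (A * tl a) - A * tl a * tl (a * \<eta>
          * a)"
          by (simp only: hom_simps mult.assoc)
        finally show ?thesis by blast
      qed
      ultimately obtain \<eta> where "hd a * \<tau> * tl a = hd \<eta> * (A * tl a) - A * tl a * tl \<eta>"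
        using less.hyps[OF _ summand(1)[OF less.prems(1) a(1,2)]] by blast
      also have "\<dots> = hd \<eta> * (hd a * A) - A * tl a * tl \<eta>" by (simp add: a1)
      finally have eq: "hd a * \<tau> * tl a = hd (\<eta> * a) * A - A * tl (a * \<eta>)"
        by (simp add: hom_simps mult.assoc)
      \<comment> \<open>Not yet a coboundary of \<open>A\<close>, since \<open>\<eta> * a\<close>
        and \<open>a * \<eta>\<close> differ; cutting once more with \<open>a\<close> on both sides
        turns both into \<open>a * \<eta> * a\<close>.\<close>
      have "hd a * (hd a * \<tau> * tl a) * tl a = hd (a * a) * \<tau> * tl (a * a)"
        by (simp only: hom_simps mult.assoc)
      then have "hd a * \<tau> * tl a = hd a * (hd a * \<tau> * tl a) * tl a"
        by (simp only: a(2))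
      also have "\<dots> = hd a * (hd (\<eta> * a) * A - A * tl (a * \<eta>)) * tl a"
        by (simp only: eq)
      also have "\<dots> = hd (a * \<eta>) * (hd a * A * tl a) - (hd a * A) * tl (a * \<eta> * a)"
        by (simp only: hom_simps algebra_simps)
      also have "hd a * A * tl a = hd a * A" by (simp add: a1 mult.assoc a flip: tl_mult)
      also have "(hd a * A) * tl (a * \<eta> * a) = A * tl (a * a * \<eta> * a)"
        by (simp only: a1 hom_simps mult.assoc)
      also have "hd (a * \<eta>) * (hd a * A) - A * tl (a * a * \<eta> * a)
          = hd (a * \<eta> * a) * A - A * tl (a * \<eta> * a)"
        unfolding a(2) by (simp only: hom_simps mult.assoc)
      finally show ?thesis by blast
    qed
    have off: "\<exists>\<eta>. hd a * \<tau> * tl b = hd \<eta> * A - A * tl \<eta>"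
      if a: "a \<in> End e A" "a * a = a" and b: "b \<in> End e A" "a * b = 0" for a b
    proof -
      obtain \<eta> where \<eta>: "hd a * \<tau> - \<tau> * tl a = hd \<eta> * A - A * tl \<eta>"
        using less.prems(4) a by blast
      have "hd a * \<tau> * tl b = hd (a * a) * \<tau> * tl b - hd a * \<tau> * tl (a * b)"
        using a b by simp
      also have "\<dots> = hd a * (hd a * \<tau> - \<tau> * tl a) * tl b"
        by (simp only: hom_simps algebra_simps)
      finally show ?thesis unfolding \<eta> using compress[OF a(1) b(1)] by auto
    qed
    have fg: "f * g = 0" "g * f = 0"
      using f by (simp_all add: g_def algebra_simps EndD)
    obtain a b c d where
      "hd f * \<tau> * tl f = hd a * A - A * tl a" "hd f * \<tau> * tl g = hd b * A - A * tl b"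
      "hd g * \<tau> * tl f = hd c * A - A * tl c" "hd g * \<tau> * tl g = hd d * A - A * tl d"
      using diag[OF f(1,2,4)] diag[OF g(1,2,4)] off[OF f(1,2) g(1) fg(1)] off[OF g(1,2) f(1) fg(2)]
      by blast
    moreover have "\<tau> = hd f * \<tau> * tl f + hd f * \<tau> * tl g + hd g * \<tau> * tl f + hd g * \<tau> * tl g"
      using less.prems(2,3) by (simp add: g_def hom_simps algebra_simps)
    ultimately have "\<tau> = (hd a * A - A * tl a) + (hd b * A - A * tl b) + (hd c * A - A * tl c)
        + (hd d * A - A * tl d)" by (simp only:)
    also have "\<dots> = hd (a + b + c + d) * A - A * tl (a + b + c + d)"
      by (simp add: hom_simps algebra_simps)
    finally show ?thesis by blast
  qed
qed

end

section \<open>Linear maps and ranks\<close>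

definition scale_fun :: "'l::field \<Rightarrow> ('i \<Rightarrow> 'l) \<Rightarrow> 'i \<Rightarrow> 'l" where
  "scale_fun c x = (\<lambda>i. c * x i)"

lemma scale_fun_apply [simp]: "scale_fun c x i = c * x i"
  by (simp add: scale_fun_def)

interpretation fv: vector_space scale_fun
  by unfold_locales (simp_all add: fun_eq_iff algebra_simps)

interpretation fvp: vector_space_pair scale_fun scale_fun
  by unfold_locales

lemma sum_fun_apply: "(\<Sum>i\<in>S. f i) x = (\<Sum>i\<in>S. f i x)"
  by (induction S rule: infinite_finite_induct) simp_all

text \<open>Gaussian elimination: equation \<open>r\<close> is solved for an unknown
  \<open>h\<close> that occurs in it, \<open>n\<close> is the system left for the other unknowns,
  and \<open>d\<close> restores the value at \<open>h\<close>. All dimension counts below go through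
  this lemma.\<close>

lemma underdetermined_system:
  fixes m :: "'r \<Rightarrow> 'g \<Rightarrow> 'l::field"
  assumes "finite R" "finite G" "card R < card G"
  shows "\<exists>c. (\<exists>g\<in>G. c g \<noteq> 0) \<and> (\<forall>r\<in>R. (\<Sum>g\<in>G. m r g * c g) = 0)"
  using assms
proof (induction R arbitrary: G m rule: finite_induct)
  case empty
  then obtain g where "g \<in> G" by (auto simp: card_gt_0_iff)
  then show ?case by (intro exI[of _ "\<lambda>_. 1"]) auto
next
  case (insert r R)
  show ?case
  proof (cases "\<forall>g\<in>G. m r g = 0")
    case True
    have "card R < card G" using insert by simp
    from insert.IH[OF insert.prems(1) this, of m] True show ?thesis by auto
  next
    case False
    then obtain h where h: "h \<in> G" "m r h \<noteq> 0" by blast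
    define n where "n = (\<lambda>s g. m s g - m s h * m r g / m r h)"
    have "card R < card (G - {h})" using insert h by simp
    from insert.IH[OF _ this, of n] insert.prems obtain c where
      c: "\<exists>g\<in>G - {h}. c g \<noteq> 0" "\<And>s. s \<in> R \<Longrightarrow> (\<Sum>g\<in>G - {h}. n s g * c g) = 0" by auto
    define d where "d = c(h := - (\<Sum>g\<in>G - {h}. m r g * c g) / m r h)"
    have sum: "(\<Sum>g\<in>G. m s g * d g) = m s h * d h + (\<Sum>g\<in>G - {h}. m s g * c g)" for s
      using h insert.prems by (subst sum.remove[of _ h]) (auto simp: d_def intro!: sum.cong)
    have "(\<Sum>g\<in>G. m s g * d g) = 0" if "s \<in> R" for s
    proof -
      have "(\<Sum>g\<in>G - {h}. n s g * c g)
        = (\<Sum>g\<in>G - {h}. m s g * c g) - m s h / m r h * (\<Sum>g\<in>G - {h}. m r g * c g)"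
        by (simp add: n_def sum_subtractf left_diff_distrib sum_distrib_left mult.assoc)
      then show ?thesis using c(2)[OF that] by (simp add: sum) (simp add: d_def)
    qed
    moreover have "(\<Sum>g\<in>G. m r g * d g) = 0"
      using h by (simp add: sum) (simp add: d_def)
    ultimately show ?thesis using c(1) by (intro exI[of _ d]) (auto simp: d_def)
  qed
qed

lemma subspace_eq_dim:
  fixes V W :: "('i \<Rightarrow> 'l::field) set"
  assumes "W \<subseteq> V" "V \<subseteq> fv.span D" "finite D" "fv.dim W = fv.dim V" "fv.subspace W"
  shows "W = V"
proof -
  obtain B where B: "B \<subseteq> V" "fv.independent B" "V \<subseteq> fv.span B" "card B = fv.dim V"
    using fv.basis_exists by blast
  obtain C where C: "C \<subseteq> W" "fv.independent C" "W \<subseteq> fv.span C" "card C = fv.dim W"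
    using fv.basis_exists by blast
  have fin: "finite B"
    using fv.independent_span_bound[OF assms(3) B(2)] B assms by blast
  have "finite C"
    using fv.independent_span_bound[OF assms(3) C(2)] C assms by blast
  have "x \<in> W" if x: "x \<in> V" for x
  proof (rule ccontr)
    assume "x \<notin> W"
    then have "x \<notin> fv.span C" using C assms(5) fv.span_minimal by blast
    then have "fv.independent (insert x C)" "x \<notin> C"
      using C fv.independent_insertI by (auto intro: fv.span_base)
    moreover have "insert x C \<subseteq> fv.span B" using x C B assms by blast
    ultimately have "card (insert x C) \<le> card B"
      using fv.independent_span_bound[OF fin] by blast
    then show False using \<open>x \<notin> C\<close> \<open>finite C\<close> B C assms by simp
  qed
  with assms show ?thesis by blast
qed

lemma dim_linear_image_le:
  fixes V :: "('i \<Rightarrow> 'l::field) set" and f :: "('i \<Rightarrow> 'l) \<Rightarrow> 'j \<Rightarrow> 'l"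
  assumes "Vector_Spaces.linear scale_fun scale_fun f" "V \<subseteq> fv.span D" "finite D"
  shows "fv.dim (f ` V) \<le> fv.dim V"
proof -
  obtain B where B: "B \<subseteq> V" "fv.independent B" "V \<subseteq> fv.span B" "card B = fv.dim V"
    using fv.basis_exists by blast
  have "finite B"
    using fv.independent_span_bound[OF assms(3) B(2)] B assms by blast
  moreover have "f ` V \<subseteq> fv.span (f ` B)"
    using B(3) by (metis assms(1) image_mono fvp.linear_span_image)
  ultimately show ?thesis
    using fv.dim_le_card[of "f ` V" "f ` B"] B card_image_le[of B f] by simp
qed

text \<open>All spaces, of whatever dimension, sit inside the one space
  \<open>nat \<Rightarrow> 'l\<close>, as the functions vanishing from their dimension on. Maps
  between different spaces thus share a type, and that type is a ring.\<close>

typedef (overloaded) 'l lmap = "{f :: (nat \<Rightarrow> 'l::field) \<Rightarrow> nat \<Rightarrow> 'l. Vector_Spaces.linear scale_fun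
  scale_fun f}"
  morphisms app Lmap
  by (rule exI[of _ "\<lambda>x. x"]) (simp add: fv.linear_ident)

setup_lifting type_definition_lmap

lemma linear_app: "Vector_Spaces.linear scale_fun scale_fun (app f)"
  using app by blast

lemma app_add: "app f (x + y) = app f x + app f y"
  and app_scale: "app f (scale_fun c x) = scale_fun c (app f x)"
  and app_sum: "app f (\<Sum>i\<in>S. h i) = (\<Sum>i\<in>S. app f (h i))"
  using linear_app[of f] fvp.linear_add fvp.linear_scale fvp.linear_sum by blast+

instantiation lmap :: (field) ring
begin
lift_definition zero_lmap :: "'a lmap" is "\<lambda>_. 0" by (rule fvp.linear_zero)
lift_definition plus_lmap :: "'a lmap \<Rightarrow> 'a lmap \<Rightarrow> 'a lmap" is "\<lambda>f g x. f x + g x"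
  by (rule fvp.linear_compose_add)
lift_definition minus_lmap :: "'a lmap \<Rightarrow> 'a lmap \<Rightarrow> 'a lmap" is "\<lambda>f g x. f x - g x"
  by (rule fvp.linear_compose_sub)
lift_definition uminus_lmap :: "'a lmap \<Rightarrow> 'a lmap" is "\<lambda>f x. - f x"
  by (rule fvp.linear_compose_neg)
lift_definition times_lmap :: "'a lmap \<Rightarrow> 'a lmap \<Rightarrow> 'a lmap" is "\<lambda>f g x. f (g x)"
  using Vector_Spaces.linear_compose[unfolded comp_def] by blast
instance
  by standard (transfer; simp add: fun_eq_iff fvp.linear_add algebra_simps)+
end

lemma lmap_eqI: "(\<And>x. app f x = app g x) \<Longrightarrow> f = g"
  by transfer (simp add: fun_eq_iff)

lemma app_simps [simp]: "app 0 x = 0" "app (f + g) x = app f x + app g x" "app (f - g) x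
  = app f x - app g x"
  "app (- f) x = - app f x" "app (f * g) x = app f (app g x)"
  by (transfer; simp)+

lift_definition lscale :: "'l::field \<Rightarrow> 'l lmap \<Rightarrow> 'l lmap" is "\<lambda>c f x. scale_fun c (f x)"
  by (rule fvp.linear_compose_scale_right)

lemma app_lscale [simp]: "app (lscale c f) x = scale_fun c (app f x)"
  by transfer simp

lemma lmap_regular: "\<exists>g. f * g * f = (f :: 'l::field lmap)"
proof -
  obtain g where "Vector_Spaces.linear scale_fun scale_fun g" "\<forall>y\<in>app f ` UNIV. app f (g y) = y"
    using fvp.linear_exists_right_inverse_on[OF linear_app fv.subspace_UNIV, of f] by blast
  then have "f * Lmap g * f = f"
    by (intro lmap_eqI) (simp add: Lmap_inverse)
  then show ?thesis by blast
qed

definition lrank :: "'l::field lmap \<Rightarrow> nat" where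
  "lrank f = fv.dim (range (app f))"

text \<open>The ambient space has infinite dimension, and \<open>fv.dim\<close> takes the default
  value 0 on infinite-dimensional subspaces; \<open>lrank\<close> is meaningful only under this
  condition.\<close>

definition fin_rank :: "'l::field lmap \<Rightarrow> bool" where
  "fin_rank f \<longleftrightarrow> (\<exists>D. finite D \<and> range (app f) \<subseteq> fv.span D)"

lemma subspace_range_app: "fv.subspace (range (app f))"
  using fvp.linear_subspace_image[OF linear_app fv.subspace_UNIV] .

lemma lrank_mult_right: 
  assumes "fin_rank t" shows "lrank (x * t) \<le> lrank t"
proof -
  have "range (app (x * t)) = app x ` range (app t)" by auto
  then show ?thesis using assms dim_linear_image_le[OF linear_app]
    unfolding lrank_def fin_rank_def by metis
qed

lemma lrank_mult_left: 
  assumes "fin_rank t" shows "lrank (t * x) \<le> lrank t"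
proof -
  obtain B where B: "B \<subseteq> range (app t)" "fv.independent B" "range (app t) \<subseteq> fv.span B" "card B
    = lrank t"
    using fv.basis_exists unfolding lrank_def by blast
  moreover have "finite B"
    using assms B fv.independent_span_bound unfolding fin_rank_def by (meson order_trans)
  moreover have "range (app (t * x)) \<subseteq> range (app t)" by auto
  ultimately show ?thesis using fv.dim_le_card[of "range (app (t * x))" B] unfolding lrank_def by auto
qed

lemma lrank_eq_left:
  assumes "fin_rank t" "lrank (t * x) = lrank t"
  shows "\<exists>r. t * x * r = t"
proof -
  obtain D where D: "finite D" "range (app t) \<subseteq> fv.span D" using assms by (auto simp: fin_rank_def)
  have eq: "range (app (t * x)) = range (app t)"
    using subspace_eq_dim[OF _ D(2,1) _ subspace_range_app, of "t * x"] assms(2)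
    by (auto simp: lrank_def)
  obtain g where "Vector_Spaces.linear scale_fun scale_fun g" "\<forall>y\<in>app (t * x) ` UNIV. app (t * x)
    (g y) = y"
    using fvp.linear_exists_right_inverse_on[OF linear_app fv.subspace_UNIV] by blast
  then have "t * x * (Lmap g * t) = t"
    by (intro lmap_eqI) (simp add: Lmap_inverse eq del: app_simps(5), simp add: Lmap_inverse eq)
  then show ?thesis by blast
qed

text \<open>A linear section \<open>g\<close> of \<open>x\<close> over the image of
  \<open>x * t\<close>, with values in the range of \<open>t\<close>, has an image of the same
  dimension as that range. It therefore fills the range, which makes \<open>g\<close> a left inverse
  of \<open>x\<close> there.\<close>

lemma lrank_eq_right:
  assumes "fin_rank t" "lrank (x * t) = lrank t"
  shows "\<exists>l. l * x * t = t"
proof -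
  let ?V = "range (app t)"
  obtain D where D: "finite D" "?V \<subseteq> fv.span D" using assms by (auto simp: fin_rank_def)
  obtain g where g: "g ` UNIV \<subseteq> ?V" "Vector_Spaces.linear scale_fun scale_fun g" "\<forall>y\<in>app x ` ?V.
    app x (g y) = y"
    using fvp.linear_exists_right_inverse_on[OF linear_app subspace_range_app] by blast
  define W where "W = g ` app x ` ?V"
  have W: "fv.subspace W"
    unfolding W_def by (intro fvp.linear_subspace_image g linear_app subspace_range_app)
  have "W \<subseteq> ?V" using g by (auto simp: W_def)
  have "app x ` W = app x ` ?V" using g(3) by (auto simp: W_def image_image)
  then have "fv.dim W \<ge> fv.dim ?V"
    using dim_linear_image_le[OF linear_app, of W D x] \<open>W \<subseteq> ?V\<close> D assms(2)
    by (simp add: lrank_def image_image)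
  moreover have "fv.dim W \<le> fv.dim ?V"
  proof -
    obtain B where B: "B \<subseteq> ?V" "fv.independent B" "?V \<subseteq> fv.span B" "card B = fv.dim ?V"
      using fv.basis_exists by blast
    then have "finite B" using D fv.independent_span_bound by (meson order_trans)
    then show ?thesis using fv.dim_le_card[of W B] \<open>W \<subseteq> ?V\<close> B by auto
  qed
  ultimately have "W = ?V" using subspace_eq_dim[OF \<open>W \<subseteq> ?V\<close> D(2,1)] W by simp
  have "g (app x (app t z)) = app t z" for z
  proof -
    have "app t z \<in> W" using \<open>W = ?V\<close> by blast
    then show ?thesis using g(3) by (auto simp: W_def)
  qed
  then have "Lmap g * x * t = t"
    by (intro lmap_eqI) (simp add: Lmap_inverse g)
  then show ?thesis by blast
qed

section \<open>Matrices as linear maps of the ambient space\<close>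

definition mat_lmap :: "nat \<Rightarrow> nat \<Rightarrow> (nat \<Rightarrow> nat \<Rightarrow> 'l::field) \<Rightarrow> 'l lmap" where
  "mat_lmap m n y = Lmap (\<lambda>w i. if i < m then \<Sum>j<n. y i j * w j else 0)"

lemma app_mat_lmap: "app (mat_lmap m n y) w = (\<lambda>i. if i < m then \<Sum>j<n. y i j * w j else 0)"
proof -
  have "Vector_Spaces.linear scale_fun scale_fun (\<lambda>w i. if i < m then \<Sum>j<n. y i j * w j else 0)"
    by (auto simp: Vector_Spaces.linear_iff fv.vector_space_axioms fun_eq_iff algebra_simps
      sum.distrib
        sum_distrib_left)
  then show ?thesis by (simp add: mat_lmap_def Lmap_inverse)
qed

definition unit_vec_fun :: "'i \<Rightarrow> 'i \<Rightarrow> 'l::field" where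
  "unit_vec_fun j = (\<lambda>i. if i = j then 1 else 0)"

definition entries :: "'l::field lmap \<Rightarrow> nat \<Rightarrow> nat \<Rightarrow> 'l" where
  "entries f i j = app f (unit_vec_fun j) i"

text \<open>Not a unit of the ring, but the idempotent projecting onto the first \<open>n\<close>
  coordinates; multiplying by it on both sides characterises the maps that come from matrices
  (\<open>lmap_eq_mat\<close>).\<close>

abbreviation id_lmap :: "nat \<Rightarrow> 'l::field lmap" where
  "id_lmap n \<equiv> mat_lmap n n (\<lambda>i j. if i = j then 1 else 0)"

lemma app_id_lmap: "app (id_lmap n) w = (\<lambda>i. if i < n then w i else 0)"
  by (auto simp: app_mat_lmap fun_eq_iff if_distrib[of "\<lambda>x. x * _"] cong: if_cong)

lemma entries_mat_lmap: "i < m \<Longrightarrow> j < n \<Longrightarrow> entries (mat_lmap m n y) i j = y i j"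
  by (simp add: entries_def app_mat_lmap unit_vec_fun_def if_distrib[of "\<lambda>x. _ * x"] cong: if_cong)

lemma mat_lmap_mult: "mat_lmap m n x * mat_lmap n p y = mat_lmap m p (\<lambda>i j. \<Sum>k<n. x i k * y k j)"
  by (rule lmap_eqI) (auto simp: app_mat_lmap fun_eq_iff sum_distrib_left sum_distrib_right
    mult.assoc intro: sum.swap)

lemma mat_lmap_diff: "mat_lmap m n x - mat_lmap m n y = mat_lmap m n (\<lambda>i j. x i j - y i j)"
  by (rule lmap_eqI) (auto simp: app_mat_lmap fun_eq_iff left_diff_distrib sum_subtractf)

lemma mat_lmap_cong: "(\<And>i j. i < m \<Longrightarrow> j < n \<Longrightarrow> x i j = y i j) \<Longrightarrow> mat_lmap m n x = mat_lmap m n y"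
  by (rule lmap_eqI) (auto simp: app_mat_lmap fun_eq_iff)

lemma mat_lmap_id: "id_lmap m * mat_lmap m n y = mat_lmap m n y" "mat_lmap m n y * id_lmap n
  = mat_lmap m n y"
  by (rule lmap_eqI, simp add: app_id_lmap, simp add: app_mat_lmap fun_eq_iff)+

lemma lmap_eq_mat:
  assumes "id_lmap m * f = f" "f * id_lmap n = f"
  shows "f = mat_lmap m n (entries f)"
proof (rule lmap_eqI)
  fix w
  have "app f w = app f (\<Sum>j<n. scale_fun (w j) (unit_vec_fun j))"
  proof -
    have "app (id_lmap n) w = (\<Sum>j<n. scale_fun (w j) (unit_vec_fun j))"
      by (auto simp: app_id_lmap fun_eq_iff unit_vec_fun_def sum.If_cases if_distrib[of "\<lambda>x. _ * x"]
          sum_fun_apply cong: if_cong)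
    moreover have "app f w = app (f * id_lmap n) w" by (simp only: assms(2))
    ultimately show ?thesis by simp
  qed
  also have "\<dots> = (\<lambda>i. \<Sum>j<n. entries f i j * w j)"
    by (simp add: app_sum app_scale fun_eq_iff sum_fun_apply entries_def mult.commute)
  finally have *: "app f w = (\<lambda>i. \<Sum>j<n. entries f i j * w j)" .
  have "app f w = app (id_lmap m * f) w" by (simp only: assms(1))
  then show "app f w = app (mat_lmap m n (entries f)) w"
    by (simp add: * app_id_lmap) (simp add: app_mat_lmap)
qed

lemma fin_rank_id: "fin_rank (id_lmap n * (f :: 'a::field lmap))" "lrank (id_lmap n :: 'a lmap) \<le> n"
proof -
  let ?D = "unit_vec_fun ` {..<n} :: (nat \<Rightarrow> 'a) set"
  have *: "app (id_lmap n) w \<in> fv.span ?D" for w :: "nat \<Rightarrow> 'a"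
  proof -
    have "app (id_lmap n) w = (\<Sum>j<n. scale_fun (w j) (unit_vec_fun j))"
      by (auto simp: app_id_lmap fun_eq_iff unit_vec_fun_def sum.If_cases if_distrib[of "\<lambda>x. _ * x"]
          sum_fun_apply cong: if_cong)
    also have "\<dots> \<in> fv.span ?D" by (intro fv.span_sum fv.span_scale fv.span_base) auto
    finally show ?thesis .
  qed
  then show "fin_rank (id_lmap n * f)" unfolding fin_rank_def by (intro exI[of _ ?D]) auto
  have "fv.dim (range (app (id_lmap n :: 'a lmap))) \<le> card ?D" using * by (intro fv.dim_le_card) auto
  also have "\<dots> \<le> n" using card_image_le[of "{..<n}" unit_vec_fun] by simp
  finally show "lrank (id_lmap n :: 'a lmap) \<le> n" by (simp add: lrank_def)
qed

section \<open>Quiver representations with positive Tits form\<close>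

lemma fin_rank_zero_iff: "fin_rank f \<Longrightarrow> lrank f = 0 \<Longrightarrow> f = 0"
proof -
  assume *: "fin_rank f" "lrank f = 0"
  obtain B where B: "B \<subseteq> range (app f)" "fv.independent B" "range (app f) \<subseteq> fv.span B" "card B
    = lrank f"
    using fv.basis_exists unfolding lrank_def by blast
  then have "finite B" using * fv.independent_span_bound unfolding fin_rank_def by (meson order_trans)
  then have "B = {}" using B * by simp
  then show "f = 0" using B by (intro lmap_eqI) auto
qed

lemma linear_functional_sum:
  fixes F :: "('g \<Rightarrow> 'l::field) \<Rightarrow> 'l"
  assumes "finite G" and add: "\<And>x y. F (x + y) = F x + F y" and scale: "\<And>c x. F (scale_fun c x)
    = c * F x"
  shows "F (\<lambda>g. if g \<in> G then c g else 0) = (\<Sum>g\<in>G. F (unit_vec_fun g) * c g)"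
  using assms(1)
proof (induction G rule: finite_induct)
  case empty
  have "F 0 = 0" using scale[of 0 0] by (simp add: scale_fun_def zero_fun_def)
  then show ?case by (simp add: zero_fun_def)
next
  case (insert x G)
  have "(\<lambda>g. if g \<in> insert x G then c g else 0) = scale_fun (c x) (unit_vec_fun x) + (\<lambda>g.
    if g \<in> G then c g else 0)"
    using insert by (auto simp: fun_eq_iff unit_vec_fun_def)
  then show ?case using insert by (simp add: add scale mult.commute)
qed

text \<open>Positivity of the Tits form is required only on the non-zero vectors below
  \<open>a\<close>. This is enough because ranks of idempotents below the unit family stay in this
  box.\<close>

locale positive_box =
  fixes V :: "'v set" and Q :: "('v \<times> 'v) set" and a :: "'v \<Rightarrow> nat"
  assumes fin: "finite V" "finite Q" and QV: "Q \<subseteq> V \<times> V" and off: "v \<notin> V \<Longrightarrow> a v = 0"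
    and tits: "(\<And>v. d v \<le> a v) \<Longrightarrow> v \<in> V \<Longrightarrow> d v \<noteq> 0 \<Longrightarrow>
      (\<Sum>(t, h)\<in>Q. d h * d t) < (\<Sum>v\<in>V. d v * d v)"
begin

text \<open>Families are total functions, so that they form rings pointwise. The value 0 off
  \<open>Q\<close> makes the condition \<open>at_head e * A = A\<close> force \<open>A\<close> to
  vanish off the arrows.\<close>

definition at_head :: "('v \<Rightarrow> 'l::field lmap) \<Rightarrow> 'v \<times> 'v \<Rightarrow> 'l lmap" where
  "at_head \<phi> = (\<lambda>\<alpha>. if \<alpha> \<in> Q then \<phi> (snd \<alpha>) else 0)"

definition at_tail :: "('v \<Rightarrow> 'l::field lmap) \<Rightarrow> 'v \<times> 'v \<Rightarrow> 'l lmap" where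
  "at_tail \<phi> = (\<lambda>\<alpha>. if \<alpha> \<in> Q then \<phi> (fst \<alpha>) else 0)"

definition total_rank :: "('v \<Rightarrow> 'l::field lmap) \<Rightarrow> nat" where
  "total_rank \<phi> = (\<Sum>v\<in>V. lrank (\<phi> v))"

definition unit_family :: "'v \<Rightarrow> 'l::field lmap" where
  "unit_family v = id_lmap (a v)"

lemma head_tail_simps:
  "at_head (\<phi> + \<psi>) = at_head \<phi> + at_head \<psi>" "at_tail (\<phi> + \<psi>) = at_tail \<phi> + at_tail \<psi>"
  "at_head (\<phi> * \<psi>) = at_head \<phi> * at_head \<psi>" "at_tail (\<phi> * \<psi>) = at_tail \<phi> * at_tail \<psi>"
  by (auto simp: at_head_def at_tail_def fun_eq_iff)

lemma fin_rank_unit: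
  fixes \<phi> :: "'v \<Rightarrow> 'b::field lmap"
  assumes "unit_family * \<phi> = \<phi>"
  shows "fin_rank (\<phi> v)" "v \<notin> V \<Longrightarrow> \<phi> v = 0" "lrank (\<phi> v) \<le> a v"
proof -
  have eq: "\<phi> v = id_lmap (a v) * \<phi> v"
    using assms by (simp add: unit_family_def fun_eq_iff)
  then show "fin_rank (\<phi> v)" using fin_rank_id(1)[of "a v" "\<phi> v"] by simp
  have "id_lmap 0 = (0 :: 'b lmap)" by (rule lmap_eqI) (simp add: app_id_lmap zero_fun_def)
  then show "v \<notin> V \<Longrightarrow> \<phi> v = 0" using eq off[of v] by simp
  have "fin_rank (id_lmap (a v) :: 'b lmap)" using fin_rank_id(1)[of "a v" "id_lmap (a v)"]
    by (simp add: mat_lmap_id)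
  from lrank_mult_left[OF this, of "\<phi> v"] eq fin_rank_id(2)[of "a v", where ?'a = 'b]
  show "lrank (\<phi> v) \<le> a v" by simp
qed

lemma pointwise_rank_eq:
  fixes f g :: "'v \<Rightarrow> nat"
  assumes "\<And>v. f v \<le> g v" "sum f V = sum g V" "v \<in> V"
  shows "f v = g v"
  using assms fin by (metis sum_mono_inv)

text \<open>If \<open>\<psi>\<close> is not a coboundary, then \<open>\<xi> \<mapsto> \<xi> A - A \<xi> + p(\<xi>) \<psi>\<close>, with \<open>p\<close> a projection onto the
  division ring of endomorphisms, embeds a space of dimension \<open>\<Sum> d\<^sub>v\<^sup>2\<close> into one of dimension \<open>\<Sum>
  d\<^sub>h d\<^sub>t\<close>, contradicting the positivity of the Tits form.\<close>

lemma brick_rigid: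
  fixes e :: "'v \<Rightarrow> 'l::field lmap" and A \<psi> :: "'v \<times> 'v \<Rightarrow> 'l lmap"
  assumes ue: "unit_family * e = e" and ee: "e * e = e" and "e \<noteq> 0"
    and A: "at_head e * A = A" "A * at_tail e = A"
    and inv: "\<And>\<phi>. e * \<phi> = \<phi> \<Longrightarrow> \<phi> * e = \<phi> \<Longrightarrow> at_head \<phi> * A = A * at_tail \<phi> \<Longrightarrow> \<phi> \<noteq> 0 \<Longrightarrow>
      \<exists>l r. l * \<phi> = e \<and> \<phi> * r = e"
    and \<psi>: "at_head e * \<psi> = \<psi>" "\<psi> * at_tail e = \<psi>"
  shows "\<exists>\<xi>. \<psi> = at_head \<xi> * A - A * at_tail \<xi>"
proof -
  define d where "d v = lrank (e v)" for v
  note fr = fin_rank_unit[OF ue]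
  have eev: "e v * e v = e v" for v using ee by (metis times_fun_apply)
  have eev': "app (e v) (app (e v) w) = app (e v) w" for v w by (metis eev app_simps(5))
  obtain v0 where v0: "e v0 \<noteq> 0" using \<open>e \<noteq> 0\<close> by (auto simp: fun_eq_iff)
  then have "v0 \<in> V" "d v0 \<noteq> 0"
    using fr(2)[of v0] fin_rank_zero_iff[OF fr(1)[of v0]] by (auto simp: d_def)
  then have less: "(\<Sum>(t, h)\<in>Q. d h * d t) < (\<Sum>v\<in>V. d v * d v)"
    using tits[of d v0] fr(3) by (simp add: d_def)
  have "\<exists>B. B \<subseteq> range (app (e v)) \<and> fv.independent B \<and> range (app (e v)) \<subseteq> fv.span B \<and> card B
    = d v" for v
    using fv.basis_exists unfolding d_def lrank_def by metis
  then obtain B where B: "B v \<subseteq> range (app (e v))" "fv.independent (B v)" "range (app (e v))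
    \<subseteq> fv.span (B v)"
    "card (B v) = d v" for v by metis
  have finB: "finite (B v)" for v
    using B[of v] fr(1)[of v] fv.independent_span_bound unfolding fin_rank_def by (meson order_trans)
  have eB: "app (e v) b = b" if "b \<in> B v" for v b
    using that B(1)[of v] eev' by auto
  have es: "app (e v) w \<in> fv.span (B v)" for v w using B(3) by blast
  define r where "r v b w = fv.representation (B v) (app (e v) w) b" for v b w
  have r_add: "r v b (w + w') = r v b w + r v b w'" for v b w w'
    unfolding r_def app_add by (rule fv.representation_add[OF B(2) es es, THEN fun_cong])
  have r_scale: "r v b (scale_fun c w) = c * r v b w" for v b c w
    unfolding r_def app_scale by (rule fv.representation_scale[OF B(2) es, THEN fun_cong])
  have r_basis: "r v b c = (if c = b then 1 else 0)" if "c \<in> B v" for v b c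
    unfolding r_def eB[OF that] using fv.representation_basis[OF B(2) that] by (auto simp: eq_commute)
  have r_sum: "app (e v) w = (\<Sum>b\<in>B v. scale_fun (r v b w) b)" for v w
    unfolding r_def using fv.sum_representation_eq[OF B(2) es finB subset_refl, of v w] by simp
  have r_e: "r v b (app (e v) w) = r v b w" for v b w
    by (simp add: r_def eev')
  \<comment> \<open>\<open>x\<close> lists matrix entries with respect to the bases
    \<open>B v\<close> of the images of \<open>e v\<close>, and \<open>r v b\<close> is the
    coordinate at \<open>b\<close> after projecting by \<open>e v\<close>. So \<open>\<phi>\<close>
    parametrises the families living on \<open>e\<close>.\<close>
  define f where "f x v w = (\<Sum>b\<in>B v. \<Sum>c\<in>B v. scale_fun (x (v, b, c) * r v c w) b)" 
    for x :: "'v \<times> (nat \<Rightarrow> 'l) \<times> (nat \<Rightarrow> 'l) \<Rightarrow> 'l" and v w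
  define \<phi> where "\<phi> x v = Lmap (f x v)" for x v
  have app_\<phi>: "app (\<phi> x v) = f x v" for x v
  proof -
    have "Vector_Spaces.linear scale_fun scale_fun (f x v)"
      by (auto simp: Vector_Spaces.linear_iff fv.vector_space_axioms f_def fun_eq_iff r_add
        r_scale sum_fun_apply
          algebra_simps sum.distrib sum_distrib_left)
    then show ?thesis by (simp add: \<phi>_def Lmap_inverse)
  qed
  have \<phi>_add: "\<phi> (x + y) = \<phi> x + \<phi> y" for x y
    by (rule ext, rule lmap_eqI)
      (auto simp: app_\<phi> f_def fun_eq_iff sum_fun_apply algebra_simps sum.distrib)
  have \<phi>_scale: "\<phi> (scale_fun c x) v = lscale c (\<phi> x v)" for c x v
    by (rule lmap_eqI)
      (auto simp: app_\<phi> f_def fun_eq_iff sum_fun_apply algebra_simps sum_distrib_left)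
  have e\<phi>: "e * \<phi> x = \<phi> x" for x
    by (rule ext, rule lmap_eqI)
      (auto simp: app_\<phi> f_def app_sum app_scale eB intro!: sum.cong)
  have \<phi>e: "\<phi> x * e = \<phi> x" for x
    by (rule ext, rule lmap_eqI) (simp add: app_\<phi> f_def r_e)
  have \<phi>0: "x (v, b, c) = 0" if "\<phi> x = 0" "b \<in> B v" "c \<in> B v" for x v b c
  proof -
    have "0 = app (\<phi> x v) c" by (simp add: that)
    also have "\<dots> = (\<Sum>b\<in>B v. scale_fun (x (v, b, c)) b)"
      unfolding app_\<phi> f_def
    proof (intro sum.cong refl)
      fix b'
      have "(\<Sum>c'\<in>B v. scale_fun (x (v, b', c') * r v c' c) b')
        = (\<Sum>c'\<in>B v. if c = c' then scale_fun (x (v, b', c')) b' else 0)"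
        by (intro sum.cong) (auto simp: r_basis that fun_eq_iff)
      then show "(\<Sum>c'\<in>B v. scale_fun (x (v, b', c') * r v c' c) b') = scale_fun (x (v, b', c)) b'"
        using that finB by simp
    qed
    finally have "(\<Sum>b\<in>B v. scale_fun (x (v, b, c)) b) = 0" by simp
    from fv.independentD[OF B(2) finB subset_refl this that(2)] show ?thesis .
  qed
  define K where "K = {x. at_head (\<phi> x) * A = A * at_tail (\<phi> x)}"
  have lsc: "lscale c p * q = lscale c (p * q)" "p * lscale c q = lscale c (p * q)" for c
    and p q :: "'l lmap"
    by (auto intro!: lmap_eqI simp: app_scale)
  have lscale_0: "lscale c 0 = (0 :: 'l lmap)" for c by (auto intro!: lmap_eqI)
  have sc: "at_head (\<phi> (scale_fun c x)) \<alpha> = lscale c (at_head (\<phi> x) \<alpha>)"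
    "at_tail (\<phi> (scale_fun c x)) \<alpha> = lscale c (at_tail (\<phi> x) \<alpha>)" for c x \<alpha>
    by (auto simp: at_head_def at_tail_def \<phi>_scale lscale_0)
  have "fv.subspace K"
  proof (rule fv.subspaceI)
    have "\<phi> (scale_fun 0 0) v = 0" for v
      unfolding \<phi>_scale by (rule lmap_eqI) (simp add: fun_eq_iff)
    then have "\<phi> 0 = 0" by (simp add: scale_fun_def zero_fun_def fun_eq_iff)
    then show "0 \<in> K" by (auto simp: K_def at_head_def at_tail_def fun_eq_iff)
  next
    show "x + y \<in> K" if "x \<in> K" "y \<in> K" for x y
      using that by (simp add: K_def \<phi>_add head_tail_simps algebra_simps)
    show "scale_fun c x \<in> K" if "x \<in> K" for c x
      using that by (simp add: K_def fun_eq_iff sc lsc)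
  qed
  then obtain p where p: "p ` UNIV \<subseteq> K" "Vector_Spaces.linear scale_fun scale_fun p" "\<And>x. x \<in> K
    \<Longrightarrow> p x = x"
    using fvp.linear_exists_left_inverse_on[OF fv.linear_ident, of K] by (auto simp: inj_on_def)
  note p_lin = fvp.linear_add[OF p(2)] fvp.linear_scale[OF p(2)]
  define T where "T x = at_head (\<phi> x) * A - A * at_tail (\<phi> x) + at_head (\<phi> (p x)) * \<psi>" for x
  \<comment> \<open>\<open>G\<close> indexes the unknowns, matrix entries at the vertices, and
    \<open>R\<close> the coordinates of the values of \<open>T\<close> along the arrows. The Tits
    form makes \<open>R\<close> smaller than \<open>G\<close>, so \<open>T\<close> kills some
    non-zero \<open>x\<close>.\<close>
  define G where "G = Sigma V (\<lambda>v. B v \<times> B v)"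
  define R where "R = Sigma Q (\<lambda>(t, h). B h \<times> B t)"
  define \<kappa> where "\<kappa> q x = (case q of (\<alpha>, b, c) \<Rightarrow> r (snd \<alpha>) b (app (T x \<alpha>) c))" for q x
  have finG: "finite G" "finite R" using fin finB by (auto simp: G_def R_def)
  have "card R = (\<Sum>(t, h)\<in>Q. d h * d t)"
    unfolding R_def using fin finB by (subst card_SigmaI) (auto simp: card_cartesian_product B
      intro!: sum.cong)
  moreover have "card G = (\<Sum>v\<in>V. d v * d v)"
    unfolding G_def using fin finB by (subst card_SigmaI) (auto simp: card_cartesian_product B)
  ultimately have "card R < card G" using less by simp
  from underdetermined_system[OF finG(2,1) this, of "\<lambda>q g. \<kappa> q (unit_vec_fun g)"]
  obtain c where c: "\<exists>g\<in>G. c g \<noteq> 0" "\<And>q. q \<in> R \<Longrightarrow> (\<Sum>g\<in>G. \<kappa> q (unit_vec_fun g) * c g) = 0" by blast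
  define x where "x = (\<lambda>g. if g \<in> G then c g else 0)"
  have T_add: "T (y + z) = T y + T z" for y z
    by (simp add: T_def p_lin \<phi>_add head_tail_simps algebra_simps)
  have T_scale: "app (T (scale_fun k y) \<alpha>) w = scale_fun k (app (T y \<alpha>) w)" for k y \<alpha> w
    by (simp add: T_def p_lin sc lsc fun_eq_iff algebra_simps)
  have \<kappa>0: "\<kappa> q x = 0" if "q \<in> R" for q
  proof -
    obtain \<alpha> b b' where q: "q = (\<alpha>, b, b')" by (rule prod_cases3)
    have "\<kappa> q (y + z) = \<kappa> q y + \<kappa> q z" "\<kappa> q (scale_fun k y) = k * \<kappa> q y" for y z k
      unfolding \<kappa>_def q prod.case T_add T_scale plus_fun_apply app_simps r_add r_scale by (rule refl)+
    then have "\<kappa> q x = (\<Sum>g\<in>G. \<kappa> q (unit_vec_fun g) * c g)"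
      unfolding x_def by (rule linear_functional_sum[OF finG(1)])
    with c that show ?thesis by simp
  qed
  have "T x = 0"
  proof (rule ext, rule lmap_eqI)
    fix \<alpha> :: "'v \<times> 'v" and w
    obtain t h where \<alpha>: "\<alpha> = (t, h)" by fastforce
    have Te: "at_head e * T x = T x" "T x * at_tail e = T x"
    proof -
      have "at_head e * (at_head (\<phi> y) * Z) = at_head (\<phi> y) * Z" for y Z
        by (simp add: e\<phi> flip: mult.assoc head_tail_simps)
      then show "at_head e * T x = T x"
        by (simp add: T_def distrib_left right_diff_distrib) (simp add: A flip: mult.assoc)
      have "A * at_tail (\<phi> y) * at_tail e = A * at_tail (\<phi> y)" for y
        by (simp add: \<phi>e mult.assoc flip: head_tail_simps)
      then show "T x * at_tail e = T x"
        by (simp add: T_def distrib_right left_diff_distrib) (simp add: A \<psi> mult.assoc)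
    qed
    show "app (T x \<alpha>) w = app (0 \<alpha>) w"
    proof (cases "\<alpha> \<in> Q")
      case False
      then have "(at_head e * T x) \<alpha> = 0" by (simp add: at_head_def)
      then show ?thesis by (simp add: Te)
    next
      case True
      have 1: "app (T x \<alpha>) w' = app (e h) (app (T x \<alpha>) w')" for w'
        using fun_cong[OF Te(1), of \<alpha>] True by (simp add: at_head_def \<alpha>) (metis app_simps(5))
      have 2: "app (T x \<alpha>) w' = app (T x \<alpha>) (app (e t) w')" for w'
        using fun_cong[OF Te(2), of \<alpha>] True by (simp add: at_tail_def \<alpha>) (metis app_simps(5))
      have "app (T x \<alpha>) b = 0" if "b \<in> B t" for b
      proof -
        have "r h b' (app (T x \<alpha>) b) = 0" if "b' \<in> B h" for b'
          using \<kappa>0[of "(\<alpha>, b', b)"] that \<open>b \<in> B t\<close> True by (auto simp: R_def \<kappa>_def \<alpha>)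
        then show ?thesis using 1[of b] r_sum[of h "app (T x \<alpha>) b"]
          by (simp add: scale_fun_def fun_eq_iff sum_fun_apply)
      qed
      then have "app (T x \<alpha>) (app (e t) w) = 0"
        using fvp.linear_eq_0_on_span[OF linear_app _ es] by blast
      then show ?thesis using 2[of w] by simp
    qed
  qed
  define \<eta> where "\<eta> = \<phi> (p x)"
  have \<eta>: "at_head \<eta> * A = A * at_tail \<eta>" using p(1) by (auto simp: K_def \<eta>_def)
  have Tx: "at_head (\<phi> x) * A - A * at_tail (\<phi> x) + at_head \<eta> * \<psi> = 0"
    using \<open>T x = 0\<close> by (simp add: T_def \<eta>_def)
  \<comment> \<open>With \<open>\<eta> = 0\<close> the equation \<open>T x = 0\<close> would say
    that \<open>\<phi> x\<close> is an endomorphism; then \<open>p x = x\<close>, so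
    \<open>\<phi> x = \<eta> = 0\<close>, against the choice of \<open>x\<close>.\<close>
  have "\<eta> \<noteq> 0"
  proof
    assume "\<eta> = 0"
    moreover have "at_head (0 :: 'v \<Rightarrow> 'l lmap) = 0" by (auto simp: at_head_def fun_eq_iff)
    ultimately have "x \<in> K" using Tx by (simp add: K_def)
    then have "\<phi> x = 0" using p(3)[of x] \<open>\<eta> = 0\<close> by (simp add: \<eta>_def)
    moreover from c(1) obtain v b b' where "(v, b, b') \<in> G" "c (v, b, b') \<noteq> 0" by (metis prod_cases3)
    ultimately show False using \<phi>0[of x b v b'] by (auto simp: G_def x_def)
  qed
  with inv[OF e\<phi>[of "p x", folded \<eta>_def] \<phi>e[of "p x", folded \<eta>_def] \<eta>]
  obtain l s where l: "l * \<eta> = e" and s: "\<eta> * s = e" by blast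
  \<comment> \<open>The inverse of \<open>\<eta>\<close> on \<open>e\<close>. Being two-sided, it
    again commutes with \<open>A\<close>, so it carries the coboundary
    \<open>at_head \<eta> * \<psi>\<close> back to a coboundary equal to
    \<open>\<psi>\<close>.\<close>
  define m where "m = e * l * e"
  have m\<eta>: "m * \<eta> = e" using e\<phi>[of "p x", folded \<eta>_def] by (simp add: m_def mult.assoc l ee)
  have mA: "at_head m * A = A * at_tail m"
  proof -
    have m: "m = e * s * e"
    proof -
      have "m = e * (l * \<eta>) * s" by (simp add: m_def mult.assoc s)
      also have "\<dots> = e * s" by (simp add: l ee)
      finally have "m = e * s" .
      moreover have "m * e = m" by (simp add: m_def mult.assoc ee)
      ultimately show ?thesis by simp
    qed
    have \<eta>m: "\<eta> * m = e" 
      using \<phi>e[of "p x", folded \<eta>_def] s ee by (simp add: m flip: mult.assoc)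
    have "at_head m * A = at_head m * (A * at_tail (\<eta> * m))" by (simp add: \<eta>m A)
    also have "\<dots> = at_head m * (A * at_tail \<eta>) * at_tail m" by (simp only: head_tail_simps mult.assoc)
    also have "\<dots> = at_head (m * \<eta>) * A * at_tail m"
      by (simp only: \<eta>[symmetric] head_tail_simps mult.assoc)
    also have "\<dots> = A * at_tail m" by (simp add: m\<eta> A)
    finally show ?thesis .
  qed
  have "\<psi> = at_head m * (at_head \<eta> * \<psi>)" using \<psi>(1) m\<eta> by (metis head_tail_simps(3) mult.assoc)
  also have "at_head \<eta> * \<psi> = A * at_tail (\<phi> x) - at_head (\<phi> x) * A"
    using Tx by (simp add: algebra_simps eq_neg_iff_add_eq_0)
  also have "at_head m * \<dots> = at_head m * A * at_tail (\<phi> x) - at_head m * (at_head (\<phi> x) * A)"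
    by (simp only: right_diff_distrib mult.assoc)
  also have "\<dots> = A * at_tail (m * \<phi> x) - at_head (m * \<phi> x) * A"
    by (simp only: mA head_tail_simps mult.assoc)
  also have "\<dots> = at_head (- (m * \<phi> x)) * A - A * at_tail (- (m * \<phi> x))"
  proof -
    have "at_head (- z) = - at_head z" "at_tail (- z) = - at_tail z" for z :: "'v \<Rightarrow> 'l lmap"
      by (auto simp: at_head_def at_tail_def fun_eq_iff)
    then show ?thesis by simp
  qed
  finally show ?thesis by blast
qed

text \<open>Multiplication cannot raise the rank at any vertex, so equality of the totals is
  equality at every vertex, and the one-sided inverses can be chosen vertex by vertex.\<close>

lemma total_rank_eq:
  fixes t x :: "'v \<Rightarrow> 'l::field lmap"
  assumes t: "unit_family * t = t"
  shows "total_rank (x * t) = total_rank t \<Longrightarrow> \<exists>l. l * x * t = t"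
    and "total_rank (t * x) = total_rank t \<Longrightarrow> \<exists>r. t * x * r = t"
proof -
  note fr = fin_rank_unit[OF t]
  show "\<exists>l. l * x * t = t" if "total_rank (x * t) = total_rank t"
  proof -
    have "lrank (x v * t v) = lrank (t v)" if "v \<in> V" for v
      using pointwise_rank_eq[of "\<lambda>v. lrank (x v * t v)" "\<lambda>v. lrank (t v)" v]
        lrank_mult_right[OF fr(1)] \<open>total_rank (x * t) = total_rank t\<close> that
          by (simp add: total_rank_def)
    then have "\<exists>l. l * x v * t v = t v" for v
      using lrank_eq_right[OF fr(1)] fr(2) by (cases "v \<in> V") auto
    then obtain l where "\<And>v. l v * x v * t v = t v" by metis
    then show ?thesis by (intro exI[of _ l]) (simp add: fun_eq_iff)
  qed
  show "\<exists>r. t * x * r = t" if "total_rank (t * x) = total_rank t"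
  proof -
    have "lrank (t v * x v) = lrank (t v)" if "v \<in> V" for v
      using pointwise_rank_eq[of "\<lambda>v. lrank (t v * x v)" "\<lambda>v. lrank (t v)" v]
        lrank_mult_left[OF fr(1)] \<open>total_rank (t * x) = total_rank t\<close> that
          by (simp add: total_rank_def)
    then have "\<exists>r. t v * x v * r = t v" for v
      using lrank_eq_left[OF fr(1)] fr(2) by (cases "v \<in> V") auto
    then obtain r where "\<And>v. t v * x v * r v = t v" by metis
    then show ?thesis by (intro exI[of _ r]) (simp add: fun_eq_iff)
  qed
qed

lemma rep_rings: "rep_rings at_head at_tail (unit_family :: 'v \<Rightarrow> 'l::field lmap) total_rank"
proof
  fix x y :: "'v \<Rightarrow> 'l lmap"
  show "at_head (x + y) = at_head x + at_head y" "at_tail (x + y) = at_tail x + at_tail y"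
    "at_head (x * y) = at_head x * at_head y" "at_tail (x * y) = at_tail x * at_tail y"
    by (rule head_tail_simps)+
  have "\<forall>v. \<exists>g. x v * g * x v = x v" using lmap_regular by blast
  then obtain g where "\<And>v. x v * g v * x v = x v" by metis
  then show "\<exists>g. x * g * x = x" by (intro exI[of _ g]) (simp add: fun_eq_iff)
next
  fix t x :: "'v \<Rightarrow> 'l lmap"
  assume t: "unit_family * t = t"
  note fr = fin_rank_unit[OF t]
  show "total_rank (x * t) \<le> total_rank t" "total_rank (t * x) \<le> total_rank t"
    unfolding total_rank_def using lrank_mult_right[OF fr(1)] lrank_mult_left[OF fr(1)]
      by (auto intro!: sum_mono)
  show "total_rank (x * t) = total_rank t \<Longrightarrow> \<exists>l. l * x * t = t"
    "total_rank (t * x) = total_rank t \<Longrightarrow> \<exists>r. t * x * r = t"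
    by (rule total_rank_eq[OF t], assumption)+
next
  fix e :: "'v \<Rightarrow> 'l lmap" and A \<psi>
  assume e: "unit_family * e = e" "e * unit_family = e" "e * e = e" "e \<noteq> 0"
    and A: "at_head e * A = A" "A * at_tail e = A"
    and rk: "\<And>\<phi>. e * \<phi> = \<phi> \<Longrightarrow> \<phi> * e = \<phi> \<Longrightarrow> at_head \<phi> * A = A * at_tail \<phi> \<Longrightarrow> \<phi> \<noteq> 0 \<Longrightarrow>
      total_rank \<phi> = total_rank e"
    and \<psi>: "at_head e * \<psi> = \<psi>" "\<psi> * at_tail e = \<psi>"
  have "\<exists>l r. l * \<phi> = e \<and> \<phi> * r = e"
    if "e * \<phi> = \<phi>" "\<phi> * e = \<phi>" "at_head \<phi> * A = A * at_tail \<phi>" "\<phi> \<noteq> 0" for \<phi>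
  proof -
    have "total_rank \<phi> = total_rank e" using rk that by blast
    then have "total_rank (\<phi> * e) = total_rank e" "total_rank (e * \<phi>) = total_rank e"
      by (simp_all only: that)
    then obtain l r where "l * \<phi> * e = e" "e * \<phi> * r = e"
      using total_rank_eq[OF e(1)] by blast
    then have "l * \<phi> = e" "\<phi> * r = e" using that by (simp_all add: mult.assoc)
    then show ?thesis by blast
  qed
  from brick_rigid[OF e(1,3,4) A this \<psi>]
  show "\<exists>\<xi>. \<psi> = at_head \<xi> * A - A * at_tail \<xi>" .
qed

end

text \<open>\<open>inf_action\<close> written on coordinate functions instead of matrices, over any
  commutative ring: homomorphisms and derivations can then be pushed through entry by entry.\<close>

definition act :: "('v \<Rightarrow> nat) \<Rightarrow> ('v \<Rightarrow> nat \<Rightarrow> nat \<Rightarrow> 'r::comm_ring_1) \<Rightarrow> ('v coord \<Rightarrow> 'r) \<Rightarrow> 'v coord \<Rightarrow>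
  'r" where
  "act a \<xi> y = (\<lambda>((t, h), i, j).
     (\<Sum>k<a h. \<xi> h i k * y ((t, h), k, j)) - (\<Sum>k<a t. y ((t, h), i, k) * \<xi> t k j))"

lemma act_cong:
  assumes "c \<in> rep_coords Q a" "\<And>c. c \<in> rep_coords Q a \<Longrightarrow> y c = z c"
  shows "act a \<xi> y c = act a \<xi> z c"
  using assms by (auto simp: act_def rep_coords_def intro!: arg_cong2[of _ _ _ _ "(-)"] sum.cong)

lemma act_cong_left:
  assumes "Q \<subseteq> V \<times> V" "c \<in> rep_coords Q a" "\<And>v i j. v \<in> V \<Longrightarrow> i < a v \<Longrightarrow> j < a v \<Longrightarrow> \<xi> v i j = \<eta> v i j"
  shows "act a \<xi> y c = act a \<eta> y c"
  using assms by (auto simp: act_def rep_coords_def intro!: arg_cong2[of _ _ _ _ "(-)"] sum.cong)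

lemma act_add: "act a (\<lambda>v i j. \<xi> v i j + \<eta> v i j) y c = act a \<xi> y c + act a \<eta> y c"
  by (auto simp: act_def algebra_simps sum.distrib split: prod.splits)

lemma act_scale: "act a (\<lambda>v i j. k * \<xi> v i j) y c = k * act a \<xi> y c"
  by (auto simp: act_def algebra_simps sum_distrib_left split: prod.splits)

lemma act_sum: "act a (\<lambda>v i j. \<Sum>k\<in>K. \<xi> k v i j) y c = (\<Sum>k\<in>K. act a (\<xi> k) y c)"
proof -
  have "act a (\<lambda>_ _ _. 0) y c = 0" by (auto simp: act_def split: prod.splits)
  then show ?thesis by (induction K rule: infinite_finite_induct) (simp_all add: act_add)
qed

lemma act_scalar:
  assumes "c \<in> rep_coords Q a"
  shows "act a (\<lambda>v i j. if i = j then s else 0) y c = 0"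
  using assms by (auto simp: act_def rep_coords_def mult.commute if_distrib[of "\<lambda>x. x * _"]
    if_distrib[of "\<lambda>x. _ * x"] cong: if_cong)

lemma act_right_add: "act a \<xi> (\<lambda>c. y c + z c) c = act a \<xi> y c + act a \<xi> z c"
  by (auto simp: act_def algebra_simps sum.distrib split: prod.splits)

lemma act_right_scale: "act a \<xi> (\<lambda>c. k * y c) c = k * act a \<xi> y c"
  by (auto simp: act_def algebra_simps sum_distrib_left split: prod.splits)

lemma act_right_sum: "act a \<xi> (\<lambda>c. \<Sum>k\<in>K. y k c) c = (\<Sum>k\<in>K. act a \<xi> (y k) c)"
proof -
  have "act a \<xi> (\<lambda>_. 0) c = 0" by (auto simp: act_def split: prod.splits)
  then show ?thesis by (induction K rule: infinite_finite_induct) (simp_all add: act_right_add)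
qed

lemma act_hom:
  assumes "comm_ring_hom f"
  shows "f (act a \<xi> y c) = act a (\<lambda>v i j. f (\<xi> v i j)) (\<lambda>c. f (y c)) c"
proof -
  interpret f: comm_ring_hom f by fact
  show ?thesis by (auto simp: act_def f.hom_minus f.hom_sum f.hom_mult split: prod.splits)
qed

section \<open>Translation between coordinates and families of linear maps\<close>

context positive_box
begin

definition arrow_lmaps :: "('v coord \<Rightarrow> 'l::field) \<Rightarrow> 'v \<times> 'v \<Rightarrow> 'l lmap" where
  "arrow_lmaps y = (\<lambda>\<alpha>. if \<alpha> \<in> Q then mat_lmap (a (snd \<alpha>)) (a (fst \<alpha>)) (\<lambda>i j. y (\<alpha>, i, j)) else 0)"

definition vertex_lmaps :: "('v \<Rightarrow> nat \<Rightarrow> nat \<Rightarrow> 'l::field) \<Rightarrow> 'v \<Rightarrow> 'l lmap" where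
  "vertex_lmaps \<xi> = (\<lambda>v. mat_lmap (a v) (a v) (\<xi> v))"

lemma arrow_lmaps_eq_iff:
  "arrow_lmaps y = arrow_lmaps z \<longleftrightarrow> (\<forall>c\<in>rep_coords Q a. y c = z c)"
proof
  assume *: "arrow_lmaps y = arrow_lmaps z"
  show "\<forall>c\<in>rep_coords Q a. y c = z c"
  proof
    fix c assume "c \<in> rep_coords Q a"
    then obtain t h i j where c: "c = ((t, h), i, j)" "(t, h) \<in> Q" "i < a h" "j < a t"
      by (auto simp: rep_coords_def)
    have "entries (arrow_lmaps y (t, h)) i j = entries (arrow_lmaps z (t, h)) i j" by (simp only: *)
    then show "y c = z c" using c by (simp add: arrow_lmaps_def entries_mat_lmap)
  qed
next
  assume *: "\<forall>c\<in>rep_coords Q a. y c = z c"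
  show "arrow_lmaps y = arrow_lmaps z"
  proof
    fix \<alpha> show "arrow_lmaps y \<alpha> = arrow_lmaps z \<alpha>"
      using * by (cases \<alpha>) (auto simp: arrow_lmaps_def rep_coords_def intro!: mat_lmap_cong)
  qed
qed

lemma arrow_lmaps_act:
  "arrow_lmaps (act a \<xi> y) = at_head (vertex_lmaps \<xi>) * arrow_lmaps y - arrow_lmaps y * at_tail
    (vertex_lmaps \<xi>)"
proof
  fix \<alpha> :: "'v \<times> 'v"
  show "arrow_lmaps (act a \<xi> y) \<alpha> =
    (at_head (vertex_lmaps \<xi>) * arrow_lmaps y - arrow_lmaps y * at_tail (vertex_lmaps \<xi>)) \<alpha>"
    by (cases \<alpha>) (auto simp: arrow_lmaps_def vertex_lmaps_def at_head_def at_tail_def act_def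
        mat_lmap_mult mat_lmap_diff intro!: mat_lmap_cong)
qed

lemma arrow_lmaps_unit:
  "at_head unit_family * arrow_lmaps y = arrow_lmaps y" "arrow_lmaps y * at_tail unit_family
    = arrow_lmaps y"
  by (auto simp: fun_eq_iff arrow_lmaps_def unit_family_def at_head_def at_tail_def mat_lmap_id)

lemma vertex_lmaps_entries:
  assumes "unit_family * \<phi> = \<phi>" "\<phi> * unit_family = \<phi>"
  shows "vertex_lmaps (\<lambda>v. entries (\<phi> v)) = \<phi>"
  using assms lmap_eq_mat[of "a v" "\<phi> v" "a v" for v]
  by (simp add: fun_eq_iff vertex_lmaps_def unit_family_def)

text \<open>\<open>central_extension_trivial\<close> for the full representation, with
  \<open>e\<close> the unit family; hypothesis and conclusion are translated into
  coordinates.\<close>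

theorem infinitesimally_central_imp_trivial:
  fixes y \<tau> :: "'v coord \<Rightarrow> 'l::field"
  assumes "\<And>\<xi>. \<forall>c\<in>rep_coords Q a. act a \<xi> y c = 0 \<Longrightarrow> \<exists>\<eta>. \<forall>c\<in>rep_coords Q a. act a \<xi> \<tau> c = act a \<eta> y c"
  shows "\<exists>\<eta>. \<forall>c\<in>rep_coords Q a. \<tau> c = act a \<eta> y c"
proof -
  interpret R: rep_rings at_head at_tail "unit_family :: 'v \<Rightarrow> 'l lmap" total_rank by (rule rep_rings)
  let ?u = "unit_family :: 'v \<Rightarrow> 'l lmap"
  have uu: "?u * ?u = ?u" by (auto simp: fun_eq_iff unit_family_def mat_lmap_id)
  have zero: "arrow_lmaps (\<lambda>_. 0) = (0 :: 'v \<times> 'v \<Rightarrow> 'l lmap)"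
  proof -
    have "mat_lmap m n (\<lambda>_ _. 0) = (0 :: 'l lmap)" for m n
      by (rule lmap_eqI) (simp add: app_mat_lmap fun_eq_iff)
    then show ?thesis by (auto simp: arrow_lmaps_def fun_eq_iff)
  qed
  have "R.rep ?u (arrow_lmaps y)"
    by (simp add: R.rep_def uu arrow_lmaps_unit)
  moreover have "\<exists>\<eta>. at_head \<phi> * arrow_lmaps \<tau> - arrow_lmaps \<tau> * at_tail \<phi>
      = at_head \<eta> * arrow_lmaps y - arrow_lmaps y * at_tail \<eta>" if "\<phi> \<in> R.End ?u (arrow_lmaps y)" for \<phi>
  proof -
    have \<phi>: "vertex_lmaps (\<lambda>v. entries (\<phi> v)) = \<phi>" "at_head \<phi> * arrow_lmaps y
      = arrow_lmaps y * at_tail \<phi>"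
      using that vertex_lmaps_entries by (auto simp: R.End_def)
    then have "arrow_lmaps (act a (\<lambda>v. entries (\<phi> v)) y) = arrow_lmaps (\<lambda>_. 0)"
      by (simp add: arrow_lmaps_act zero)
    then obtain \<eta> where "arrow_lmaps (act a (\<lambda>v. entries (\<phi> v)) \<tau>) = arrow_lmaps (act a \<eta> y)"
      using assms[of "\<lambda>v. entries (\<phi> v)"] unfolding arrow_lmaps_eq_iff by blast
    then show ?thesis unfolding arrow_lmaps_act \<phi> by blast
  qed
  ultimately obtain \<eta> where eq: "arrow_lmaps \<tau> = at_head \<eta> * arrow_lmaps y - arrow_lmaps y *
    at_tail \<eta>"
    using R.central_extension_trivial[of ?u "arrow_lmaps y" "arrow_lmaps \<tau>"] arrow_lmaps_unit by blast
  \<comment> \<open>The family \<open>\<eta>\<close> consists of arbitrary maps of the ambient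
    space; only after cutting it down by the unit family is it given by matrices.\<close>
  define \<eta>' where "\<eta>' = ?u * \<eta> * ?u"
  have "arrow_lmaps \<tau> = at_head ?u * arrow_lmaps \<tau> * at_tail ?u"
    by (simp add: arrow_lmaps_unit)
  also have "\<dots> = at_head (?u * \<eta>) * (arrow_lmaps y * at_tail ?u)
      - (at_head ?u * arrow_lmaps y) * at_tail (\<eta> * ?u)"
    unfolding eq by (simp only: R.hom_simps algebra_simps)
  also have "\<dots> = at_head (?u * \<eta>) * (at_head ?u * arrow_lmaps y)
      - (arrow_lmaps y * at_tail ?u) * at_tail (\<eta> * ?u)"
    by (simp only: arrow_lmaps_unit)
  also have "\<dots> = at_head \<eta>' * arrow_lmaps y - arrow_lmaps y * at_tail \<eta>'"
    unfolding \<eta>'_def by (simp only: R.hom_simps mult.assoc)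
  also have "\<eta>' = vertex_lmaps (\<lambda>v. entries (\<eta>' v))"
    by (rule vertex_lmaps_entries[symmetric])
      (simp_all add: \<eta>'_def mult.assoc uu, simp add: uu flip: mult.assoc)
  finally have "arrow_lmaps \<tau> = arrow_lmaps (act a (\<lambda>v. entries (\<eta>' v)) y)"
    unfolding arrow_lmaps_act .
  then show ?thesis unfolding arrow_lmaps_eq_iff by blast
qed

end

section \<open>Derivations and orbits\<close>

text \<open>A homogeneous system with coefficients in a subring \<open>S\<close> has a solution
  space spanned, over the field, by solutions with entries in \<open>S\<close>. Spanning is phrased
  as an induction principle for properties \<open>P\<close> closed under linear combinations.
  Elimination is done by cross-multiplication, as \<open>S\<close> need not contain
  inverses.\<close>

lemma solutions_spanned_by_subring:
  fixes S :: "'l::field set" and E :: "('g \<Rightarrow> 'l) set"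
  assumes S: "0 \<in> S" "1 \<in> S" "\<And>a b. a \<in> S \<Longrightarrow> b \<in> S \<Longrightarrow> a + b \<in> S" "\<And>a b. a \<in> S \<Longrightarrow> b \<in> S \<Longrightarrow> a - b \<in> S"
      "\<And>a b. a \<in> S \<Longrightarrow> b \<in> S \<Longrightarrow> a * b \<in> S"
    and "finite G" and "\<And>q g. q \<in> E \<Longrightarrow> g \<in> G \<Longrightarrow> q g \<in> S"
    and "\<And>g. g \<notin> G \<Longrightarrow> x g = 0" and "\<And>q. q \<in> E \<Longrightarrow> (\<Sum>g\<in>G. q g * x g) = 0"
    and "\<And>x y. P x \<Longrightarrow> P y \<Longrightarrow> P (\<lambda>g. x g + y g)" and "\<And>c x. P x \<Longrightarrow> P (\<lambda>g. c * x g)"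
    and "\<And>z. range z \<subseteq> S \<Longrightarrow> (\<And>g. g \<notin> G \<Longrightarrow> z g = 0) \<Longrightarrow> (\<And>q. q \<in> E \<Longrightarrow> (\<Sum>g\<in>G. q g * z g) = 0) \<Longrightarrow> P z"
  shows "P x"
  using assms(6-)
proof (induction G arbitrary: E x P rule: finite_induct)
  case empty
  show ?case by (rule empty(6)) (use empty(2) S in auto)
next
  case (insert h G)
  note add = insert.prems(4) and scale = insert.prems(5) and rat = insert.prems(6)
  define x' where "x' = x(h := 0)"
  have x': "x' g = 0" if "g \<notin> G" for g using that insert.prems(2) by (auto simp: x'_def)
  have sumx: "(\<Sum>g\<in>G. q g * x' g) = - (q h * x h)" if "q \<in> E" for q
  proof -
    have "(\<Sum>g\<in>G. q g * x' g) = (\<Sum>g\<in>G. q g * x g)"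
      using insert.hyps by (intro sum.cong) (auto simp: x'_def)
    then show ?thesis using insert.prems(3)[OF that] insert.hyps
      by (simp add: eq_neg_iff_add_eq_0 add.commute)
  qed
  show ?case
  proof (cases "\<forall>q\<in>E. q h = 0")
    case True
    have "P x'"
    proof (rule insert.IH[of E])
      show "(\<Sum>g\<in>G. q g * x' g) = 0" if "q \<in> E" for q using sumx[OF that] True that by simp
      show "P z" if "range z \<subseteq> S" "\<And>g. g \<notin> G \<Longrightarrow> z g = 0" "\<And>q. q \<in> E \<Longrightarrow> (\<Sum>g\<in>G. q g * z g) = 0" for z
        by (rule rat) (use that insert.hyps True in auto)
    qed (use insert.prems x' in \<open>auto intro: add scale\<close>)
    moreover have "P (\<lambda>g. if g = h then 1 else 0)"
    proof (rule rat)
      show "(\<Sum>g\<in>insert h G. q g * (if g = h then 1 else 0)) = 0" if "q \<in> E" for q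
        using True that insert.hyps by (simp add: if_distrib[of "\<lambda>x. _ * x"] cong: if_cong)
    qed (use S in auto)
    ultimately have "P (\<lambda>g. x' g + x h * (if g = h then 1 else 0))" by (intro add scale)
    moreover have "(\<lambda>g. x' g + x h * (if g = h then 1 else 0)) = x" by (auto simp: x'_def)
    ultimately show ?thesis by simp
  next
    case False
    then obtain p where p: "p \<in> E" "p h \<noteq> 0" by blast
    \<comment> \<open>Turns a solution in the remaining unknowns into one of the whole system: the
      value at \<open>h\<close> is solved from \<open>p\<close>, and everything is scaled by
      \<open>p h\<close> so as to stay in \<open>S\<close>. The induction hypothesis is used for the
      property \<open>P (lift z)\<close>.\<close>
    define lift where "lift z = (\<lambda>g. if g = h then - (\<Sum>g\<in>G. p g * z g) else p h * z g)" for z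
    define E' where "E' = (\<lambda>q g. p h * q g - q h * p g) ` E"
    have E'_sum: "(\<Sum>g\<in>G. (p h * q g - q h * p g) * z g) = p h * (\<Sum>g\<in>G. q g * z g) - q h * (\<Sum>g\<in>G. p
      g * z g)" for q z
      by (simp add: left_diff_distrib sum_subtractf sum_distrib_left mult.assoc)
    have "P (lift x')"
    proof (rule insert.IH[of E' _ "\<lambda>z. P (lift z)"])
      show "q g \<in> S" if "q \<in> E'" "g \<in> G" for q g
        using that insert.prems(1) p S by (auto simp: E'_def)
      show "(\<Sum>g\<in>G. q g * x' g) = 0" if "q \<in> E'" for q
        using that p by (auto simp: E'_def E'_sum sumx)
      show "P (lift (\<lambda>g. u g + v g))" if "P (lift u)" "P (lift v)" for u v
      proof -
        have "lift (\<lambda>g. u g + v g) = (\<lambda>g. lift u g + lift v g)"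
          by (auto simp: lift_def fun_eq_iff algebra_simps sum.distrib)
        then show ?thesis using add[OF that] by simp
      qed
      show "P (lift (\<lambda>g. c * u g))" if "P (lift u)" for u c
      proof -
        have "lift (\<lambda>g. c * u g) = (\<lambda>g. c * lift u g)"
          by (auto simp: lift_def fun_eq_iff algebra_simps sum_distrib_left)
        then show ?thesis using scale[OF that] by simp
      qed
      show "P (lift z)" if z: "range z \<subseteq> S" "\<And>g. g \<notin> G \<Longrightarrow> z g = 0" "\<And>q. q \<in> E' \<Longrightarrow> (\<Sum>g\<in>G. q g * z g)
        = 0" for z
      proof (rule rat)
        have zS: "z g \<in> S" for g using z(1) by blast
        have sumS: "(\<Sum>g\<in>A. f g) \<in> S" if "\<And>g. g \<in> A \<Longrightarrow> f g \<in> S" for A :: "'g set" and f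
          using that by (induction A rule: infinite_finite_induct) (auto intro: S)
        have "(\<Sum>g\<in>G. p g * z g) \<in> S"
          using insert.prems(1) p zS S by (intro sumS) auto
        then have "0 - (\<Sum>g\<in>G. p g * z g) \<in> S" by (intro S)
        then show "range (lift z) \<subseteq> S"
          using insert.prems(1)[OF p(1)] zS S by (auto simp: lift_def)
        show "lift z g = 0" if "g \<notin> insert h G" for g
          using that z by (auto simp: lift_def)
        fix q assume q: "q \<in> E"
        have "(\<Sum>g\<in>insert h G. q g * lift z g) = - (q h * (\<Sum>g\<in>G. p g * z g)) + (\<Sum>g\<in>G. q g * lift z g)"
          using insert.hyps by (simp add: lift_def)
        also have "(\<Sum>g\<in>G. q g * lift z g) = p h * (\<Sum>g\<in>G. q g * z g)"
          unfolding sum_distrib_left using insert.hyps by (intro sum.cong) (auto simp: lift_def)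
        also have "- (q h * (\<Sum>g\<in>G. p g * z g)) + \<dots> = 0"
          using z(3)[of "\<lambda>g. p h * q g - q h * p g"] q by (auto simp: E'_def E'_sum)
        finally show "(\<Sum>g\<in>insert h G. q g * lift z g) = 0" .
      qed
    qed (use x' in auto)
    then have "P (\<lambda>g. inverse (p h) * lift x' g)" by (rule scale)
    moreover have "(\<lambda>g. inverse (p h) * lift x' g) = x"
      using p sumx[OF p(1)] by (auto simp: lift_def fun_eq_iff x'_def)
    ultimately show ?thesis by simp
  qed
qed

text \<open>Differentiating \<open>\<xi> y = 0\<close> gives \<open>\<xi> \<delta>(y) = - \<delta>(\<xi>) y\<close>, so the class of \<open>\<delta>(y)\<close> modulo the
  tangent space of the orbit commutes with all endomorphisms of \<open>y\<close>.\<close>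

lemma (in positive_box) derivation_tangent_to_orbit:
  fixes ev \<delta> :: "'r::comm_ring_1 \<Rightarrow> 'l::field" and y :: "'v coord \<Rightarrow> 'r"
  assumes ev: "additive ev" "\<And>a b. ev (a * b) = ev a * ev b" "ev 1 = 1"
    and \<delta>: "additive \<delta>" "\<And>a b. \<delta> (a * b) = \<delta> a * ev b + ev a * \<delta> b"
    and ker: "\<And>a. ev a = 0 \<Longrightarrow> \<delta> a = 0"
  shows "\<exists>\<eta>. \<forall>c\<in>rep_coords Q a. \<delta> (y c) = act a \<eta> (\<lambda>c. ev (y c)) c"
proof (rule infinitesimally_central_imp_trivial)
  interpret ev: additive ev by fact
  interpret \<delta>: additive \<delta> by fact
  let ?y = "\<lambda>c. ev (y c)" and ?\<tau> = "\<lambda>c. \<delta> (y c)"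
  fix \<xi> :: "'v \<Rightarrow> nat \<Rightarrow> nat \<Rightarrow> 'l"
  assume \<xi>: "\<forall>c\<in>rep_coords Q a. act a \<xi> ?y c = 0"
  define G where "G = Sigma V (\<lambda>v. {..<a v} \<times> {..<a v})"
  have finG: "finite G" using fin by (auto simp: G_def)
  define q where "q = (\<lambda>((t, h), i, j) (v, k, l).
     (if v = h \<and> k = i then ?y ((t, h), l, j) else 0) - (if v = t \<and> l
       = j then ?y ((t, h), i, k) else 0))"
  define fam where "fam x v i j = x (v, i, j)" for x :: "'v \<times> nat \<times> nat \<Rightarrow> 'l" and v i j
  have act_sum: "act a (fam x) ?y c = (\<Sum>g\<in>G. q c g * x g)" if "c \<in> rep_coords Q a" for c x
  proof -
    obtain t h i j where c: "c = ((t, h), i, j)" "(t, h) \<in> Q" "i < a h" "j < a t"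
      using \<open>c \<in> rep_coords Q a\<close> by (auto simp: rep_coords_def)
    have V: "t \<in> V" "h \<in> V" using c QV by auto
    have "(\<Sum>g\<in>G. q c g * x g) = (\<Sum>v\<in>V. \<Sum>(k, l)\<in>{..<a v} \<times> {..<a v}. q c (v, k, l) * x (v, k, l))"
      unfolding G_def using fin by (subst sum.Sigma) (auto simp del: sum.cartesian_product intro!:
        sum.cong)
    also have "\<dots> = (\<Sum>v\<in>V. (if v = h then \<Sum>l<a h. ?y ((t, h), l, j) * x (h, i, l) else 0)
        - (if v = t then \<Sum>k<a t. ?y ((t, h), i, k) * x (t, k, j) else 0))"
    proof (intro sum.cong refl)
      fix v
      have 1: "(\<Sum>k<a v. \<Sum>l<a v. (if v = h \<and> k = i then ?y ((t, h), l, j) else 0) * x (v, k, l))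
          = (if v = h then \<Sum>l<a h. ?y ((t, h), l, j) * x (h, i, l) else 0)"
      proof (cases "v = h")
        case True
        have "(\<Sum>k<a h. \<Sum>l<a h. (if k = i then ?y ((t, h), l, j) else 0) * x (h, k, l))
          = (\<Sum>k<a h. if k = i then \<Sum>l<a h. ?y ((t, h), l, j) * x (h, i, l) else 0)"
          by (intro sum.cong) auto
        then show ?thesis using True c by simp
      qed simp
      have 2: "(\<Sum>k<a v. \<Sum>l<a v. (if v = t \<and> l = j then ?y ((t, h), i, k) else 0) * x (v, k, l))
          = (if v = t then \<Sum>k<a t. ?y ((t, h), i, k) * x (t, k, j) else 0)"
        using c by (auto simp: if_distrib[of "\<lambda>x. x * _"] cong: if_cong)
      show "(\<Sum>(k, l)\<in>{..<a v} \<times> {..<a v}. q c (v, k, l) * x (v, k, l))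
        = (if v = h then \<Sum>l<a h. ?y ((t, h), l, j) * x (h, i, l) else 0)
        - (if v = t then \<Sum>k<a t. ?y ((t, h), i, k) * x (t, k, j) else 0)"
        unfolding sum.cartesian_product[symmetric] 1[symmetric] 2[symmetric]
        by (simp add: q_def c left_diff_distrib sum_subtractf)
    qed
    also have "\<dots> = (\<Sum>l<a h. ?y ((t, h), l, j) * x (h, i, l)) - (\<Sum>k<a t. ?y ((t, h), i, k) * x
      (t, k, j))"
      using V fin by (simp add: sum_subtractf)
    finally show ?thesis by (simp add: act_def c fam_def mult.commute)
  qed
  define x where "x = (\<lambda>(v, i, j). if (v, i, j) \<in> G then \<xi> v i j else 0)"
  have act_x: "act a (fam x) z c = act a \<xi> z c" if "c \<in> rep_coords Q a" for z c
    by (rule act_cong_left[OF QV that]) (simp add: x_def fam_def G_def)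
  define P where "P z \<longleftrightarrow> (\<exists>\<eta>. \<forall>c\<in>rep_coords Q a. act a (fam z) ?\<tau> c = act a \<eta> ?y c)" for z
  \<comment> \<open>An endomorphism may have entries outside the range of \<open>ev\<close>, and
    those cannot be differentiated. Since \<open>q\<close> has coefficients in that range and the
    claim is linear in the endomorphism, it suffices to treat entries
    \<open>ev (w g)\<close>.\<close>
  have "P x"
  proof (rule solutions_spanned_by_subring[of "range ev" G "q ` rep_coords Q a"])
    show "0 \<in> range ev" "1 \<in> range ev" using ev.zero ev(3) by (metis rangeI)+
    show "a + b \<in> range ev" "a - b \<in> range ev" "a * b \<in> range ev" if "a \<in> range ev" "b \<in> range ev"
      for a b
      using that ev.add ev.diff ev(2) by (metis (no_types, lifting) image_iff rangeI)+
    then show "q' g \<in> range ev" if "q' \<in> q ` rep_coords Q a" for q' g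
      using that \<open>0 \<in> range ev\<close> by (cases g) (auto simp: q_def)
    show "x g = 0" if "g \<notin> G" for g using that by (cases g) (auto simp: x_def)
    show "(\<Sum>g\<in>G. q' g * x g) = 0" if q': "q' \<in> q ` rep_coords Q a" for q'
    proof -
      obtain c where c: "q' = q c" "c \<in> rep_coords Q a" using q' by blast
      then show ?thesis using act_sum[OF c(2), of x] act_x[OF c(2)] \<xi> by simp
    qed
    show "P (\<lambda>g. u g + v g)" if uv: "P u" "P v" for u v
    proof -
      obtain \<eta> \<theta> where "\<forall>c\<in>rep_coords Q a. act a (fam u) ?\<tau> c = act a \<eta> ?y c"
        "\<forall>c\<in>rep_coords Q a. act a (fam v) ?\<tau> c = act a \<theta> ?y c" using uv by (auto simp: P_def)
      then show ?thesis unfolding P_def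
        by (intro exI[of _ "\<lambda>v i j. \<eta> v i j + \<theta> v i j"]) (simp add: fam_def[abs_def] act_add)
    qed
    show "P (\<lambda>g. k * u g)" if u: "P u" for u k
    proof -
      obtain \<eta> where "\<forall>c\<in>rep_coords Q a. act a (fam u) ?\<tau> c = act a \<eta> ?y c"
        using u by (auto simp: P_def)
      then show ?thesis unfolding P_def
        by (intro exI[of _ "\<lambda>v i j. k * \<eta> v i j"]) (simp add: fam_def[abs_def] act_scale)
    qed
    show "P z" if z: "range z \<subseteq> range ev" "\<And>q'. q' \<in> q ` rep_coords Q a \<Longrightarrow> (\<Sum>g\<in>G. q' g * z g) = 0"
      for z
    proof -
      have "\<forall>g. \<exists>w. z g = ev w" using z(1) by blast
      then obtain w where w: "\<And>g. z g = ev (w g)" by metis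
      have "act a (fam z) ?\<tau> c = act a (\<lambda>v i j. - \<delta> (w (v, i, j))) ?y c"
        if c: "c \<in> rep_coords Q a" for c
      proof -
        let ?A = "act a (\<lambda>v i j. w (v, i, j)) y c"
        have "ev ?A = act a (fam z) ?y c"
          by (auto simp: act_def ev.diff ev.sum ev(2) fam_def w split: prod.splits)
        also have "\<dots> = 0" using z(2) c act_sum by simp
        finally have "\<delta> ?A = 0" by (rule ker)
        moreover have "\<delta> ?A = act a (fam z) ?\<tau> c - act a (\<lambda>v i j. - \<delta> (w (v, i, j))) ?y c"
          by (auto simp: act_def \<delta>.diff \<delta>.sum \<delta>(2) fam_def w sum.distrib sum_negf split: prod.splits)
        ultimately show ?thesis by simp
      qed
      then show ?thesis unfolding P_def by blast
    qed
  qed (rule finG)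
  then show "\<exists>\<eta>. \<forall>c\<in>rep_coords Q a. act a \<xi> ?\<tau> c = act a \<eta> ?y c"
    using act_x by (auto simp: P_def)
qed

section \<open>Polynomials: evaluation and partial derivatives\<close>

abbreviation (input) "lookup \<equiv> Poly_Mapping.lookup"
abbreviation (input) "keys \<equiv> Poly_Mapping.keys"
abbreviation (input) "single \<equiv> Poly_Mapping.single"

lemma poly_mapping_sum_single: "p = (\<Sum>m\<in>keys p. single m (lookup p m))"
proof (rule poly_mapping_eqI)
  fix k
  have "lookup (\<Sum>m\<in>keys p. single m (lookup p m)) k
    = (\<Sum>m\<in>keys p. if m = k then lookup p m else 0)"
    unfolding lookup_sum by (intro sum.cong) (auto simp: lookup_single when_def)
  then show "lookup p k
    = lookup (\<Sum>m\<in>keys p. single m (lookup p m)) k"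
    by (simp add: in_keys_iff)
qed

lemma single_monomial:
  "single m c = poly_const c * (\<Prod>i\<in>keys m. poly_var i ^ lookup m i)"
proof -
  have pow: "poly_var i ^ k = single (single i k) 1" for i k
    by (induction k) (simp_all add: poly_var_def mult_single flip: single_add)
  have "(\<Prod>i\<in>A. single (f i) 1) = (single (\<Sum>i\<in>A. f i) 1 :: cpoly)"
    for A :: "nat set" and f
    by (induction A rule: infinite_finite_induct) (simp_all add: mult_single)
  then have "(\<Prod>i\<in>keys m. poly_var i ^ lookup m i) = single m 1"
    unfolding pow using poly_mapping_sum_single[of m] by simp
  then show ?thesis by (simp add: poly_const_def mult_single)
qed

lemma poly_const_simps [simp]:
  "poly_const 0 = 0" "poly_const 1 = 1" "poly_const (a + b) = poly_const a + poly_const b"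
  "poly_const (a * b) = poly_const a * poly_const b" "poly_const (- a) = - poly_const a"
  "poly_const (a - b) = poly_const a - poly_const b"
  by (simp_all add: poly_const_def single_add mult_single single_uminus single_diff)

lemma poly_const_hom: "comm_ring_hom poly_const"
  by unfold_locales simp_all

lemma poly_const_eq_0_iff [simp]: "poly_const c = 0 \<longleftrightarrow> c = 0"
  unfolding poly_const_def by (metis lookup_single_eq lookup_zero single_zero)

lemma poly_ring_induct [consumes 1, case_names const var add mult]:
  assumes p: "p \<in> poly_ring N" and const: "\<And>c. P (poly_const c)" and var: "\<And>i. i < N \<Longrightarrow> P (poly_var i)"
    and add: "\<And>p q. P p \<Longrightarrow> P q \<Longrightarrow> P (p + q)" and mult: "\<And>p q. P p \<Longrightarrow> P q \<Longrightarrow> P (p * q)"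
  shows "P p"
proof -
  have 0: "P 0" "P 1" using const[of 0] const[of 1] by simp_all
  have prod: "P (\<Prod>i\<in>A. f i)" if "\<And>i. i \<in> A \<Longrightarrow> P (f i)" for A :: "nat set" and f
    using that by (induction A rule: infinite_finite_induct) (auto intro: 0 mult)
  have pow: "P (q ^ k)" if "P q" for q k
    using that by (induction k) (auto intro: 0 mult)
  have "P (single m c)" if "keys m \<subseteq> {..<N}" for m c
    unfolding single_monomial using that by (intro mult const prod pow var) auto
  moreover have sum: "P (\<Sum>i\<in>A. f i)" if "\<And>i. i \<in> A \<Longrightarrow> P (f i)" for A :: "(nat \<Rightarrow>\<^sub>0 nat) set" and f
    using that by (induction A rule: infinite_finite_induct) (auto intro: 0 add)
  ultimately show ?thesis
    using p by (subst poly_mapping_sum_single) (auto simp: poly_ring_def)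
qed

lemma in_some_poly_ring: "\<exists>N. p \<in> poly_ring N"
proof -
  have "finite (\<Union>m\<in>keys p. keys m)" by simp
  then obtain N where "(\<Union>m\<in>keys p. keys m) \<subseteq> {..<N}"
    by (meson finite_nat_iff_bounded)
  then show ?thesis by (auto simp: poly_ring_def)
qed

lemma poly_ring_mono: "N \<le> M \<Longrightarrow> p \<in> poly_ring N \<Longrightarrow> p \<in> poly_ring M"
  by (fastforce simp: poly_ring_def)

lemma poly_ring_closed [intro]:
  "poly_const c \<in> poly_ring N" "i < N \<Longrightarrow> poly_var i \<in> poly_ring N" "0 \<in> poly_ring N" "1 \<in> poly_ring N"
  "p \<in> poly_ring N \<Longrightarrow> q \<in> poly_ring N \<Longrightarrow> p + q \<in> poly_ring N"
  "p \<in> poly_ring N \<Longrightarrow> - p \<in> poly_ring N"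
  "p \<in> poly_ring N \<Longrightarrow> q \<in> poly_ring N \<Longrightarrow> p - q \<in> poly_ring N"
  "p \<in> poly_ring N \<Longrightarrow> q \<in> poly_ring N \<Longrightarrow> p * q \<in> poly_ring N"
proof -
  show add: "p + q \<in> poly_ring N" if "p \<in> poly_ring N" "q \<in> poly_ring N" for p q
    using that keys_add[of p q] by (auto simp: poly_ring_def)
  show neg: "- p \<in> poly_ring N" if "p \<in> poly_ring N" for p
    using that by (simp add: poly_ring_def)
  show "p - q \<in> poly_ring N" if "p \<in> poly_ring N" "q \<in> poly_ring N" for p q
    using add[OF that(1) neg[OF that(2)]] by simp
  show "p * q \<in> poly_ring N" if "p \<in> poly_ring N" "q \<in> poly_ring N" for p q
    unfolding poly_ring_def
  proof (intro CollectI ballI)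
    fix m assume "m \<in> keys (p * q)"
    then obtain a b where ab: "m = a + b" "a \<in> keys p" "b \<in> keys q"
      using keys_mult[of p q] by blast
    then have "keys a \<union> keys b \<subseteq> {..<N}" using that by (auto simp: poly_ring_def)
    with keys_add[of a b] show "keys m \<subseteq> {..<N}" unfolding ab by blast
  qed
qed (auto simp: poly_ring_def poly_const_def poly_var_def split: if_splits)

lemma poly_ring_sum: "(\<And>i. i \<in> A \<Longrightarrow> f i \<in> poly_ring N) \<Longrightarrow> (\<Sum>i\<in>A. f i) \<in> poly_ring N"
  by (induction A rule: infinite_finite_induct) auto

lemma poly_ring_prod: "(\<And>i. i \<in> A \<Longrightarrow> f i \<in> poly_ring N) \<Longrightarrow> (\<Prod>i\<in>A. f i) \<in> poly_ring N"
  by (induction A rule: infinite_finite_induct) auto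

lemma poly_ring_det:
  assumes "A \<in> carrier_mat n n" "\<And>i j. i < n \<Longrightarrow> j < n \<Longrightarrow> A $$ (i, j) \<in> poly_ring N"
  shows "det A \<in> poly_ring N"
proof -
  have "signof p \<in> poly_ring N" for p :: "nat \<Rightarrow> nat"
    by (cases p rule: sign_cases) auto
  moreover have "p i < n" if "p permutes {0..<n}" "i < n" for p i
    using permutes_in_image[OF that(1), of i] that(2) by simp
  ultimately show ?thesis
    unfolding det_def'[OF assms(1)] by (intro poly_ring_sum poly_ring_closed poly_ring_prod
      assms(2)) auto
qed

definition monomial_value :: "(nat \<Rightarrow> 'r::comm_ring_1) \<Rightarrow> (nat \<Rightarrow>\<^sub>0 nat) \<Rightarrow> 'r" where
  "monomial_value x m = (\<Prod>i\<in>keys m. x i ^ lookup m i)"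

lemma monomial_value_superset:
  "finite A \<Longrightarrow> keys m \<subseteq> A \<Longrightarrow> monomial_value x m = (\<Prod>i\<in>A. x i ^ lookup m i)"
  unfolding monomial_value_def by (rule prod.mono_neutral_left) (auto simp: in_keys_iff)

lemma monomial_value_add: "monomial_value x (m + n) = monomial_value x m * monomial_value x n"
proof -
  let ?A = "keys m \<union> keys n"
  have "monomial_value x (m + n) = (\<Prod>i\<in>?A. x i ^ lookup (m + n) i)"
    by (rule monomial_value_superset) (auto simp: keys_add)
  also have "\<dots> = (\<Prod>i\<in>?A. x i ^ lookup m i) * (\<Prod>i\<in>?A. x i ^ lookup n i)"
    by (simp add: lookup_add power_add prod.distrib)
  also have "\<dots> = monomial_value x m * monomial_value x n"
    by (intro arg_cong2[of _ _ _ _ "(*)"] monomial_value_superset[symmetric]) auto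
  finally show ?thesis .
qed

text \<open>Evaluation with the coefficients transported by \<open>c\<close>, so that the values can
  lie in any commutative ring: complex points, points on a line, truncation of variables.\<close>

definition evaluate :: "(complex \<Rightarrow> 'r::comm_ring_1) \<Rightarrow> (nat \<Rightarrow> 'r) \<Rightarrow> cpoly \<Rightarrow> 'r" where
  "evaluate c x p = (\<Sum>m\<in>keys p. c (lookup p m) * monomial_value x m)"

context
  fixes c :: "complex \<Rightarrow> 'r::comm_ring_1"
  assumes c: "comm_ring_hom c"
begin

interpretation c: comm_ring_hom c by (rule c)

lemma evaluate_superset:
  "finite A \<Longrightarrow> keys p \<subseteq> A \<Longrightarrow> evaluate c x p = (\<Sum>m\<in>A. c (lookup p m) * monomial_value x m)"
  unfolding evaluate_def by (rule sum.mono_neutral_left) (auto simp: in_keys_iff)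

lemma evaluate_single: "evaluate c x (single m a) = c a * monomial_value x m"
  by (subst evaluate_superset[of "{m}"]) auto

lemma evaluate_add: "evaluate c x (p + q) = evaluate c x p + evaluate c x q"
proof -
  let ?A = "keys p \<union> keys q"
  have "evaluate c x r = (\<Sum>m\<in>?A. c (lookup r m) * monomial_value x m)"
    if "keys r \<subseteq> ?A" for r using that by (intro evaluate_superset) auto
  from this[of "p + q"] this[of p] this[of q] show ?thesis
    using keys_add[of p q] by (simp add: lookup_add c.hom_add distrib_right sum.distrib)
qed

lemma evaluate_mult: "evaluate c x (p * q) = evaluate c x p * evaluate c x q"
proof -
  let ?s = "\<lambda>p m. single m (lookup p m)"
  have 0: "evaluate c x 0 = 0" by (simp add: evaluate_def)
  have sum: "evaluate c x (\<Sum>m\<in>A. f m) = (\<Sum>m\<in>A. evaluate c x (f m))" for A :: "(nat \<Rightarrow>\<^sub>0 nat) set" and f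
    by (induction A rule: infinite_finite_induct) (simp_all add: 0 evaluate_add)
  have "p * q = (\<Sum>m\<in>keys p. \<Sum>n\<in>keys q. ?s p m * ?s q n)"
    by (subst poly_mapping_sum_single[of p], subst poly_mapping_sum_single[of q]) (rule sum_product)
  then have "evaluate c x (p * q)
    = (\<Sum>m\<in>keys p. \<Sum>n\<in>keys q.
        (c (lookup p m) * monomial_value x m) * (c (lookup q n) * monomial_value x n))"
    by (simp add: sum mult_single evaluate_single monomial_value_add c.hom_mult mult.assoc
      mult.left_commute)
  also have "\<dots> = evaluate c x p * evaluate c x q"
    unfolding evaluate_def by (rule sum_product[symmetric])
  finally show ?thesis .
qed

lemma evaluate_const [simp]: "evaluate c x (poly_const a) = c a"
  and evaluate_var [simp]: "evaluate c x (poly_var i) = x i"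
  by (simp_all add: poly_const_def poly_var_def evaluate_single monomial_value_def)

lemma evaluate_hom: "comm_ring_hom (evaluate c x)"
  using evaluate_const[of x 0] evaluate_const[of x 1]
  by unfold_locales (simp_all add: evaluate_add evaluate_mult)

end

lemma hom_eq_on_poly_ring:
  assumes f: "comm_ring_hom f" and g: "comm_ring_hom g" and p: "p \<in> poly_ring N"
    and "\<And>c. f (poly_const c) = g (poly_const c)" "\<And>i. i < N \<Longrightarrow> f (poly_var i) = g (poly_var i)"
  shows "f p = g p"
proof -
  interpret f: comm_ring_hom f by fact
  interpret g: comm_ring_hom g by fact
  show ?thesis using p by (induction rule: poly_ring_induct) (simp_all add: assms f.hom_add
    g.hom_add f.hom_mult g.hom_mult)
qed

section \<open>Partial derivatives\<close>

lemma partial_deriv_superset: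
  assumes "finite A" "keys p \<subseteq> A"
  shows "partial_deriv i p = (\<Sum>m\<in>A. single (m - single i 1)
       (of_nat (lookup m i) * lookup p m))"
  unfolding partial_deriv_def by (rule sum.mono_neutral_left) (use assms in \<open>auto simp: in_keys_iff\<close>)

lemma partial_deriv_0 [simp]: "partial_deriv i 0 = 0"
  by (simp add: partial_deriv_def)

lemma partial_deriv_single:
  "partial_deriv i (single m a) = single (m - single i 1)
       (of_nat (lookup m i) * a)"
  by (subst partial_deriv_superset[of "{m}"]) auto

lemma partial_deriv_add: "partial_deriv i (p + q) = partial_deriv i p + partial_deriv i q"
proof -
  let ?A = "keys p \<union> keys q"
  have "partial_deriv i r = (\<Sum>m\<in>?A. single (m - single i 1)
       (of_nat (lookup m i) * lookup r m))"
    if "keys r \<subseteq> ?A" for r using that by (intro partial_deriv_superset) auto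
  from this[of "p + q"] this[of p] this[of q] show ?thesis
    using keys_add[of p q] by (simp add: lookup_add distrib_left single_add sum.distrib)
qed

lemma partial_deriv_mult: "partial_deriv i (p * q) = partial_deriv i p * q + p * partial_deriv i q"
proof -
  let ?s = "\<lambda>p m. single m (lookup p m)"
  let ?e = "single i (1::nat)"
  have sum: "partial_deriv i (\<Sum>m\<in>A. f m) = (\<Sum>m\<in>A. partial_deriv i (f m))"
    for A :: "(nat \<Rightarrow>\<^sub>0 nat) set" and f
    by (induction A rule: infinite_finite_induct) (simp_all add: partial_deriv_add)
  have single: "partial_deriv i (single m a * single n b)
      = partial_deriv i (single m a) * single n b
        + single m a * partial_deriv i (single n b)" for m n and a b :: complex
  proof -
    \<comment> \<open>Subtraction of exponents is truncated, so the identity needs the variable to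
      occur in \<open>m\<close>; when it does not, the coefficient is 0.\<close>
    have shift: "m + n - ?e = (m - ?e) + n" if "lookup m i \<noteq> 0" for m n :: "nat \<Rightarrow>\<^sub>0 nat"
      by (rule poly_mapping_eqI) (use that in \<open>auto simp: lookup_add lookup_minus lookup_single
        when_def\<close>)
    have 1: "single (m + n - ?e) (of_nat (lookup m i) * a * b)
        = single (m - ?e + n) (of_nat (lookup m i) * a * b)"
      using shift[of m n] by (cases "lookup m i = 0") auto
    have 2: "single (m + n - ?e) (of_nat (lookup n i) * a * b)
        = single (m + (n - ?e)) (of_nat (lookup n i) * a * b)"
      using shift[of n m] by (cases "lookup n i = 0") (auto simp: add.commute)
    show ?thesis
      using 1 2 by (simp add: mult_single partial_deriv_single lookup_add algebra_simps flip:
        single_add)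
        (simp add: algebra_simps single_add)
  qed
  have pq: "p * q = (\<Sum>m\<in>keys p. \<Sum>n\<in>keys q. ?s p m * ?s q n)"
    by (subst poly_mapping_sum_single[of p], subst poly_mapping_sum_single[of q]) (rule sum_product)
  have dp: "partial_deriv i p = (\<Sum>m\<in>keys p. partial_deriv i (?s p m))" for p
    by (subst poly_mapping_sum_single[of p]) (rule sum)
  have "partial_deriv i (p * q) = (\<Sum>m\<in>keys p. \<Sum>n\<in>keys q. partial_deriv i (?s p m) * ?s q n)
     + (\<Sum>m\<in>keys p. \<Sum>n\<in>keys q. ?s p m * partial_deriv i (?s q n))"
    unfolding pq sum single by (simp add: sum.distrib)
  also have "\<dots> = partial_deriv i p * q + p * partial_deriv i q"
    unfolding sum_product[symmetric] dp[symmetric] poly_mapping_sum_single[symmetric] ..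
  finally show ?thesis .
qed

lemma partial_deriv_const [simp]: "partial_deriv i (poly_const c) = 0"
  and partial_deriv_var [simp]: "partial_deriv i (poly_var j) = (if i = j then 1 else 0)"
  by (auto simp: poly_const_def poly_var_def partial_deriv_single lookup_single when_def)

lemma partial_deriv_poly_ring: "p \<in> poly_ring N \<Longrightarrow> partial_deriv i p \<in> poly_ring N"
proof -
  assume p: "p \<in> poly_ring N"
  then have "p \<in> poly_ring N \<and> partial_deriv i p \<in> poly_ring N"
    by (induction rule: poly_ring_induct) (auto simp: partial_deriv_add partial_deriv_mult)
  then show ?thesis ..
qed

lemma derivation_eq_on_poly_ring:
  fixes d d' h :: "cpoly \<Rightarrow> 'r::comm_ring_1"
  assumes "\<And>p q. d (p + q) = d p + d q" "\<And>p q. d' (p + q) = d' p + d' q"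
    and "\<And>p q. d (p * q) = d p * h q + h p * d q" "\<And>p q. d' (p * q) = d' p * h q + h p * d' q"
    and "\<And>c. d (poly_const c) = d' (poly_const c)" "\<And>i. i < N \<Longrightarrow> d (poly_var i) = d' (poly_var i)"
    and p: "p \<in> poly_ring N"
  shows "d p = d' p"
  using p by (induction rule: poly_ring_induct) (simp_all add: assms(1-6))

text \<open>The substitution \<open>x + t v\<close> with the variables themselves as base point: a
  polynomial in \<open>t\<close> over the coordinate ring, whose value at \<open>t = 0\<close> is
  the original polynomial.\<close>

definition line_subst :: "(nat \<Rightarrow> complex) \<Rightarrow> cpoly \<Rightarrow> cpoly poly" where
  "line_subst v = evaluate (\<lambda>c. [:poly_const c:]) (\<lambda>i. [:poly_var i, poly_const (v i):])"

lemma line_subst_hom: "comm_ring_hom (line_subst v)"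
  unfolding line_subst_def
  by (rule evaluate_hom, unfold_locales) (simp_all add: one_pCons)

lemma line_subst_simps [simp]:
  "line_subst v (poly_const c) = [:poly_const c:]" "line_subst v (poly_var i)
    = [:poly_var i, poly_const (v i):]"
proof -
  have "comm_ring_hom (\<lambda>c. [:poly_const c:])" by unfold_locales (simp_all add: one_pCons)
  then show "line_subst v (poly_const c) = [:poly_const c:]"
    "line_subst v (poly_var i) = [:poly_var i, poly_const (v i):]"
    by (simp_all add: line_subst_def)
qed

lemma comm_ring_hom_id: "comm_ring_hom (\<lambda>x :: 'a::comm_ring_1. x)"
  by unfold_locales simp_all

lemma comm_ring_hom_comp: "comm_ring_hom f \<Longrightarrow> comm_ring_hom g \<Longrightarrow> comm_ring_hom (\<lambda>x. f (g x))"
proof -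
  assume "comm_ring_hom f" "comm_ring_hom g"
  then interpret f: comm_ring_hom f + g: comm_ring_hom g by simp_all
  show ?thesis
    by unfold_locales (simp_all add: f.hom_add g.hom_add f.hom_mult g.hom_mult)
qed

lemma comm_ring_hom_poly: "comm_ring_hom (\<lambda>p. poly p (x :: 'a::comm_ring_1))"
  by unfold_locales simp_all

lemma line_subst_at_0: "poly (line_subst v p) 0 = p"
proof -
  obtain N where "p \<in> poly_ring N" using in_some_poly_ring by blast
  then show ?thesis
    by (rule hom_eq_on_poly_ring[OF comm_ring_hom_comp[OF comm_ring_hom_poly[of 0]
      line_subst_hom[of v]] comm_ring_hom_id])
      simp_all
qed

text \<open>The chain rule. Both sides are derivations along \<open>line_subst v\<close>, so
  comparing them on constants and variables is enough.\<close>

lemma pderiv_line_subst: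
  assumes "p \<in> poly_ring N"
  shows "pderiv (line_subst v p) = line_subst v (\<Sum>i<N. poly_const (v i) * partial_deriv i p)"
proof -
  interpret s: comm_ring_hom "line_subst v" by (rule line_subst_hom)
  show ?thesis
  proof (rule derivation_eq_on_poly_ring[of "\<lambda>p. pderiv (line_subst v p)" "\<lambda>p. line_subst v (\<Sum>i<N.
    poly_const (v i) * partial_deriv i p)" "line_subst v", OF _ _ _ _ _ _ assms])
    show "pderiv (line_subst v (p * q)) = pderiv (line_subst v p) * line_subst v q + line_subst v
      p * pderiv (line_subst v q)" for p q
      by (simp add: s.hom_mult pderiv_mult algebra_simps)
    show "line_subst v (\<Sum>i<N. poly_const (v i) * partial_deriv i (p * q))
      = line_subst v (\<Sum>i<N. poly_const (v i) * partial_deriv i p) * line_subst v q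
      + line_subst v p * line_subst v (\<Sum>i<N. poly_const (v i) * partial_deriv i q)" for p q
      unfolding s.hom_mult[symmetric] s.hom_add[symmetric]
      by (simp add: partial_deriv_mult distrib_left sum.distrib sum_distrib_left sum_distrib_right
        mult.assoc mult.left_commute)
    show "pderiv (line_subst v (poly_var i)) = line_subst v (\<Sum>j<N. poly_const (v j) *
      partial_deriv j (poly_var i))"
      if "i < N" for i
      using that by (simp add: pderiv_pCons if_distrib[of "\<lambda>x. _ * x"] cong: if_cong)
  qed (simp_all add: s.hom_add pderiv_add partial_deriv_add distrib_left sum.distrib)
qed

definition at_point :: "(nat \<Rightarrow> complex) \<Rightarrow> cpoly \<Rightarrow> complex" where
  "at_point x = evaluate (\<lambda>c. c) x"

lemma at_point_hom: "comm_ring_hom (at_point x)"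
  unfolding at_point_def by (rule evaluate_hom[OF comm_ring_hom_id])

lemma at_point_simps [simp]: "at_point x (poly_const c) = c" "at_point x (poly_var i) = x i"
  by (simp_all add: at_point_def comm_ring_hom_id)

text \<open>Vanishing everywhere passes to each partial derivative, because the restriction to a
  coordinate line is a polynomial in one variable with all complex numbers as roots. By
  \<open>lookup_deriv\<close>, in characteristic 0, every coefficient is thus reduced to a constant
  term of a derivative.\<close>

lemma eq_0_if_at_point_0:
  assumes "\<And>x. at_point x p = 0"
  shows "p = 0"
proof (rule poly_mapping_eqI)
  have deriv: "at_point x (partial_deriv i p) = 0" if p: "\<And>x. at_point x p = 0" for p i x
  proof -
    obtain M where M: "p \<in> poly_ring M" using in_some_poly_ring by blast
    define N where "N = max M (Suc i)"
    have N: "p \<in> poly_ring N" "i < N" using poly_ring_mono[OF _ M, of N] by (auto simp: N_def)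
    define v :: "nat \<Rightarrow> complex" where "v j = (if j = i then 1 else 0)" for j
    interpret ax: idom_hom "at_point x" unfolding idom_hom_def by (rule at_point_hom)
    interpret s: comm_ring_hom "line_subst v" by (rule line_subst_hom)
    interpret m: map_poly_comm_ring_hom "at_point x" ..
    let ?q = "map_poly (at_point x) (line_subst v p)"
    have "poly ?q t = at_point (\<lambda>j. x j + t * v j) p" for t
    proof (rule hom_eq_on_poly_ring[OF _ at_point_hom N(1)])
      show "comm_ring_hom (\<lambda>p. poly (map_poly (at_point x) (line_subst v p)) t)"
        by (intro comm_ring_hom_comp[OF comm_ring_hom_poly] comm_ring_hom_comp[OF
          m.comm_ring_hom_axioms line_subst_hom])
    qed (simp_all add: ax.map_poly_pCons_hom)
    then have "poly ?q = poly 0" using p by auto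
    then have q: "?q = 0" by (simp only: poly_eq_poly_eq_iff)
    have "pderiv ?q = map_poly (at_point x) (pderiv (line_subst v p))"
      by (rule ax.map_poly_pderiv[symmetric])
    also have "\<dots> = map_poly (at_point x) (line_subst v (partial_deriv i p))"
      using N by (simp add: pderiv_line_subst v_def if_distrib[of poly_const] if_distrib[of "\<lambda>x. x
        * _"] cong: if_cong)
    finally have "poly (map_poly (at_point x) (line_subst v (partial_deriv i p))) 0 = 0"
      by (simp add: q)
    then have "at_point x (poly (line_subst v (partial_deriv i p)) 0) = 0"
      by (metis ax.hom_zero ax.poly_map_poly)
    then show ?thesis by (simp add: line_subst_at_0)
  qed
  have lookup_deriv: "lookup (partial_deriv i p) m
      = of_nat (Suc (lookup m i)) * lookup p (m + single i 1)" for i m p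
  proof -
    let ?e = "single i (1::nat)"
    have "lookup (partial_deriv i p) m = (\<Sum>n\<in>keys p.
        if n = m + ?e then of_nat (lookup n i) * lookup p n else 0)"
      unfolding partial_deriv_def lookup_sum
    proof (intro sum.cong refl)
      fix n
      show "lookup (single (n - ?e) (of_nat (lookup n i) * lookup p n)) m
        = (if n = m + ?e then of_nat (lookup n i) * lookup p n else 0)"
      proof (cases "n - ?e = m \<and> lookup n i \<noteq> 0")
        case True
        then have "n = m + ?e"
          by (intro poly_mapping_eqI) (auto simp: lookup_add lookup_minus lookup_single when_def)
        then show ?thesis by simp
      next
        case False
        moreover have "n \<noteq> m + ?e" if "n - ?e \<noteq> m" using that by auto
        ultimately show ?thesis by (cases "n - ?e = m") (auto simp: lookup_single when_def)
      qed
    qed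
    then show ?thesis by (simp add: lookup_add in_keys_iff)
  qed
  fix m
  have "lookup p m = 0" if "\<And>x. at_point x p = 0" for p m
    using that
  proof (induction "sum (lookup m) (keys m)" arbitrary: m p rule: less_induct)
    case less
    show ?case
    proof (cases "m = 0")
      case True
      have "at_point (\<lambda>_. 0) p = (\<Sum>n\<in>keys p. if n = 0 then lookup p n else 0)"
        unfolding at_point_def evaluate_def
      proof (intro sum.cong refl)
        fix n
        show "lookup p n * monomial_value (\<lambda>_. 0) n = (if n = 0 then lookup p n else 0)"
        proof (cases "n = 0")
          case False
          then obtain i where "i \<in> keys n" using keys_eq_empty by fastforce
          then have "monomial_value (\<lambda>_. 0 :: complex) n = 0"
            unfolding monomial_value_def by (intro prod_zero) (auto simp: in_keys_iff intro!:
              bexI[of _ i])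
          then show ?thesis using False by simp
        qed (simp add: monomial_value_def)
      qed
      then show ?thesis using less.prems True by (auto simp: in_keys_iff split: if_splits)
    next
      case False
      then obtain i where i: "i \<in> keys m" using keys_eq_empty by fastforce
      define n where "n = m - single i 1"
      have m: "m = n + single i 1"
        by (rule poly_mapping_eqI) (use i in \<open>auto simp: n_def lookup_add lookup_minus
          lookup_single when_def in_keys_iff\<close>)
      have "sum (lookup n) (keys n) = sum (lookup n) (keys m)"
        by (rule sum.mono_neutral_left) (auto simp: m lookup_add in_keys_iff)
      also have "\<dots> < sum (lookup m) (keys m)"
        by (rule sum_strict_mono_ex1) (use i in \<open>auto simp: m lookup_add intro!: bexI[of _ i]\<close>)
      finally have "lookup (partial_deriv i p) n = 0"
        using less.hyps deriv less.prems by blast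
      then show ?thesis unfolding lookup_deriv m[symmetric] by (simp del: of_nat_Suc)
    qed
  qed
  then show "lookup p m = lookup 0 m" using assms by simp
qed

section \<open>Determinants\<close>

definition replace_row :: "'r mat \<Rightarrow> nat \<Rightarrow> (nat \<Rightarrow> 'r) \<Rightarrow> 'r mat" where
  "replace_row A k w = mat (dim_row A) (dim_col A) (\<lambda>(i, j). if i = k then w j else A $$ (i, j))"

lemma replace_row_carrier [simp]: "A \<in> carrier_mat m n \<Longrightarrow> replace_row A k w \<in> carrier_mat m n"
  by (auto simp: replace_row_def)

lemma cofactor_replace_row:
  assumes "A \<in> carrier_mat n n" "k < n"
  shows "cofactor (replace_row A k w) k j = cofactor A k j"
  unfolding cofactor_def
  by (rule arg_cong[where f = "\<lambda>M. _ * det M"])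
    (use assms in \<open>auto simp: mat_delete_def replace_row_def intro!: eq_matI\<close>)

lemma det_replace_row:
  fixes A :: "'r::comm_ring_1 mat"
  assumes "A \<in> carrier_mat n n" "k < n"
  shows "det (replace_row A k w) = (\<Sum>j<n. w j * cofactor A k j)"
  using laplace_expansion_row[of "replace_row A k w" n k] assms
  by (simp add: cofactor_replace_row) (auto simp: replace_row_def intro!: sum.cong)

lemma cofactor_row_sum:
  fixes A :: "'r::comm_ring_1 mat"
  assumes A: "A \<in> carrier_mat n n" and "k < n" "l < n"
  shows "(\<Sum>j<n. A $$ (l, j) * cofactor A k j) = (if l = k then det A else 0)"
proof -
  have "(A * adj_mat A) $$ (l, k) = (\<Sum>j<n. A $$ (l, j) * cofactor A k j)"
    using assms by (auto simp: adj_mat_def scalar_prod_def lessThan_atLeast0 intro!: sum.cong)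
  then show ?thesis using assms by (auto simp: adj_mat[OF A] split: if_splits)
qed

lemma cofactor_col_sum:
  fixes A :: "'r::comm_ring_1 mat"
  assumes A: "A \<in> carrier_mat n n" and "i < n" "j < n"
  shows "(\<Sum>k<n. A $$ (k, j) * cofactor A k i) = (if i = j then det A else 0)"
proof -
  have "(adj_mat A * A) $$ (i, j) = (\<Sum>k<n. A $$ (k, j) * cofactor A k i)"
    using assms by (auto simp: adj_mat_def scalar_prod_def lessThan_atLeast0 mult.commute intro!:
      sum.cong)
  then show ?thesis using assms by (auto simp: adj_mat[OF A] split: if_splits)
qed

text \<open>Jacobi's formula: by the product rule the derivative is the sum of the determinants in
  which a single row is differentiated.\<close>

lemma derivation_det:
  fixes d :: "'r::comm_ring_1 \<Rightarrow> 'r"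
  assumes add: "additive d" and mult: "\<And>x y. d (x * y) = d x * y + x * d y"
    and A: "A \<in> carrier_mat n n"
  shows "d (det A) = (\<Sum>k<n. \<Sum>j<n. d (A $$ (k, j)) * cofactor A k j)"
proof -
  interpret d: additive d by (rule add)
  have d1: "d 1 = 0" using mult[of 1 1] by simp
  have d_sign: "d (signof p) = 0" for p :: "nat \<Rightarrow> nat"
    by (cases p rule: sign_cases) (simp_all add: d1 d.minus)
  have d_prod: "d (\<Prod>i\<in>I. f i) = (\<Sum>k\<in>I. d (f k) * (\<Prod>i\<in>I - {k}. f i))" if "finite I"
    for I :: "nat set" and f
    using that
  proof (induction I rule: finite_induct)
    case (insert x I)
    have "(\<Sum>k\<in>I. d (f k) * (\<Prod>i\<in>insert x I - {k}. f i)) = f x * (\<Sum>k\<in>I. d (f k) * (\<Prod>i\<in>I - {k}. f i))"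
      unfolding sum_distrib_left
    proof (intro sum.cong refl)
      fix k assume "k \<in> I"
      then have "insert x I - {k} = insert x (I - {k})" using insert by auto
      then show "d (f k) * (\<Prod>i\<in>insert x I - {k}. f i) = f x * (d (f k) * (\<Prod>i\<in>I - {k}. f i))"
        using insert by (simp add: mult.left_commute)
    qed
    then show ?case using insert by (simp add: mult)
  qed (simp add: d1)
  have "d (det A) = (\<Sum>p | p permutes {0..<n}. \<Sum>k\<in>{0..<n}. signof p * (d (A $$ (k, p k)) *
    (\<Prod>i\<in>{0..<n} - {k}. A $$ (i, p i))))"
    unfolding det_def'[OF A] d.sum by (intro sum.cong refl) (simp add: mult d_sign d_prod
      sum_distrib_left)
  also have "\<dots> = (\<Sum>k\<in>{0..<n}. \<Sum>p | p permutes {0..<n}. signof p * (d (A $$ (k, p k)) * (\<Prod>i\<in>{0..<n}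
    - {k}. A $$ (i, p i))))"
    by (rule sum.swap)
  also have "\<dots> = (\<Sum>k\<in>{0..<n}. det (replace_row A k (\<lambda>j. d (A $$ (k, j)))))"
  proof (intro sum.cong refl)
    fix k assume k: "k \<in> {0..<n}"
    have R: "replace_row A k (\<lambda>j. d (A $$ (k, j))) \<in> carrier_mat n n" using A by simp
    show "(\<Sum>p | p permutes {0..<n}. signof p * (d (A $$ (k, p k)) * (\<Prod>i\<in>{0..<n} - {k}. A $$ (i, p
      i))))
      = det (replace_row A k (\<lambda>j. d (A $$ (k, j))))"
      unfolding det_def'[OF R]
    proof (intro sum.cong refl arg_cong2[of _ _ _ _ "(*)"])
      fix p assume "p \<in> {p. p permutes {0..<n}}"
      then have p: "p i < n" if "i < n" for i using that permutes_in_image[of p "{0..<n}" i] by simp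
      show "d (A $$ (k, p k)) * (\<Prod>i\<in>{0..<n} - {k}. A $$ (i, p i))
        = (\<Prod>i = 0..<n. replace_row A k (\<lambda>j. d (A $$ (k, j))) $$ (i, p i))"
        using k A p by (subst prod.remove[of _ k]) (auto simp: replace_row_def intro!:
          arg_cong2[of _ _ _ _ "(*)"] prod.cong)
    qed
  qed
  also have "\<dots> = (\<Sum>k<n. \<Sum>j<n. d (A $$ (k, j)) * cofactor A k j)"
    using A by (auto simp: det_replace_row lessThan_atLeast0 intro!: sum.cong)
  finally show ?thesis .
qed

text \<open>If the derivative of \<open>A\<close> is \<open>C A + A D\<close>, the determinant is
  multiplied by the sum of the two traces. This is how the discriminant turns out to be a
  semi-invariant.\<close>

lemma derivation_det_linear:
  fixes d :: "'r::comm_ring_1 \<Rightarrow> 'r"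
  assumes "additive d" "\<And>x y. d (x * y) = d x * y + x * d y" and A: "A \<in> carrier_mat n n"
    and lin: "\<And>k j. k < n \<Longrightarrow> j < n \<Longrightarrow>
      d (A $$ (k, j)) = (\<Sum>l<n. C k l * A $$ (l, j)) + (\<Sum>i<n. A $$ (k, i) * D i j)"
  shows "d (det A) = det A * ((\<Sum>k<n. C k k) + (\<Sum>j<n. D j j))"
proof -
  have "d (det A) = (\<Sum>k<n. \<Sum>j<n. (\<Sum>l<n. C k l * A $$ (l, j)) * cofactor A k j)
      + (\<Sum>k<n. \<Sum>j<n. (\<Sum>i<n. A $$ (k, i) * D i j) * cofactor A k j)"
    by (simp add: derivation_det[OF assms(1,2) A] lin distrib_right sum.distrib)
  also have "(\<Sum>k<n. \<Sum>j<n. (\<Sum>l<n. C k l * A $$ (l, j)) * cofactor A k j)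
      = (\<Sum>k<n. \<Sum>l<n. C k l * (\<Sum>j<n. A $$ (l, j) * cofactor A k j))"
  proof (rule sum.cong[OF refl])
    fix k
    have "(\<Sum>j<n. (\<Sum>l<n. C k l * A $$ (l, j)) * cofactor A k j)
        = (\<Sum>j<n. \<Sum>l<n. C k l * (A $$ (l, j) * cofactor A k j))"
      by (simp add: sum_distrib_right mult.assoc)
    also have "\<dots> = (\<Sum>l<n. \<Sum>j<n. C k l * (A $$ (l, j) * cofactor A k j))"
      by (rule sum.swap)
    finally show "(\<Sum>j<n. (\<Sum>l<n. C k l * A $$ (l, j)) * cofactor A k j)
        = (\<Sum>l<n. C k l * (\<Sum>j<n. A $$ (l, j) * cofactor A k j))"
      by (simp add: sum_distrib_left)
  qed
  also have "\<dots> = (\<Sum>k<n. C k k * det A)"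
    by (intro sum.cong refl) (simp add: cofactor_row_sum[OF A] if_distrib[of "\<lambda>x. _ * x"] cong:
      if_cong)
  also have "(\<Sum>k<n. \<Sum>j<n. (\<Sum>i<n. A $$ (k, i) * D i j) * cofactor A k j)
      = (\<Sum>j<n. \<Sum>i<n. D i j * (\<Sum>k<n. A $$ (k, i) * cofactor A k j))"
  proof -
    have "(\<Sum>k<n. \<Sum>j<n. (\<Sum>i<n. A $$ (k, i) * D i j) * cofactor A k j)
        = (\<Sum>j<n. \<Sum>k<n. \<Sum>i<n. D i j * (A $$ (k, i) * cofactor A k j))"
      by (subst sum.swap) (simp add: sum_distrib_right sum_distrib_left mult_ac)
    also have "\<dots> = (\<Sum>j<n. \<Sum>i<n. \<Sum>k<n. D i j * (A $$ (k, i) * cofactor A k j))"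
      by (rule sum.cong[OF refl]) (rule sum.swap)
    finally show ?thesis by (simp add: sum_distrib_left)
  qed
  also have "\<dots> = (\<Sum>j<n. D j j * det A)"
    by (intro sum.cong refl) (simp add: cofactor_col_sum[OF A] if_distrib[of "\<lambda>x. _ * x"] cong:
      if_cong)
  finally show ?thesis by (simp add: algebra_simps sum_distrib_left sum_distrib_right)
qed

lemma cramer_row:
  fixes A :: "'r::comm_ring_1 mat"
  assumes A: "A \<in> carrier_mat n n" and "j < n"
  shows "(\<Sum>k<n. det (replace_row A k w) * A $$ (k, j)) = det A * w j"
proof -
  have "(\<Sum>k<n. det (replace_row A k w) * A $$ (k, j)) = (\<Sum>k<n. \<Sum>i<n. w i * (A $$ (k, j) * cofactor
    A k i))"
    using A by (intro sum.cong refl) (auto simp: det_replace_row sum_distrib_right mult_ac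
      sum_distrib_left intro!: sum.cong)
  also have "\<dots> = (\<Sum>i<n. w i * (\<Sum>k<n. A $$ (k, j) * cofactor A k i))"
    by (subst sum.swap) (simp add: sum_distrib_left)
  also have "\<dots> = (\<Sum>i<n. w i * (if i = j then det A else 0))"
    using assms by (intro sum.cong) (auto simp: cofactor_col_sum)
  finally show ?thesis using assms by (simp add: if_distrib[of "\<lambda>x. _ * x"] mult.commute cong:
    if_cong)
qed

lemma det_replace_row_combination:
  fixes A :: "'r::comm_ring_1 mat"
  assumes A: "A \<in> carrier_mat n n" and k: "k < n"
  shows "det (replace_row A k (\<lambda>j. \<Sum>l<n. c l * A $$ (l, j))) = c k * det A"
proof -
  have "det (replace_row A k (\<lambda>j. \<Sum>l<n. c l * A $$ (l, j)))
    = (\<Sum>j<n. \<Sum>l<n. c l * (A $$ (l, j) * cofactor A k j))"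
    using assms by (simp add: det_replace_row sum_distrib_right mult.assoc)
  also have "\<dots> = (\<Sum>l<n. c l * (\<Sum>j<n. A $$ (l, j) * cofactor A k j))"
    by (subst sum.swap) (simp add: sum_distrib_left)
  finally show ?thesis
    using assms by (simp add: cofactor_row_sum if_distrib[of "\<lambda>x. _ * x"] cong: if_cong)
qed

lemma det_0_iff_common_zero:
  fixes A :: "'l::field mat"
  assumes A: "A \<in> carrier_mat n n"
  shows "det A = 0 \<longleftrightarrow> (\<exists>z. (\<exists>j<n. z j \<noteq> 0) \<and> (\<forall>k<n. (\<Sum>j<n. A $$ (k, j) * z j) = 0))"
proof -
  have mv: "(A *\<^sub>v v) $ k = (\<Sum>j<n. A $$ (k, j) * v $ j)" if "k < n" "v \<in> carrier_vec n" for v k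
    using that A by (auto simp: scalar_prod_def lessThan_atLeast0 intro!: sum.cong)
  show ?thesis
  proof
    assume "det A = 0"
    then obtain v where v: "v \<in> carrier_vec n" "v \<noteq> 0\<^sub>v n" "A *\<^sub>v v = 0\<^sub>v n"
      using det_0_iff_vec_prod_zero[OF A] by blast
    then have "\<exists>j<n. v $ j \<noteq> 0" by (metis carrier_vecD eq_vecI index_zero_vec)
    moreover have "(\<Sum>j<n. A $$ (k, j) * v $ j) = 0" if "k < n" for k
      using mv[OF that v(1)] v(3) that by simp
    ultimately show "\<exists>z. (\<exists>j<n. z j \<noteq> 0) \<and> (\<forall>k<n. (\<Sum>j<n. A $$ (k, j) * z j) = 0)"
      by (intro exI[of _ "\<lambda>j. v $ j"]) blast
  next
    assume "\<exists>z. (\<exists>j<n. z j \<noteq> 0) \<and> (\<forall>k<n. (\<Sum>j<n. A $$ (k, j) * z j) = 0)"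
    then obtain z where z: "\<exists>j<n. z j \<noteq> 0" "\<forall>k<n. (\<Sum>j<n. A $$ (k, j) * z j) = 0" by blast
    let ?v = "vec n z"
    have "?v \<noteq> 0\<^sub>v n" using z(1) by (metis index_vec index_zero_vec(1))
    moreover have "A *\<^sub>v ?v = 0\<^sub>v n"
      by (rule eq_vecI) (use A z(2) mv[of _ ?v] in auto)
    ultimately show "det A = 0" using det_0_iff_vec_prod_zero[OF A] by (metis vec_carrier)
  qed
qed

section \<open>Restriction of the discriminant to a line\<close>

lemma dvd_if_simple_roots:
  fixes p r :: "'l::alg_closed_field poly"
  assumes "p \<noteq> 0" "\<And>x. poly p x = 0 \<Longrightarrow> poly (pderiv p) x \<noteq> 0" "\<And>x. poly p x = 0 \<Longrightarrow> poly r x = 0"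
  shows "p dvd r"
  using assms
proof (induction "degree p" arbitrary: p r rule: less_induct)
  case less
  show ?case
  proof (cases "degree p = 0")
    case True
    then show ?thesis using less.prems(1) by (metis is_unit_iff_degree unit_imp_dvd)
  next
    case False
    then obtain x where x: "poly p x = 0" using alg_closed_imp_poly_has_root[of p] by auto
    obtain p' where p': "p = [:- x, 1:] * p'" using x by (metis dvdE poly_eq_0_iff_dvd)
    obtain r' where r': "r = [:- x, 1:] * r'" using less.prems(3)[OF x]
      by (metis dvdE poly_eq_0_iff_dvd)
    have "p' \<noteq> 0" using less.prems(1) p' by auto
    have pd: "pderiv p = p' + [:- x, 1:] * pderiv p'"
      by (simp add: p' pderiv_mult pderiv_pCons del: mult_pCons_left)
    have ev1: "poly (pderiv p) z = poly p' z + (z - x) * poly (pderiv p') z" for z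
      unfolding pd by (simp add: algebra_simps)
    have ev2: "poly p z = (z - x) * poly p' z" "poly r z = (z - x) * poly r' z" for z
      unfolding p' r' poly_mult by (simp_all add: algebra_simps)
    note ev = ev1 ev2
    have "p' dvd r'"
    proof (rule less.hyps)
      show "degree p' < degree p" using \<open>p' \<noteq> 0\<close> by (simp add: p' degree_mult_eq del: mult_pCons_left)
      show "poly (pderiv p') z \<noteq> 0" if "poly p' z = 0" for z
        using less.prems(2)[of z] that by (auto simp: ev)
      \<comment> \<open>The root \<open>x\<close> of \<open>p\<close> is simple, so it is not a root
        of \<open>p'\<close>; hence \<open>z - x\<close> is non-zero and can be cancelled.\<close>
      show "poly r' z = 0" if "poly p' z = 0" for z
        using less.prems(2)[OF x] less.prems(3)[of z] that by (auto simp: ev)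
    qed fact
    then show ?thesis unfolding p' r' by (rule mult_dvd_mono[OF dvd_refl])
  qed
qed

lemma prod_linear_polys:
  fixes f g :: "'i \<Rightarrow> 'r::comm_ring_1"
  assumes "finite I"
  shows "degree (\<Prod>i\<in>I. [:f i, g i:]) \<le> card I \<and> coeff (\<Prod>i\<in>I. [:f i, g i:]) (card I) = (\<Prod>i\<in>I. g i)"
  using assms
proof (induction I rule: finite_induct)
  case (insert x I)
  let ?p = "\<Prod>i\<in>I. [:f i, g i:]"
  have "coeff ?p (Suc (card I)) = 0" using insert by (intro coeff_eq_0) auto
  moreover have "degree ([:f x, g x:] * ?p) \<le> degree [:f x, g x:] + degree ?p"
    by (rule degree_mult_le)
  moreover have "degree [:f x, g x:] \<le> 1" by simp
  ultimately show ?case using insert by (auto simp del: mult_pCons_left) (simp add: insert)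
qed simp

lemma det_linear_polys:
  fixes a b :: "nat \<Rightarrow> nat \<Rightarrow> 'r::comm_ring_1" and n :: nat
  defines "M \<equiv> mat n n (\<lambda>(i, j). [:a i j, b i j:])"
  shows "degree (det M) \<le> n" "coeff (det M) n = det (mat n n (\<lambda>(i, j). b i j))"
proof -
  have M: "M \<in> carrier_mat n n" by (simp add: M_def)
  have pr: "(\<Prod>i = 0..<n. M $$ (i, p i)) = (\<Prod>i = 0..<n. [:a i (p i), b i (p i):])"
    if "p permutes {0..<n}" for p
    using permutes_in_image[OF that] by (intro prod.cong) (auto simp: M_def)
  have sg: "(signof p :: 'r poly) = [:signof p:]" for p :: "nat \<Rightarrow> nat"
    by (cases p rule: sign_cases) (simp_all add: one_pCons)
  have eq: "det M = (\<Sum>p | p permutes {0..<n}. smult (signof p) (\<Prod>i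
    = 0..<n. [:a i (p i), b i (p i):]))"
    unfolding det_def'[OF M] by (intro sum.cong refl) (simp add: pr sg)
  have lin: "degree (\<Prod>i = 0..<n. [:a i (p i), b i (p i):]) \<le> n"
    "coeff (\<Prod>i = 0..<n. [:a i (p i), b i (p i):]) n = (\<Prod>i = 0..<n. b i (p i))" for p
    using prod_linear_polys[of "{0..<n}" "\<lambda>i. a i (p i)" "\<lambda>i. b i (p i)"] by simp_all
  show "degree (det M) \<le> n"
    unfolding eq by (intro degree_sum_le finite_permutations order_trans[OF degree_smult_le
      lin(1)]) simp
  have "coeff (det M) n = (\<Sum>p | p permutes {0..<n}. signof p * (\<Prod>i = 0..<n. b i (p i)))"
    unfolding eq coeff_sum by (simp add: lin)
  also have "\<dots> = det (mat n n (\<lambda>(i, j). b i j))"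
    unfolding det_def'[OF mat_carrier] by (intro sum.cong refl arg_cong2[of _ _ _ _ "(*)"] prod.cong)
      (auto dest: permutes_in_image)
  finally show "coeff (det M) n = det (mat n n (\<lambda>(i, j). b i j))" .
qed

text \<open>For the coefficient matrix, \<open>z\<close> is a non-zero linear functional that
  vanishes on the tangent space of the orbit at the point given by \<open>\<phi>\<close>. The
  arguments about non-open orbits all work with such a functional.\<close>

lemma common_zero_if_hom_det_0:
  fixes \<phi> :: "'r::comm_ring_1 \<Rightarrow> 'l::field"
  assumes \<phi>: "comm_ring_hom \<phi>" and A: "A \<in> carrier_mat n n" and det: "\<phi> (det A) = 0"
  obtains z j where "j < n" "z j \<noteq> 0" "\<And>k. k < n \<Longrightarrow> (\<Sum>l<n. \<phi> (A $$ (k, l)) * z l) = 0"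
proof -
  interpret \<phi>: comm_ring_hom \<phi> by (rule \<phi>)
  have M: "map_mat \<phi> A \<in> carrier_mat n n" using A by simp
  have "det (map_mat \<phi> A) = 0" using det by (simp only: \<phi>.hom_det)
  then obtain z j where z: "j < n" "z j \<noteq> 0" "\<forall>k<n. (\<Sum>l<n. map_mat \<phi> A $$ (k, l) * z l) = 0"
    unfolding det_0_iff_common_zero[OF M] by blast
  have "(\<Sum>l<n. \<phi> (A $$ (k, l)) * z l) = 0" if "k < n" for k
  proof -
    have "(\<Sum>l<n. \<phi> (A $$ (k, l)) * z l) = (\<Sum>l<n. map_mat \<phi> A $$ (k, l) * z l)"
      using A that by (intro sum.cong) auto
    then show ?thesis using z(3) that by simp
  qed
  with z(1,2) show ?thesis by (rule that)
qed

locale square_box = positive_box V Q a for V :: "'v set" and Q :: "('v \<times> 'v) set"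
  and a :: "'v \<Rightarrow> nat" +
  fixes e :: "nat \<Rightarrow> 'v coord" and B :: "('v \<Rightarrow> complex mat) list"
  assumes e: "bij_betw e {..<rep_dim Q a} (rep_coords Q a)" and B: "pgl_basis V a B"
    and len: "length B = rep_dim Q a"
begin

abbreviation "N \<equiv> rep_dim Q a"

abbreviation "\<Delta> \<equiv> coefficient_matrix Q a e B"

abbreviation "f \<equiv> discriminant Q a e B"

definition coord_ix :: "'v coord \<Rightarrow> nat" where
  "coord_ix c = inv_into {..<N} e c"

definition base :: "(complex \<Rightarrow> 'r::comm_ring_1) \<Rightarrow> nat \<Rightarrow> 'v \<Rightarrow> nat \<Rightarrow> nat \<Rightarrow> 'r" where
  "base h k v i j = h ((B ! k) v $$ (i, j))"

lemma coord_ix [simp]: "l < N \<Longrightarrow> coord_ix (e l) = l"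
  using e by (auto simp: coord_ix_def bij_betw_def)

lemma e_coord [simp]: "l < N \<Longrightarrow> e l \<in> rep_coords Q a"
  using e by (auto simp: bij_betw_def)

lemma coord_ix_inverse: "c \<in> rep_coords Q a \<Longrightarrow> e (coord_ix c) = c \<and> coord_ix c < N"
  using e unfolding coord_ix_def by (metis bij_betw_def f_inv_into_f inv_into_into lessThan_iff)

lemma ball_coords_iff: "(\<forall>c\<in>rep_coords Q a. P c) \<longleftrightarrow> (\<forall>l<N. P (e l))"
  using coord_ix_inverse by (metis e_coord)

lemma \<Delta>_carrier [simp]: "\<Delta> \<in> carrier_mat N N"
  by (simp add: coefficient_matrix_def len)

lemma B_carrier: "k < N \<Longrightarrow> v \<in> V \<Longrightarrow> (B ! k) v \<in> carrier_mat (a v) (a v)"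
proof -
  assume "k < N" "v \<in> V"
  have "set B \<subseteq> gl_algebra V a" using B unfolding pgl_basis_def by (rule conjunct1)
  moreover have "B ! k \<in> set B" using \<open>k < N\<close> len by simp
  ultimately have "B ! k \<in> gl_algebra V a" by (rule subsetD)
  then show ?thesis using \<open>v \<in> V\<close> by (simp add: gl_algebra_def)
qed

lemma action_field_act:
  assumes "\<And>v. v \<in> V \<Longrightarrow> \<xi> v \<in> carrier_mat (a v) (a v)" and l: "l < N"
  shows "action_field Q a e \<xi> l
    = act a (\<lambda>v i j. poly_const (\<xi> v $$ (i, j))) (\<lambda>c. poly_var (coord_ix c)) (e l)"
proof -
  obtain t h i j where c: "e l = ((t, h), i, j)" "(t, h) \<in> Q" "i < a h" "j < a t"
    using e_coord[OF l] by (auto simp: rep_coords_def)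
  then have "\<xi> t \<in> carrier_mat (a t) (a t)" "\<xi> h \<in> carrier_mat (a h) (a h)" using QV assms(1) by auto
  then show ?thesis
    using c l by (auto simp: action_field_def act_def inf_action_def generic_mat_def scalar_prod_def
        lessThan_atLeast0 coord_ix_def intro!: arg_cong2[of _ _ _ _ "(-)"] sum.cong)
qed

lemma \<Delta>_entry:
  assumes "k < N" "l < N"
  shows "\<Delta> $$ (k, l) = act a (base poly_const k) (\<lambda>c. poly_var (coord_ix c)) (e l)"
  using assms B_carrier[OF assms(1)]
  by (simp add: coefficient_matrix_def len action_field_act base_def[abs_def])

text \<open>The basis \<open>B\<close> together with the identity still spans after extension of
  scalars along \<open>h\<close>: the matrix units \<open>E g\<close> are expanded over the complex
  numbers, and an arbitrary \<open>\<xi>\<close> is a combination of their images.\<close>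

lemma gl_spanned:
  fixes h :: "complex \<Rightarrow> 'r::comm_ring_1" and \<xi> :: "'v \<Rightarrow> nat \<Rightarrow> nat \<Rightarrow> 'r"
  assumes h: "comm_ring_hom h"
  shows "\<exists>c s. \<forall>v\<in>V. \<forall>i<a v. \<forall>j<a v. \<xi> v i j = (\<Sum>k<N. c k * base h k v i j) + (if i
    = j then s else 0)"
proof -
  interpret h: comm_ring_hom h by (rule h)
  define G where "G = Sigma V (\<lambda>v. {..<a v} \<times> {..<a v})"
  have finG: "finite G" using fin by (auto simp: G_def)
  define E where "E g v i j = (if g = (v, i, j) then 1 else 0 :: complex)"
    for g :: "'v \<times> nat \<times> nat" and v i j
  have "\<exists>c s. \<forall>v\<in>V. \<forall>i<a v. \<forall>j<a v. E g v i j = (\<Sum>k<N. c k * (B ! k) v $$ (i, j)) + (if i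
    = j then s else 0)" for g
  proof -
    have "(\<lambda>v. mat (a v) (a v) (\<lambda>(i, j). E g v i j)) \<in> gl_algebra V a" by (simp add: gl_algebra_def)
    then obtain c where "equal_mod_id V a (\<lambda>v. mat (a v) (a v) (\<lambda>(i, j). E g v i j))
      (gl_combination a c B)"
      using B unfolding pgl_basis_def by blast
    then obtain s where cs: "\<And>v. v \<in> V \<Longrightarrow> mat (a v) (a v) (\<lambda>(i, j). E g v i j)
      = gl_combination a c B v + s \<cdot>\<^sub>m 1\<^sub>m (a v)"
      unfolding equal_mod_id_def by blast
    have "E g v i j = (\<Sum>k<N. c k * (B ! k) v $$ (i, j)) + (if i = j then s else 0)"
      if "v \<in> V" "i < a v" "j < a v" for v i j
    proof -
      have "E g v i j = mat (a v) (a v) (\<lambda>(i, j). E g v i j) $$ (i, j)" using that by simp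
      also have "\<dots> = (gl_combination a c B v + s \<cdot>\<^sub>m 1\<^sub>m (a v)) $$ (i, j)"
        by (simp only: cs[OF that(1)])
      finally show ?thesis using that by (simp add: gl_combination_def len)
    qed
    then show ?thesis by blast
  qed
  then obtain c s where cs: "\<And>g v i j. v \<in> V \<Longrightarrow> i < a v \<Longrightarrow> j < a v \<Longrightarrow>
      E g v i j = (\<Sum>k<N. c g k * (B ! k) v $$ (i, j)) + (if i = j then s g else 0)" by metis
  define x where "x g = (case g of (v, i, j) \<Rightarrow> \<xi> v i j)" for g
  have "\<xi> v i j = (\<Sum>k<N. (\<Sum>g\<in>G. x g * h (c g k)) * base h k v i j) + (if i
    = j then \<Sum>g\<in>G. x g * h (s g) else 0)"
    if v: "v \<in> V" "i < a v" "j < a v" for v i j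
  proof -
    have "(v, i, j) \<in> G" using v by (simp add: G_def)
    then have "\<xi> v i j = (\<Sum>g\<in>G. x g * h (E g v i j))"
      using finG by (simp add: E_def x_def if_distrib[of h] if_distrib[of "\<lambda>x. _ * x"] cong: if_cong)
    also have "\<dots> = (\<Sum>g\<in>G. \<Sum>k<N. x g * h (c g k) * base h k v i j) + (if i
      = j then \<Sum>g\<in>G. x g * h (s g) else 0)"
      using v by (simp add: cs base_def h.hom_add h.hom_sum h.hom_mult distrib_left sum.distrib
        sum_distrib_left mult.assoc)
    also have "(\<Sum>g\<in>G. \<Sum>k<N. x g * h (c g k) * base h k v i j) = (\<Sum>k<N. (\<Sum>g\<in>G. x g * h (c g k)) *
      base h k v i j)"
      by (subst sum.swap) (simp add: sum_distrib_right)
    finally show ?thesis .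
  qed
  then show ?thesis by (intro exI[of _ "\<lambda>k. \<Sum>g\<in>G. x g * h (c g k)"] exI[of _ "\<Sum>g\<in>G. x g * h
    (s g)"]) blast
qed

lemma act_spanned:
  assumes h: "comm_ring_hom h"
  shows "\<exists>c. \<forall>x. \<forall>b\<in>rep_coords Q a. act a \<xi> x b = (\<Sum>k<N. c k * act a (base h k) x b)"
proof -
  obtain c s where cs: "\<And>v i j. v \<in> V \<Longrightarrow> i < a v \<Longrightarrow> j < a v \<Longrightarrow>
    \<xi> v i j = (\<Sum>k<N. c k * base h k v i j) + (if i = j then s else 0)"
      using gl_spanned[OF h, of \<xi>] by blast
  have "act a \<xi> x b = (\<Sum>k<N. c k * act a (base h k) x b)" if b: "b \<in> rep_coords Q a" for x b
  proof -
    have "act a \<xi> x b = act a (\<lambda>v i j. (\<Sum>k<N. c k * base h k v i j) + (if i = j then s else 0)) x b"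
      by (rule act_cong_left[OF QV b cs])
    then show ?thesis by (simp add: act_add act_sum act_scale act_scalar[OF b])
  qed
  then show ?thesis by blast
qed

lemma discriminant_det: "f = det \<Delta>"
  by (simp add: discriminant_def)

text \<open>The rows of \<open>\<Delta>\<close>, evaluated by \<open>\<phi>\<close>, span the
  tangent space of the orbit of the corresponding point; the scalar part of \<open>\<eta>\<close>
  acts by 0.\<close>

lemma functional_vanishes_on_orbit:
  fixes \<phi> :: "cpoly \<Rightarrow> 'l::field"
  assumes \<phi>: "comm_ring_hom \<phi>"
    and z: "\<And>k. k < N \<Longrightarrow> (\<Sum>l<N. \<phi> (\<Delta> $$ (k, l)) * z l) = 0"
    and w: "\<And>l. l < N \<Longrightarrow> w l = act a \<eta> (\<lambda>c. \<phi> (poly_var (coord_ix c))) (e l)"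
  shows "(\<Sum>l<N. w l * z l) = 0"
proof -
  have h: "comm_ring_hom (\<lambda>x. \<phi> (poly_const x))" by (rule comm_ring_hom_comp[OF \<phi> poly_const_hom])
  obtain c where c: "\<forall>x. \<forall>b\<in>rep_coords Q a. act a \<eta> x b = (\<Sum>k<N. c k * act a (base (\<lambda>x. \<phi>
    (poly_const x)) k) x b)"
    using act_spanned[OF h] by blast
  have "act a (base (\<lambda>x. \<phi> (poly_const x)) k) (\<lambda>c. \<phi> (poly_var (coord_ix c))) (e l) = \<phi> (\<Delta> $$ (k, l))"
    if "k < N" "l < N" for k l
    using that by (simp add: \<Delta>_entry act_hom[OF \<phi>] base_def[abs_def])
  then have "w l = (\<Sum>k<N. c k * \<phi> (\<Delta> $$ (k, l)))" if "l < N" for l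
    using w[OF that] c that by simp
  then have "(\<Sum>l<N. w l * z l) = (\<Sum>l<N. \<Sum>k<N. c k * (\<phi> (\<Delta> $$ (k, l)) * z l))"
    by (simp add: sum_distrib_right mult.assoc)
  also have "\<dots> = (\<Sum>k<N. c k * (\<Sum>l<N. \<phi> (\<Delta> $$ (k, l)) * z l))"
    by (subst sum.swap) (simp add: sum_distrib_left)
  finally show ?thesis by (simp add: z)
qed

end

text \<open>The images of the variables are the coordinates of the generic point; the algebraic
  closure supplies the roots \<open>\<theta>\<close> on the generic line.\<close>

definition to_closure :: "cpoly \<Rightarrow> cpoly fract alg_closure" where
  "to_closure p = to_ac (Fract p 1)"

lemma to_closure_hom: "comm_ring_hom to_closure"
  by unfold_locales (simp_all add: to_closure_def flip: Zero_fract_def One_fract_def to_ac_add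
    to_ac_mult)

lemma to_closure_eq_0_iff [simp]: "to_closure p = 0 \<longleftrightarrow> p = 0"
  by (simp add: to_closure_def Zero_fract_def eq_fract)

section \<open>The open orbit\<close>

context square_box
begin

text \<open>\<open>partial_deriv j\<close> sends the generic point to the \<open>j\<close>-th unit
  vector, which is therefore tangent to its orbit. A functional killing the tangent space kills all
  unit vectors.\<close>

lemma discriminant_nonzero: "f \<noteq> 0"
proof
  assume "f = 0"
  interpret \<iota>: comm_ring_hom to_closure by (rule to_closure_hom)
  have "to_closure (det \<Delta>) = 0" using \<open>f = 0\<close> by (simp add: discriminant_det)
  then obtain z i where z: "i < N" "z i \<noteq> 0" "\<And>k. k < N \<Longrightarrow> (\<Sum>l<N. to_closure (\<Delta> $$ (k, l)) * z l) = 0"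
    using common_zero_if_hom_det_0[OF to_closure_hom \<Delta>_carrier] by blast
  have "z j = 0" if j: "j < N" for j
  proof -
    have "\<exists>\<eta>. \<forall>c\<in>rep_coords Q a. to_closure (partial_deriv j (poly_var (coord_ix c)))
        = act a \<eta> (\<lambda>c. to_closure (poly_var (coord_ix c))) c"
    proof (rule derivation_tangent_to_orbit[of to_closure "\<lambda>p. to_closure (partial_deriv j p)"
      "\<lambda>c. poly_var (coord_ix c)"])
      show "additive to_closure" "additive (\<lambda>p. to_closure (partial_deriv j p))"
        unfolding additive_def \<iota>.hom_add partial_deriv_add by blast+
      show "to_closure (p * q) = to_closure p * to_closure q" "to_closure 1 = 1" for p q
        by (rule \<iota>.hom_mult \<iota>.hom_one)+
      show "to_closure (partial_deriv j (p * q))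
        = to_closure (partial_deriv j p) * to_closure q + to_closure p * to_closure (partial_deriv
          j q)" for p q
        by (simp only: partial_deriv_mult \<iota>.hom_add \<iota>.hom_mult)
      show "to_closure (partial_deriv j p) = 0" if "to_closure p = 0" for p
        using that by simp
    qed
    then obtain \<eta> where \<eta>: "\<And>l. l < N \<Longrightarrow> to_closure (partial_deriv j (poly_var l))
        = act a \<eta> (\<lambda>c. to_closure (poly_var (coord_ix c))) (e l)"
      unfolding ball_coords_iff by (metis coord_ix)
    have w: "(if l = j then 1 else 0) = act a \<eta> (\<lambda>c. to_closure (poly_var (coord_ix c))) (e l)"
      if "l < N" for l
      unfolding \<eta>[OF that, symmetric] by (simp add: \<iota>.hom_one \<iota>.hom_zero)
    have "(\<Sum>l<N. (if l = j then 1 else 0) * z l) = 0"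
      by (rule functional_vanishes_on_orbit[OF to_closure_hom z(3) w])
    then show ?thesis using j by (simp add: if_distrib[of "\<lambda>x. x * _"] cong: if_cong)
  qed
  with z(1,2) show False by blast
qed

end

text \<open>After \<open>line_subst v\<close> this is evaluation at the point
  \<open>x + \<theta> v\<close>.\<close>

definition at_param :: "cpoly fract alg_closure \<Rightarrow> cpoly poly \<Rightarrow> cpoly fract alg_closure" where
  "at_param \<theta> p = poly (map_poly to_closure p) \<theta>"

lemma at_param_hom: "comm_ring_hom (at_param \<theta>)"
proof -
  interpret \<iota>: comm_ring_hom to_closure by (rule to_closure_hom)
  interpret m: map_poly_comm_ring_hom to_closure ..
  show ?thesis unfolding at_param_def by (rule comm_ring_hom_comp[OF comm_ring_hom_poly
    m.comm_ring_hom_axioms])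
qed

lemma at_param_pCons: "at_param \<theta> (pCons c p) = to_closure c + \<theta> * at_param \<theta> p"
proof -
  interpret \<iota>: comm_ring_hom to_closure by (rule to_closure_hom)
  show ?thesis by (simp add: at_param_def \<iota>.map_poly_pCons_hom)
qed

lemma at_param_0: "at_param \<theta> 0 = 0"
  by (simp add: at_param_def)

lemma map_poly_partial_deriv_add:
  "map_poly (partial_deriv j) (p + q) = map_poly (partial_deriv j) p + map_poly (partial_deriv j) q"
  by (intro poly_eqI) (simp add: coeff_map_poly partial_deriv_add)

lemma map_poly_partial_deriv_linear:
  "map_poly (partial_deriv j) [:p, q:] = [:partial_deriv j p, partial_deriv j q:]"
  by (intro poly_eqI) (simp add: coeff_map_poly coeff_pCons split: nat.split)

lemma map_poly_partial_deriv_mult: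
  "map_poly (partial_deriv j) (p * q) = map_poly (partial_deriv j) p * q + p * map_poly
    (partial_deriv j) q"
proof -
  have sum: "partial_deriv j (\<Sum>i\<in>A. g i) = (\<Sum>i\<in>A. partial_deriv j (g i))" for A :: "nat set" and g
    by (induction A rule: infinite_finite_induct) (simp_all add: partial_deriv_add)
  show ?thesis
    by (intro poly_eqI) (simp add: coeff_map_poly coeff_mult sum partial_deriv_mult sum.distrib)
qed

text \<open>\<open>\<partial>/\<partial>x\<^sub>j\<close> on polynomials in \<open>x\<close> extends to the field generated by an algebraic element \<open>\<theta>\<close>:
  the constant \<open>c\<close> below is the derivative of \<open>\<theta>\<close>.\<close>

lemma extended_partial_deriv:
  assumes p: "p \<noteq> 0" "at_param \<theta> p = 0"
  obtains c where "\<And>g. at_param \<theta> g = 0 \<Longrightarrow> at_param \<theta> (map_poly (partial_deriv j) g) + c * at_param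
    \<theta> (pderiv g) = 0"
proof -
  interpret ev: comm_ring_hom "at_param \<theta>" by (rule at_param_hom)
  let ?P = "\<lambda>p. p \<noteq> 0 \<and> at_param \<theta> p = 0"
  \<comment> \<open>A minimal polynomial of \<open>\<theta>\<close>, not made monic because its
    coefficients lie in a ring. By minimality and characteristic 0 its derivative is non-zero at
    \<open>\<theta>\<close>, and differentiating \<open>m(\<theta>) = 0\<close> dictates
    \<open>c\<close>.\<close>
  obtain m where m: "m \<noteq> 0" "at_param \<theta> m = 0" and min: "\<And>q. ?P q \<Longrightarrow> degree m \<le> degree q"
    using ex_has_least_nat[of ?P p degree] p by blast
  have "degree m \<noteq> 0"
  proof
    assume "degree m = 0"
    then obtain b where "m = [:b:]" by (rule degree_eq_zeroE)
    then show False using m by (simp add: at_param_pCons at_param_0)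
  qed
  then have "pderiv m \<noteq> 0" "degree (pderiv m) < degree m"
    by (simp_all add: pderiv_eq_0_iff degree_pderiv)
  then have m': "at_param \<theta> (pderiv m) \<noteq> 0" using min[of "pderiv m"] by auto
  define c where "c = - at_param \<theta> (map_poly (partial_deriv j) m) / at_param \<theta> (pderiv m)"
  define \<delta> where "\<delta> g = at_param \<theta> (map_poly (partial_deriv j) g) + c * at_param \<theta> (pderiv g)" for g
  have \<delta>_mult: "\<delta> (g * h) = \<delta> g * at_param \<theta> h + at_param \<theta> g * \<delta> h" for g h
    by (simp add: \<delta>_def map_poly_partial_deriv_mult pderiv_mult ev.hom_add ev.hom_mult algebra_simps)
  have \<delta>_m: "\<delta> m = 0" using m' by (simp add: \<delta>_def c_def)
  have "\<delta> g = 0" if g: "at_param \<theta> g = 0" for g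
  proof -
    \<comment> \<open>Every relation of \<open>\<theta>\<close> is, up to a non-zero factor
      \<open>b\<close> from the coordinate ring, a multiple of \<open>m\<close>; pseudo-division
      avoids fractions.\<close>
    obtain q r where qr: "pseudo_divmod g m = (q, r)" by fastforce
    define b where "b = lead_coeff m ^ (Suc (degree g) - degree m)"
    have eq: "[:b:] * g = m * q + r" and r: "r = 0 \<or> degree r < degree m"
      using pseudo_divmod[OF m(1) qr] by (simp_all add: b_def)
    have "at_param \<theta> r = at_param \<theta> ([:b:] * g - m * q)" by (simp only: eq add_diff_cancel_left')
    also have "\<dots> = 0" by (simp only: ev.hom_minus ev.hom_mult g m) simp
    finally have "r = 0" using min[of r] r by (metis not_less)
    then have "[:b:] * g = m * q" using eq by (simp only: add_0_right)
    then have "\<delta> ([:b:] * g) = \<delta> (m * q)" by (simp only:)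
    also have "\<dots> = 0" by (simp add: \<delta>_mult \<delta>_m m)
    finally have "to_closure b * \<delta> g = 0" by (simp add: \<delta>_mult g at_param_pCons at_param_0 del:
      mult_pCons_left)
    moreover have "b \<noteq> 0" using m(1) by (simp add: b_def)
    ultimately show ?thesis by simp
  qed
  then show ?thesis using that unfolding \<delta>_def by blast
qed

lemma sum_linear_polys: "(\<Sum>i\<in>A. [:x i, y i:]) = [:\<Sum>i\<in>A. x i, \<Sum>i\<in>A. y i:]"
  by (induction A rule: infinite_finite_induct) simp_all

section \<open>Points of the discriminant on the generic line\<close>

context square_box
begin

lemma \<Delta>_dim [simp]: "dim_row \<Delta> = N" "dim_col \<Delta> = N"
  using carrier_matD[OF \<Delta>_carrier] .

lemma line_subst_\<Delta>:
  assumes "k < N" "l < N"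
  shows "line_subst v (\<Delta> $$ (k, l)) = [:\<Delta> $$ (k, l), poly_const (at_point v (\<Delta> $$ (k, l))):]"
proof -
  have "line_subst v (\<Delta> $$ (k, l)) = act a (base (\<lambda>x. [:poly_const x:]) k)
      (\<lambda>c. [:poly_var (coord_ix c), poly_const (v (coord_ix c)):]) (e l)"
    by (simp add: \<Delta>_entry[OF assms] act_hom[OF line_subst_hom] base_def[abs_def])
  also have "\<dots> = [:act a (base poly_const k) (\<lambda>c. poly_var (coord_ix c)) (e l),
      act a (base poly_const k) (\<lambda>c. poly_const (v (coord_ix c))) (e l):]"
  proof -
    have "(\<Sum>i\<in>A. [:x i:] * [:y i, z i:]) = [:\<Sum>i\<in>A. x i * y i, \<Sum>i\<in>A. x i * z i:]"
      "(\<Sum>i\<in>A. [:y i, z i:] * [:x i:]) = [:\<Sum>i\<in>A. y i * x i, \<Sum>i\<in>A. z i * x i:]"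
      for A :: "nat set" and x y z :: "nat \<Rightarrow> cpoly"
      by (induction A rule: infinite_finite_induct) (simp_all add: mult.commute)
    then show ?thesis by (cases "e l") (auto simp: act_def base_def split: prod.splits)
  qed
  also have "act a (base poly_const k) (\<lambda>c. poly_const (v (coord_ix c))) (e l)
      = poly_const (at_point v (\<Delta> $$ (k, l)))"
    by (simp add: \<Delta>_entry[OF assms] act_hom[OF at_point_hom] act_hom[OF poly_const_hom]
      base_def[abs_def])
  finally show ?thesis by (simp add: \<Delta>_entry[OF assms])
qed

lemma line_subst_discriminant:
  "line_subst v f = det (mat N N (\<lambda>(k, l). [:\<Delta> $$ (k, l), poly_const (at_point v (\<Delta> $$ (k, l))):]))"
proof -
  interpret s: comm_ring_hom "line_subst v" by (rule line_subst_hom)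
  have "map_mat (line_subst v) \<Delta> = mat N N (\<lambda>(k, l). [:\<Delta> $$ (k, l), poly_const (at_point v (\<Delta> $$
    (k, l))):])"
    by (intro eq_matI) (auto simp: line_subst_\<Delta>)
  then show ?thesis unfolding discriminant_det s.hom_det[symmetric] by simp
qed

text \<open>The entries of \<open>\<Delta>\<close> are linear forms, so on the line the matrix is
  \<open>\<Delta>(x) + t \<Delta>(v)\<close> and the coefficient of \<open>t^N\<close> is the
  constant \<open>det \<Delta>(v)\<close>.\<close>

lemma degree_line_subst_discriminant:
  assumes "at_point v f \<noteq> 0"
  shows "degree (line_subst v f) = N" "lead_coeff (line_subst v f) = poly_const (at_point v f)"
proof -
  have "coeff (line_subst v f) N = det (mat N N (\<lambda>(k, l). poly_const (at_point v (\<Delta> $$ (k, l)))))"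
    unfolding line_subst_discriminant by (rule det_linear_polys(2))
  also have "mat N N (\<lambda>(k, l). poly_const (at_point v (\<Delta> $$ (k, l))))
    = map_mat (\<lambda>p. poly_const (at_point v p)) \<Delta>"
    by (intro eq_matI) auto
  also have "det \<dots> = poly_const (at_point v f)"
    unfolding discriminant_det
    by (rule comm_ring_hom.hom_det[OF comm_ring_hom_comp[OF poly_const_hom at_point_hom]])
  finally have c: "coeff (line_subst v f) N = poly_const (at_point v f)" .
  moreover have "degree (line_subst v f) \<le> N"
    unfolding line_subst_discriminant by (rule det_linear_polys(1))
  ultimately show "degree (line_subst v f) = N"
    using assms by (metis le_antisym le_degree poly_const_eq_0_iff)
  with c show "lead_coeff (line_subst v f) = poly_const (at_point v f)" by simp
qed

text \<open>At a root \<open>\<theta>\<close> the point \<open>y = x + \<theta> v\<close> is generic on a component of the discriminant: the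
  derivations extended from \<open>\<partial>/\<partial>x\<^sub>j\<close> show that its orbit together with \<open>v\<close> spans all
  directions.  If the root were multiple, then every endomorphism of \<open>y\<close> would move \<open>v\<close> into the
  tangent space of the orbit, hence \<open>v\<close> would lie in it and the orbit would be open.\<close>

theorem simple_roots:
  assumes v: "at_point v f \<noteq> 0" and root: "at_param \<theta> (line_subst v f) = 0"
  shows "at_param \<theta> (pderiv (line_subst v f)) \<noteq> 0"
proof
  assume root': "at_param \<theta> (pderiv (line_subst v f)) = 0"
  interpret ev: comm_ring_hom "at_param \<theta>" by (rule at_param_hom)
  interpret \<iota>: comm_ring_hom to_closure by (rule to_closure_hom)
  define \<phi> where "\<phi> p = at_param \<theta> (line_subst v p)" for p
  have \<phi>: "comm_ring_hom \<phi>" unfolding \<phi>_def by (rule comm_ring_hom_comp[OF at_param_hom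
    line_subst_hom])
  interpret \<phi>: comm_ring_hom \<phi> by (rule \<phi>)
  let ?y = "\<lambda>c. \<phi> (poly_var (coord_ix c))"
  define w where "w l = to_closure (poly_const (v l))" for l
  have P: "line_subst v f \<noteq> 0" using degree_line_subst_discriminant(2)[OF v] v by auto
  \<comment> \<open>The extension of the \<open>j\<close>-th partial derivative sends
    \<open>x + \<theta> v\<close> to the \<open>j\<close>-th unit vector plus \<open>c v\<close>,
    where \<open>c\<close> is the derivative of \<open>\<theta>\<close>.\<close>
  have "\<exists>c \<eta>. \<forall>l<N. (if l = j then 1 else 0) + c * w l = act a \<eta> ?y (e l)" for j
  proof -
    obtain c where c: "\<And>g. at_param \<theta> g = 0 \<Longrightarrow>
        at_param \<theta> (map_poly (partial_deriv j) g) + c * at_param \<theta> (pderiv g) = 0"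
      using extended_partial_deriv[OF P root, of j] by blast
    define \<delta> where "\<delta> g = at_param \<theta> (map_poly (partial_deriv j) g) + c * at_param \<theta> (pderiv g)" for g
    have "\<exists>\<eta>. \<forall>b\<in>rep_coords Q a. \<delta> (line_subst v (poly_var (coord_ix b)))
        = act a \<eta> (\<lambda>b. at_param \<theta> (line_subst v (poly_var (coord_ix b)))) b"
    proof (rule derivation_tangent_to_orbit[of "at_param \<theta>" \<delta> "\<lambda>b. line_subst v (poly_var
      (coord_ix b))"])
      show "additive (at_param \<theta>)" unfolding additive_def ev.hom_add by blast
      show "additive \<delta>"
        unfolding additive_def \<delta>_def map_poly_partial_deriv_add pderiv_add ev.hom_add
          by (simp add: algebra_simps)
      show "at_param \<theta> (p * q) = at_param \<theta> p * at_param \<theta> q" "at_param \<theta> 1 = 1" for p q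
        by (rule ev.hom_mult ev.hom_one)+
      show "\<delta> (p * q) = \<delta> p * at_param \<theta> q + at_param \<theta> p * \<delta> q" for p q
        unfolding \<delta>_def map_poly_partial_deriv_mult pderiv_mult ev.hom_add ev.hom_mult
          by (simp add: algebra_simps)
      show "\<delta> p = 0" if "at_param \<theta> p = 0" for p
        unfolding \<delta>_def by (rule c[OF that])
    qed
    then obtain \<eta> where \<eta>: "\<And>l. l < N \<Longrightarrow> \<delta> (line_subst v (poly_var l)) = act a \<eta> ?y (e l)"
      unfolding ball_coords_iff \<phi>_def by (metis coord_ix)
    have "\<delta> (line_subst v (poly_var l)) = (if l = j then 1 else 0) + c * w l" for l
      by (auto simp: \<delta>_def map_poly_partial_deriv_linear at_param_pCons at_param_0 pderiv_pCons w_def)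
    then show ?thesis using \<eta> by (intro exI[of _ c] exI[of _ \<eta>]) simp
  qed
  then obtain c \<eta> where c\<eta>: "\<And>j l. l < N \<Longrightarrow> (if l = j then 1 else 0) + c j * w l
    = act a (\<eta> j) ?y (e l)" by metis
  \<comment> \<open>A functional vanishing on the tangent space is determined by its value on
    \<open>v\<close>: the tangent space and \<open>v\<close> span everything.\<close>
  have killed: "z j = - c j * (\<Sum>l<N. w l * z l)"
    if z: "\<And>k. k < N \<Longrightarrow> (\<Sum>l<N. \<phi> (\<Delta> $$ (k, l)) * z l) = 0" and j: "j < N" for z j
  proof -
    have "(\<Sum>l<N. ((if l = j then 1 else 0) + c j * w l) * z l) = 0"
      by (rule functional_vanishes_on_orbit[OF \<phi> z c\<eta>])
    moreover have "(\<Sum>l<N. ((if l = j then 1 else 0) + c j * w l) * z l)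
        = (\<Sum>l<N. if l = j then z j else 0) + c j * (\<Sum>l<N. w l * z l)"
      unfolding sum_distrib_left sum.distrib[symmetric] by (intro sum.cong) (auto simp: algebra_simps)
    ultimately show ?thesis using j by (simp add: eq_neg_iff_add_eq_0)
  qed
  have expand: "act a (\<lambda>b i l. \<Sum>j<N. u j * \<eta> j b i l) ?y (e l) = u l + (\<Sum>j<N. u j * c j) * w l"
    if "l < N" for u l
  proof -
    have "act a (\<lambda>b i l. \<Sum>j<N. u j * \<eta> j b i l) ?y (e l)
        = (\<Sum>j<N. (if l = j then u j else 0) + u j * c j * w l)"
      unfolding act_sum act_scale c\<eta>[OF that, symmetric]
        by (intro sum.cong) (auto simp: algebra_simps)
    then show ?thesis using that by (simp add: sum.distrib sum_distrib_right)
  qed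
  define W where "W k l = to_closure (poly_const (at_point v (\<Delta> $$ (k, l))))" for k l
  have \<phi>\<Delta>: "\<phi> (\<Delta> $$ (k, l)) = to_closure (\<Delta> $$ (k, l)) + \<theta> * W k l" if "k < N" "l < N" for k l
    using that by (simp add: \<phi>_def line_subst_\<Delta> at_param_pCons at_param_0 W_def)
  have W_act: "W k l = act a (base (\<lambda>x. \<phi> (poly_const x)) k) (\<lambda>c. w (coord_ix c)) (e l)"
    if "k < N" "l < N" for k l
    using that by (simp add: W_def w_def \<Delta>_entry act_hom[OF at_point_hom] act_hom[OF poly_const_hom]
        act_hom[OF to_closure_hom] base_def[abs_def] \<phi>_def at_param_pCons at_param_0)
  define D where "D = mat N N (\<lambda>(k, l). [:to_closure (\<Delta> $$ (k, l)), W k l:])"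
  have D: "D \<in> carrier_mat N N" by (simp add: D_def)
  have detD: "map_poly to_closure (line_subst v f) = det D"
  proof -
    interpret m: map_poly_comm_ring_hom to_closure ..
    have "map_mat (map_poly to_closure) (mat N N (\<lambda>(k, l). [:\<Delta> $$ (k, l), poly_const (at_point v
      (\<Delta> $$ (k, l))):])) = D"
      by (intro eq_matI) (auto simp: D_def W_def \<iota>.map_poly_pCons_hom)
    then show ?thesis unfolding line_subst_discriminant m.hom_det[symmetric] by simp
  qed
  \<comment> \<open>The relations \<open>b\<close> between the rows at \<open>y\<close> are the
    endomorphisms of \<open>y\<close>, and the combination of the rows \<open>W k\<close>, which are
    those of \<open>\<Delta>(v)\<close>, is the endomorphism applied to \<open>v\<close>.\<close>
  have tangent: "\<exists>\<zeta>. \<forall>l<N. (\<Sum>k<N. b k * W k l) = act a \<zeta> ?y (e l)"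
    if b: "\<And>l. l < N \<Longrightarrow> (\<Sum>k<N. b k * \<phi> (\<Delta> $$ (k, l))) = 0" for b
  proof (cases "\<exists>i<N. b i \<noteq> 0")
    case False
    then show ?thesis by (intro exI[of _ "\<lambda>_ _ _. 0"]) (auto simp: act_def split: prod.splits)
  next
    case True
    then obtain i where i: "i < N" "b i \<noteq> 0" by blast
    define u where "u l = (\<Sum>k<N. b k * W k l)" for l
    have row: "(\<Sum>k<N. [:b k:] * D $$ (k, l)) = [:- \<theta>, 1:] * [:u l:]" if "l < N" for l
    proof -
      have "(\<Sum>k<N. [:b k:] * D $$ (k, l)) = (\<Sum>k<N. [:b k * to_closure (\<Delta> $$ (k, l)), b k * W k l:])"
        using that by (intro sum.cong) (auto simp: D_def)
      also have "\<dots> = [:\<Sum>k<N. b k * to_closure (\<Delta> $$ (k, l)), u l:]"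
        unfolding u_def by (rule sum_linear_polys)
      also have "(\<Sum>k<N. b k * to_closure (\<Delta> $$ (k, l))) = (\<Sum>k<N. b k * \<phi> (\<Delta> $$ (k, l))) - \<theta> * u l"
        using that by (simp add: \<phi>\<Delta> u_def sum_distrib_left algebra_simps sum.distrib)
      finally show ?thesis by (simp add: b[OF that])
    qed
    \<comment> \<open>The combination of rows vanishes at \<open>t = \<theta>\<close>, so it is
      \<open>t - \<theta>\<close> times the constant row \<open>u\<close>. Putting it into row
      \<open>i\<close> splits off this factor, and a double root of \<open>det D\<close> then makes
      the matrix with row \<open>u\<close> singular at \<open>\<theta>\<close>.\<close>
    have "[:b i:] * det D = det (replace_row D i (\<lambda>l. \<Sum>k<N. [:b k:] * D $$ (k, l)))"
      by (rule det_replace_row_combination[OF D i(1), symmetric])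
    also have "\<dots> = (\<Sum>l<N. [:- \<theta>, 1:] * [:u l:] * cofactor D i l)"
      unfolding det_replace_row[OF D i(1)] by (intro sum.cong refl) (simp only: row lessThan_iff)
    also have "\<dots> = [:- \<theta>, 1:] * det (replace_row D i (\<lambda>l. [:u l:]))"
      unfolding det_replace_row[OF D i(1)] sum_distrib_left by (simp only: mult.assoc)
    finally have eq: "[:b i:] * det D = [:- \<theta>, 1:] * det (replace_row D i (\<lambda>l. [:u l:]))" .
    have "pderiv ([:b i:] * p) = [:b i:] * pderiv p" "pderiv ([:- \<theta>, 1:] * p)
      = p + [:- \<theta>, 1:] * pderiv p"
      for p :: "cpoly fract alg_closure poly"
      by (simp add: pderiv_smult) (simp add: pderiv_mult pderiv_pCons del: mult_pCons_left)
    with arg_cong[OF eq, of "\<lambda>p. poly (pderiv p) \<theta>"]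
    have "b i * poly (pderiv (det D)) \<theta> = poly (det (replace_row D i (\<lambda>l. [:u l:]))) \<theta>"
      by simp
    moreover have "poly (pderiv (det D)) \<theta> = 0"
    proof -
      interpret h: idom_hom to_closure unfolding idom_hom_def by (rule to_closure_hom)
      show ?thesis using root' by (simp add: at_param_def h.map_poly_pderiv detD)
    qed
    ultimately have "poly (det (replace_row D i (\<lambda>l. [:u l:]))) \<theta> = 0" by simp
    then obtain z j where z: "j < N" "z j \<noteq> 0"
      "\<And>k. k < N \<Longrightarrow> (\<Sum>l<N. poly (replace_row D i (\<lambda>l. [:u l:]) $$ (k, l)) \<theta> * z l) = 0"
      using common_zero_if_hom_det_0[OF comm_ring_hom_poly replace_row_carrier[OF D]] by blast
    have zi: "(\<Sum>l<N. u l * z l) = 0"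
      using z(3)[OF i(1)] i(1) D by (simp add: replace_row_def)
    have zk: "(\<Sum>l<N. \<phi> (\<Delta> $$ (k, l)) * z l) = 0" if k: "k < N" "k \<noteq> i" for k
      using z(3)[OF k(1)] k D by (simp add: replace_row_def D_def \<phi>\<Delta>)
    have z_all: "(\<Sum>l<N. \<phi> (\<Delta> $$ (k, l)) * z l) = 0" if "k < N" for k
    proof (cases "k = i")
      case True
      have "0 = (\<Sum>l<N. (\<Sum>k<N. b k * \<phi> (\<Delta> $$ (k, l))) * z l)" by (simp add: b)
      also have "\<dots> = (\<Sum>l<N. \<Sum>k<N. b k * (\<phi> (\<Delta> $$ (k, l)) * z l))"
        by (simp add: sum_distrib_right mult.assoc)
      also have "\<dots> = (\<Sum>k<N. b k * (\<Sum>l<N. \<phi> (\<Delta> $$ (k, l)) * z l))"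
        by (subst sum.swap) (simp add: sum_distrib_left)
      also have "\<dots> = b i * (\<Sum>l<N. \<phi> (\<Delta> $$ (i, l)) * z l)"
        using i(1) zk by (subst sum.remove[of _ i]) auto
      finally show ?thesis using i(2) True by simp
    qed (use zk that in blast)
    \<comment> \<open>Some multiple of \<open>v\<close> added to \<open>u\<close> is tangent, by
      \<open>expand\<close>. Since \<open>z\<close> kills the tangent space and \<open>u\<close> but
      not \<open>v\<close>, that multiple is 0 and \<open>u\<close> itself is tangent.\<close>
    have wz: "(\<Sum>l<N. w l * z l) \<noteq> 0"
      using killed[OF z_all z(1)] z(2) by auto
    have "(\<Sum>l<N. (u l + (\<Sum>j<N. u j * c j) * w l) * z l) = 0"
      by (rule functional_vanishes_on_orbit[OF \<phi> z_all expand[symmetric]])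
    moreover have "(\<Sum>l<N. (u l + (\<Sum>j<N. u j * c j) * w l) * z l)
        = (\<Sum>l<N. u l * z l) + (\<Sum>j<N. u j * c j) * (\<Sum>l<N. w l * z l)"
      unfolding sum_distrib_left[of "\<Sum>j<N. u j * c j"] sum.distrib[symmetric]
      by (intro sum.cong) (auto simp: algebra_simps)
    ultimately have "(\<Sum>j<N. u j * c j) = 0" using wz zi by simp
    then have "u l = act a (\<lambda>b i l. \<Sum>j<N. u j * \<eta> j b i l) ?y (e l)" if "l < N" for l
      using expand[OF that, of u] by simp
    then show ?thesis unfolding u_def by blast
  qed
  have "\<exists>\<zeta>. \<forall>b\<in>rep_coords Q a. w (coord_ix b) = act a \<zeta> ?y b"
  proof (rule infinitesimally_central_imp_trivial)
    fix \<xi> assume \<xi>: "\<forall>c\<in>rep_coords Q a. act a \<xi> ?y c = 0"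
    have h: "comm_ring_hom (\<lambda>x. \<phi> (poly_const x))" by (rule comm_ring_hom_comp[OF \<phi> poly_const_hom])
    obtain b where b: "\<forall>x. \<forall>c\<in>rep_coords Q a. act a \<xi> x c = (\<Sum>k<N. b k * act a (base (\<lambda>x. \<phi>
      (poly_const x)) k) x c)"
      using act_spanned[OF h] by blast
    have "(\<Sum>k<N. b k * \<phi> (\<Delta> $$ (k, l))) = 0" if l: "l < N" for l
    proof -
      have "(\<Sum>k<N. b k * \<phi> (\<Delta> $$ (k, l))) = (\<Sum>k<N. b k * act a (base (\<lambda>x. \<phi> (poly_const x)) k) ?y
        (e l))"
        using l by (intro sum.cong) (auto simp: \<Delta>_entry act_hom[OF \<phi>] base_def[abs_def])
      also have "\<dots> = act a \<xi> ?y (e l)" using b l by simp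
      finally show ?thesis using \<xi> l by simp
    qed
    from tangent[OF this] obtain \<zeta> where \<zeta>: "\<And>l. l < N \<Longrightarrow> (\<Sum>k<N. b k * W k l) = act a \<zeta> ?y (e l)"
      by blast
    have "act a \<xi> (\<lambda>c. w (coord_ix c)) (e l) = act a \<zeta> ?y (e l)" if "l < N" for l
      unfolding \<zeta>[OF that, symmetric] using b that by (simp add: W_act)
    then show "\<exists>\<eta>. \<forall>c\<in>rep_coords Q a. act a \<xi> (\<lambda>c. w (coord_ix c)) c = act a \<eta> ?y c"
      unfolding ball_coords_iff by blast
  qed
  then obtain \<zeta> where \<zeta>: "\<And>l. l < N \<Longrightarrow> w l = act a \<zeta> ?y (e l)"
    unfolding ball_coords_iff by (metis coord_ix)
  \<comment> \<open>With \<open>v\<close> tangent, a functional killing the tangent space kills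
    \<open>v\<close> and is therefore 0 by \<open>killed\<close>; but the root
    \<open>\<theta>\<close> provides a non-zero one.\<close>
  have "\<phi> (det \<Delta>) = 0" using root by (simp add: \<phi>_def discriminant_det)
  then obtain z j where z: "j < N" "z j \<noteq> 0" "\<And>k. k < N \<Longrightarrow> (\<Sum>l<N. \<phi> (\<Delta> $$ (k, l)) * z l) = 0"
    using common_zero_if_hom_det_0[OF \<phi> \<Delta>_carrier] by blast
  have "(\<Sum>l<N. w l * z l) = 0" by (rule functional_vanishes_on_orbit[OF \<phi> z(3) \<zeta>])
  then show False using killed[OF z(3,1)] z(2) by simp
qed

end

section \<open>Logarithmic vector fields\<close>

lemma apply_field_derivation:
  "apply_field n \<chi> (p + q) = apply_field n \<chi> p + apply_field n \<chi> q"
  "apply_field n \<chi> (p * q) = apply_field n \<chi> p * q + p * apply_field n \<chi> q"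
  by (simp_all add: apply_field_def partial_deriv_add partial_deriv_mult algebra_simps sum.distrib
      sum_distrib_left sum_distrib_right)

lemma apply_field_var: "i < n \<Longrightarrow> apply_field n \<chi> (poly_var i) = \<chi> i"
  by (simp add: apply_field_def if_distrib[of "\<lambda>x. _ * x"] cong: if_cong)

lemma apply_field_const: "apply_field n \<chi> (poly_const c) = 0"
  by (simp add: apply_field_def)

text \<open>Setting the variables from \<open>n\<close> on to zero changes neither \<open>p\<close> nor \<open>p q\<close>, hence not \<open>q\<close>.\<close>

lemma poly_ring_cancel:
  assumes "p \<in> poly_ring n" "p * q \<in> poly_ring n" "p \<noteq> 0"
  shows "q \<in> poly_ring n"
proof -
  define \<pi> where "\<pi> = evaluate poly_const (\<lambda>i. if i < n then poly_var i else 0)"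
  have hom: "comm_ring_hom \<pi>" unfolding \<pi>_def by (rule evaluate_hom[OF poly_const_hom])
  interpret \<pi>: comm_ring_hom \<pi> by (rule hom)
  have \<pi>_gen: "\<pi> (poly_const c) = poly_const c" "\<pi> (poly_var i)
    = (if i < n then poly_var i else 0)" for c i
    by (simp_all add: \<pi>_def evaluate_const[OF poly_const_hom] evaluate_var[OF poly_const_hom])
  have id: "\<pi> g = g" if "g \<in> poly_ring n" for g
    using hom_eq_on_poly_ring[OF hom comm_ring_hom_id that] \<pi>_gen by simp
  have range: "\<pi> g \<in> poly_ring n" for g
  proof -
    obtain m where "g \<in> poly_ring m" using in_some_poly_ring by blast
    then show ?thesis by (induction rule: poly_ring_induct) (auto simp: \<pi>_gen \<pi>.hom_add \<pi>.hom_mult)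
  qed
  have "p * \<pi> q = p * q"
    using id[OF assms(2)] id[OF assms(1)] by (simp add: \<pi>.hom_mult)
  then have "\<pi> q = q" using assms(3) by simp
  then show ?thesis using range by metis
qed

text \<open>Terms with one matrix on each side of \<open>y\<close> cancel, leaving commutators at
  head and tail. This computes the derivative of a row of \<open>\<Delta>\<close> along another
  action field.\<close>

lemma act_commutator:
  assumes c: "c \<in> rep_coords Q a"
  shows "act a \<xi> (act a \<eta> y) c = act a \<eta> (act a \<xi> y) c
    + act a (\<lambda>v i j. (\<Sum>k<a v. \<xi> v i k * \<eta> v k j) - (\<Sum>k<a v. \<eta> v i k * \<xi> v k j)) y c"
proof -
  obtain t h i j where c': "c = ((t, h), i, j)" by (metis prod.exhaust)
  have expand: "act a \<xi> (act a \<eta> y) c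
      = (\<Sum>k<a h. \<Sum>l<a h. \<xi> h i k * \<eta> h k l * y ((t, h), l, j))
      - (\<Sum>k<a h. \<Sum>l<a t. \<xi> h i k * y ((t, h), k, l) * \<eta> t l j)
      - (\<Sum>k<a t. \<Sum>l<a h. \<eta> h i l * y ((t, h), l, k) * \<xi> t k j)
      + (\<Sum>k<a t. \<Sum>l<a t. y ((t, h), i, l) * \<eta> t l k * \<xi> t k j)" for \<xi> \<eta>
    by (simp add: act_def c' right_diff_distrib left_diff_distrib sum_subtractf sum_distrib_left
        sum_distrib_right mult.assoc)
  have comm: "act a (\<lambda>v i j. (\<Sum>k<a v. \<xi> v i k * \<eta> v k j) - (\<Sum>k<a v. \<eta> v i k * \<xi> v k j)) y c
      = ((\<Sum>k<a h. \<Sum>l<a h. \<xi> h i k * \<eta> h k l * y ((t, h), l, j))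
        - (\<Sum>k<a h. \<Sum>l<a h. \<eta> h i k * \<xi> h k l * y ((t, h), l, j)))
      - ((\<Sum>k<a t. \<Sum>l<a t. y ((t, h), i, l) * \<xi> t l k * \<eta> t k j)
        - (\<Sum>k<a t. \<Sum>l<a t. y ((t, h), i, l) * \<eta> t l k * \<xi> t k j))"
  proof -
    have 1: "(\<Sum>l<a h. (\<Sum>k<a h. p h i k * q h k l) * y ((t, h), l, j))
        = (\<Sum>k<a h. \<Sum>l<a h. p h i k * q h k l * y ((t, h), l, j))" for p q
      by (subst sum.swap) (simp add: sum_distrib_right)
    have 2: "(\<Sum>l<a t. y ((t, h), i, l) * (\<Sum>k<a t. p t l k * q t k j))
        = (\<Sum>k<a t. \<Sum>l<a t. y ((t, h), i, l) * p t l k * q t k j)" for p q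
      by (subst sum.swap) (simp add: sum_distrib_left mult.assoc)
    show ?thesis
      unfolding 1[symmetric] 2[symmetric]
      by (simp add: act_def c' left_diff_distrib right_diff_distrib sum_subtractf)
  qed
  have swap1: "(\<Sum>k<a h. \<Sum>l<a t. \<xi> h i k * y ((t, h), k, l) * \<eta> t l j)
      = (\<Sum>k<a t. \<Sum>l<a h. \<xi> h i l * y ((t, h), l, k) * \<eta> t k j)" for \<xi> \<eta>
    by (rule sum.swap)
  show ?thesis
    unfolding expand[of \<xi> \<eta>] expand[of \<eta> \<xi>] comm swap1 by (simp add: algebra_simps)
qed

context square_box
begin

definition act_matrix :: "('v \<Rightarrow> nat \<Rightarrow> nat \<Rightarrow> 'r::comm_ring_1) \<Rightarrow> nat \<Rightarrow> nat \<Rightarrow> 'r" where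
  "act_matrix \<xi> i j = act a \<xi> (\<lambda>c. if c = e i then 1 else 0) (e j)"

lemma act_eq_act_matrix:
  assumes "j < N"
  shows "act a \<xi> y (e j) = (\<Sum>i<N. y (e i) * act_matrix \<xi> i j)"
proof -
  have yc: "y c = (\<Sum>i<N. y (e i) * (if c = e i then 1 else 0))" if "c \<in> rep_coords Q a" for c
  proof -
    have c: "e (coord_ix c) = c" "coord_ix c < N" using coord_ix_inverse[OF that] by auto
    have "c = e i \<longleftrightarrow> i = coord_ix c" if "i < N" for i
      using that c coord_ix by metis
    then have "(\<Sum>i<N. y (e i) * (if c = e i then 1 else 0)) = (\<Sum>i<N.
      if i = coord_ix c then y c else 0)"
      using c(1) by (intro sum.cong) auto
    then show ?thesis using c(2) by simp
  qed
  have "act a \<xi> y (e j) = act a \<xi> (\<lambda>c. \<Sum>i<N. y (e i) * (if c = e i then 1 else 0)) (e j)"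
    by (rule act_cong[OF e_coord[OF assms] yc])
  then show ?thesis by (simp add: act_right_sum act_right_scale act_matrix_def)
qed

section \<open>The action fields as a basis of the logarithmic fields\<close>

definition fields :: "vfield list" where
  "fields = map (action_field Q a e) B"

lemma length_fields: "length fields = N"
  by (simp add: fields_def len)

lemma fields_nth: "k < N \<Longrightarrow> l < N \<Longrightarrow> (fields ! k) l = \<Delta> $$ (k, l)"
  by (simp add: fields_def coefficient_matrix_def len)

lemma fields_nth_0: "k < N \<Longrightarrow> N \<le> l \<Longrightarrow> (fields ! k) l = 0"
  by (simp add: fields_def action_field_def len)

lemma \<Delta>_linear:
  assumes "k < N" "l < N"
  shows "\<Delta> $$ (k, l) = (\<Sum>i<N. poly_const (act_matrix (base (\<lambda>x. x) k) i l) * poly_var i)"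
proof -
  have "act_matrix (base poly_const k) i l = poly_const (act_matrix (base (\<lambda>x. x) k) i l)" for i
    by (simp add: act_matrix_def act_hom[OF poly_const_hom] base_def[abs_def] if_distrib[of
      poly_const] cong: if_cong)
  then show ?thesis
    by (simp add: \<Delta>_entry[OF assms] act_eq_act_matrix[OF assms(2)] mult.commute)
qed

lemma \<Delta>_poly_ring: "k < N \<Longrightarrow> l < N \<Longrightarrow> \<Delta> $$ (k, l) \<in> poly_ring N"
  by (simp add: \<Delta>_linear) (intro poly_ring_sum poly_ring_closed; simp)

lemma discriminant_poly_ring: "f \<in> poly_ring N"
  unfolding discriminant_det by (rule poly_ring_det[OF \<Delta>_carrier \<Delta>_poly_ring])

lemma linear_fields: "\<forall>\<delta>\<in>set fields. linear_field N \<delta>"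
proof
  fix \<delta> assume "\<delta> \<in> set fields"
  then obtain k where k: "k < N" "\<delta> = fields ! k" by (metis in_set_conv_nth length_fields)
  have "\<delta> = (\<lambda>i. if i < N then \<Sum>j<N. poly_const (act_matrix (base (\<lambda>x. x) k) j i) * poly_var j
    else 0)"
  proof
    fix i
    show "\<delta> i = (if i < N then \<Sum>j<N. poly_const (act_matrix (base (\<lambda>x. x) k) j i) * poly_var j
      else 0)"
      using k by (cases "i < N") (simp_all add: fields_nth fields_nth_0 \<Delta>_linear)
  qed
  then show "linear_field N \<delta>" unfolding linear_field_def
    by (rule exI[of _ "\<lambda>i j. act_matrix (base (\<lambda>x. x) k) j i"])
qed

text \<open>Along the \<open>k\<close>-th field, row \<open>m\<close> of \<open>\<Delta>\<close>
  changes by the bracket of the two basis elements, a constant combination of rows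
  (\<open>C\<close>), and by the linear action on the coordinates (\<open>act_matrix\<close>). So
  \<open>derivation_det_linear\<close> applies with constant traces.\<close>

lemma action_field_discriminant:
  assumes k: "k < N"
  shows "\<exists>g\<in>poly_ring N. apply_field N (fields ! k) f = f * g"
proof -
  define d where "d = apply_field N (fields ! k)"
  have d: "d (p + q) = d p + d q" "d (p * q) = d p * q + p * d q" for p q
    by (simp_all add: d_def apply_field_derivation)
  have add: "additive d" by (simp add: additive_def d(1))
  interpret d: additive d by (rule add)
  let ?\<xi> = "base poly_const k" and ?x = "\<lambda>c. poly_var (coord_ix c)"
  define br where "br m = (\<lambda>v i j. (\<Sum>l<a v. base (\<lambda>x. x) m v i l * base (\<lambda>x. x) k v l j)
      - (\<Sum>l<a v. base (\<lambda>x. x) k v i l * base (\<lambda>x. x) m v l j))" for m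
  have "\<forall>m. \<exists>C s. \<forall>v\<in>V. \<forall>i<a v. \<forall>j<a v. br m v i j = (\<Sum>l<N. C l * base (\<lambda>x. x) l v i j) + (if i
    = j then s else 0)"
    using gl_spanned[OF comm_ring_hom_id] by blast
  from choice[OF this] obtain C where C: "\<forall>m. \<exists>s. \<forall>v\<in>V. \<forall>i<a v. \<forall>j<a v.
      br m v i j = (\<Sum>l<N. C m l * base (\<lambda>x. x) l v i j) + (if i = j then s else 0)" by (rule exE)
  from choice[OF this] obtain s where Cs: "\<forall>m. \<forall>v\<in>V. \<forall>i<a v. \<forall>j<a v.
      br m v i j = (\<Sum>l<N. C m l * base (\<lambda>x. x) l v i j) + (if i = j then s m else 0)" by (rule exE)
  interpret pc: comm_ring_hom poly_const by (rule poly_const_hom)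
  have lin: "d (\<Delta> $$ (m, j)) = (\<Sum>l<N. poly_const (C m l) * \<Delta> $$ (l, j))
      + (\<Sum>i<N. \<Delta> $$ (m, i) * poly_const (act_matrix (base (\<lambda>x. x) k) i j))" if m: "m < N"
        and j: "j < N" for m j
  proof -
    have am: "act_matrix ?\<xi> i j = poly_const (act_matrix (base (\<lambda>x. x) k) i j)" for i
      by (simp add: act_matrix_def act_hom[OF poly_const_hom] base_def[abs_def] if_distrib[of
        poly_const] cong: if_cong)
    have "d (\<Delta> $$ (m, j)) = act a (base poly_const m) (\<lambda>c. d (?x c)) (e j)"
    proof -
      have "d (poly_const c * p) = poly_const c * d p" "d (p * poly_const c) = d p * poly_const c"
        for c p
        unfolding d(2) by (simp_all add: d_def apply_field_const)
      then show ?thesis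
        unfolding \<Delta>_entry[OF m j] by (cases "e j") (auto simp: act_def d.diff d.sum base_def)
    qed
    also have "\<dots> = act a (base poly_const m) (act a ?\<xi> ?x) (e j)"
    proof (rule act_cong[OF e_coord[OF j]])
      fix c assume "c \<in> rep_coords Q a"
      then have c: "e (coord_ix c) = c" "coord_ix c < N" using coord_ix_inverse by auto
      have "d (?x c) = \<Delta> $$ (k, coord_ix c)"
        using c k by (simp add: d_def apply_field_var fields_nth)
      then show "d (?x c) = act a ?\<xi> ?x c" using c k by (simp add: \<Delta>_entry)
    qed
    also have "\<dots> = act a ?\<xi> (act a (base poly_const m) ?x) (e j) + act a (\<lambda>v i j. poly_const (br m
      v i j)) ?x (e j)"
      unfolding act_commutator[OF e_coord[OF j], of "base poly_const m"]
      by (simp add: br_def base_def pc.hom_sum)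
    also have "act a ?\<xi> (act a (base poly_const m) ?x) (e j) = (\<Sum>i<N. \<Delta> $$ (m, i) * act_matrix ?\<xi>
      i j)"
      unfolding act_eq_act_matrix[OF j] by (intro sum.cong refl) (simp add: \<Delta>_entry[OF m])
    also have "act a (\<lambda>v i j. poly_const (br m v i j)) ?x (e j)
        = act a (\<lambda>v i j. (\<Sum>l<N. poly_const (C m l) * base poly_const l v i j) + (if i
          = j then poly_const (s m) else 0)) ?x (e j)"
      by (rule act_cong_left[OF QV e_coord[OF j]]) (simp add: Cs pc.hom_sum base_def if_distrib[of
        poly_const])
    also have "\<dots> = (\<Sum>l<N. poly_const (C m l) * \<Delta> $$ (l, j))"
      using j by (simp add: act_add act_sum act_scale act_scalar[OF e_coord[OF j]] \<Delta>_entry)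
    finally show ?thesis by (simp add: am add.commute)
  qed
  have "d (det \<Delta>) = det \<Delta> * ((\<Sum>m<N. poly_const (C m m)) + (\<Sum>j<N. poly_const (act_matrix (base (\<lambda>x.
    x) k) j j)))"
    by (rule derivation_det_linear[OF add d(2) \<Delta>_carrier lin])
  then show ?thesis unfolding d_def discriminant_det by (blast intro: poly_ring_sum)
qed

lemma ex_nonvanishing: "\<exists>v. at_point v f \<noteq> 0"
  using eq_0_if_at_point_0 discriminant_nonzero by blast

text \<open>Saito's argument restricted to the line \<open>x + t v\<close>, on which the discriminant has simple
  roots and constant leading coefficient.\<close>

lemma discriminant_dvd_if_gradient:
  assumes "\<And>i. i < N \<Longrightarrow> f dvd g * partial_deriv i f"
  shows "f dvd g"
proof -
  obtain v where v: "at_point v f \<noteq> 0" using ex_nonvanishing by blast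
  define P where "P = line_subst v f"
  interpret s: comm_ring_hom "line_subst v" by (rule line_subst_hom)
  have degP: "degree P = N" "lead_coeff P = poly_const (at_point v f)"
    using degree_line_subst_discriminant[OF v] by (simp_all add: P_def)
  have "P \<noteq> 0" using degP(2) v by auto
  have "f dvd g * (\<Sum>i<N. poly_const (v i) * partial_deriv i f)"
    unfolding sum_distrib_left
    by (intro dvd_sum) (metis assms dvd_mult lessThan_iff mult.left_commute)
  then have "line_subst v f dvd line_subst v (g * (\<Sum>i<N. poly_const (v i) * partial_deriv i f))"
    by (rule s.hom_dvd)
  then have dvd: "P dvd line_subst v g * pderiv P"
    by (simp add: P_def s.hom_mult pderiv_line_subst[OF discriminant_poly_ring])
  \<comment> \<open>The leading coefficient of \<open>P\<close> is a non-zero constant, so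
    pseudo-division costs only the constant \<open>b\<close>. The remainder lies over the coordinate
    ring, and divisibility over the closure forces it to be 0 by its degree.\<close>
  obtain q r where qr: "pseudo_divmod (line_subst v g) P = (q, r)" by fastforce
  define b where "b = at_point v f ^ (Suc (degree (line_subst v g)) - degree P)"
  interpret pc: comm_ring_hom poly_const by (rule poly_const_hom)
  have eq: "smult (poly_const b) (line_subst v g) = P * q + r" and r: "r = 0 \<or> degree r < degree P"
    using pseudo_divmod[OF \<open>P \<noteq> 0\<close> qr] degP(2) by (simp_all add: b_def pc.hom_power)
  have "P dvd r * pderiv P"
  proof -
    have "r = smult (poly_const b) (line_subst v g) - P * q" by (simp only: eq add_diff_cancel_left')
    then have "r * pderiv P = smult (poly_const b) (line_subst v g * pderiv P) - P * (q * pderiv P)"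
      by (simp only: left_diff_distrib mult_smult_left mult.assoc)
    moreover have "P dvd smult (poly_const b) (line_subst v g * pderiv P) - P * (q * pderiv P)"
      by (intro dvd_diff dvd_smult dvd dvd_triv_left)
    ultimately show ?thesis by (simp only:)
  qed
  then obtain u where u: "r * pderiv P = P * u" by (rule dvdE)
  interpret \<iota>: comm_ring_hom to_closure by (rule to_closure_hom)
  let ?m = "map_poly to_closure"
  have "poly (?m r) \<theta> = 0" if "poly (?m P) \<theta> = 0" for \<theta>
  proof -
    interpret ev: comm_ring_hom "at_param \<theta>" by (rule at_param_hom)
    have P0: "at_param \<theta> P = 0" using that by (simp add: at_param_def)
    have "at_param \<theta> r * at_param \<theta> (pderiv P) = 0"
      using arg_cong[OF u, of "at_param \<theta>"] by (simp add: ev.hom_mult P0)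
    then show ?thesis using simple_roots[OF v P0[unfolded P_def]] by (simp add: at_param_def P_def)
  qed
  moreover have deg: "degree (?m p) = degree p" for p
    by (rule degree_map_poly) simp
  moreover have "?m P \<noteq> 0" using \<open>P \<noteq> 0\<close> by (metis \<iota>.hom_zero coeff_map_poly coeff_0
    leading_coeff_0_iff to_closure_eq_0_iff)
  moreover have "poly (pderiv (?m P)) \<theta> \<noteq> 0" if "poly (?m P) \<theta> = 0" for \<theta>
  proof -
    interpret h: idom_hom to_closure unfolding idom_hom_def by (rule to_closure_hom)
    show ?thesis using simple_roots[OF v, of \<theta>] that
      by (simp add: at_param_def P_def h.map_poly_pderiv)
  qed
  ultimately have "?m P dvd ?m r" using dvd_if_simple_roots by blast
  then have "r = 0"
  proof -
    assume "?m P dvd ?m r"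
    show "r = 0"
    proof (rule ccontr)
      assume "r \<noteq> 0"
      then have "?m r \<noteq> 0" by (metis \<iota>.hom_zero coeff_map_poly coeff_0 leading_coeff_0_iff
        to_closure_eq_0_iff)
      from dvd_imp_degree_le[OF \<open>?m P dvd ?m r\<close> this] r \<open>r \<noteq> 0\<close> show False by (simp add: deg)
    qed
  qed
  \<comment> \<open>Setting \<open>t = 0\<close> returns from the line to the coordinate
    ring.\<close>
  then have "poly (smult (poly_const b) (line_subst v g)) 0 = poly (P * q) 0" using eq by simp
  then have "poly_const b * g = f * poly q 0" by (simp add: P_def line_subst_at_0)
  then have "poly_const (1 / b) * (poly_const b * g) = f * (poly_const (1 / b) * poly q 0)"
    by (simp add: mult.left_commute)
  moreover have "poly_const (1 / b) * poly_const b = 1"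
    using v by (simp add: b_def flip: poly_const_simps(4))
  ultimately have "g = f * (poly_const (1 / b) * poly q 0)" by (simp flip: mult.assoc)
  then show ?thesis by (rule dvdI)
qed

text \<open>A repeated factor \<open>x\<close> would give double roots on every line with
  \<open>f v \<noteq> 0\<close> unless it is constant there; then its value at \<open>v\<close> is
  its value at the origin. So \<open>x\<close> minus that value vanishes wherever \<open>f\<close>
  does not, and its product with \<open>f\<close> is 0.\<close>

lemma squarefree_discriminant: "squarefree f"
  unfolding squarefree_def
proof (intro allI impI)
  fix x assume "x\<^sup>2 dvd f"
  then obtain h where "f = x\<^sup>2 * h" by (rule dvdE)
  then have fx: "f = x * (x * h)" by (simp add: power2_eq_square mult.assoc)
  have const: "at_point v x = at_point (\<lambda>_. 0) x" if v: "at_point v f \<noteq> 0" for v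
  proof -
    interpret s: comm_ring_hom "line_subst v" by (rule line_subst_hom)
    let ?m = "map_poly to_closure"
    have P: "line_subst v f = line_subst v x * (line_subst v x * line_subst v h)"
      by (simp add: s.hom_mult fx)
    have "degree (line_subst v x) = 0"
    proof (rule ccontr)
      assume "degree (line_subst v x) \<noteq> 0"
      then have "degree (?m (line_subst v x)) > 0" by (subst degree_map_poly) simp_all
      then obtain \<theta> where "poly (?m (line_subst v x)) \<theta> = 0" using alg_closed_imp_poly_has_root
        by blast
      then have \<theta>: "at_param \<theta> (line_subst v x) = 0" by (simp add: at_param_def)
      interpret ev: comm_ring_hom "at_param \<theta>" by (rule at_param_hom)
      have "at_param \<theta> (line_subst v f) = 0" "at_param \<theta> (pderiv (line_subst v f)) = 0"
        unfolding P pderiv_mult ev.hom_add ev.hom_mult \<theta> by simp_all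
      with simple_roots[OF v] show False by blast
    qed
    then obtain c where "line_subst v x = [:c:]" by (rule degree_eq_zeroE)
    then have eq: "line_subst v x = [:x:]" using line_subst_at_0[of v x] by simp
    obtain M where M: "x \<in> poly_ring M" using in_some_poly_ring by blast
    interpret z: comm_ring_hom "at_point (\<lambda>_. 0)" by (rule at_point_hom)
    interpret m: map_poly_comm_ring_hom "at_point (\<lambda>_. 0)" ..
    have "poly (map_poly (at_point (\<lambda>_. 0)) (line_subst v x)) 1 = at_point v x"
      by (rule hom_eq_on_poly_ring[OF comm_ring_hom_comp[OF comm_ring_hom_poly
        comm_ring_hom_comp[OF m.comm_ring_hom_axioms line_subst_hom]]
            at_point_hom M]) (simp_all add: z.map_poly_pCons_hom)
    then show ?thesis by (simp add: eq z.map_poly_pCons_hom)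
  qed
  define c where "c = at_point (\<lambda>_. 0) x"
  have "(x - poly_const c) * f = 0"
  proof (rule eq_0_if_at_point_0)
    fix v
    interpret p: comm_ring_hom "at_point v" by (rule at_point_hom)
    show "at_point v ((x - poly_const c) * f) = 0"
      using const[of v] by (cases "at_point v f = 0") (simp_all add: p.hom_mult p.hom_minus c_def)
  qed
  then have x: "x = poly_const c" using discriminant_nonzero by simp
  then have "c \<noteq> 0" using fx discriminant_nonzero by auto
  then have "1 = x * poly_const (1 / c)" by (simp add: x flip: poly_const_simps(4))
  then show "x dvd 1" by (rule dvdI)
qed

lemma fields_log: "set fields \<subseteq> log_fields N (divisor_ideal N f)"
proof
  fix \<delta> assume "\<delta> \<in> set fields"
  then obtain k where k: "k < N" "\<delta> = fields ! k" by (metis in_set_conv_nth length_fields)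
  obtain g where g: "g \<in> poly_ring N" "apply_field N \<delta> f = f * g"
    using action_field_discriminant[OF k(1)] k by blast
  have vf: "\<delta> \<in> vector_fields N"
    using k by (simp add: vector_fields_def fields_nth fields_nth_0 \<Delta>_poly_ring)
  have "apply_field N \<delta> (f * h) \<in> divisor_ideal N f" if h: "h \<in> poly_ring N" for h
  proof -
    have "apply_field N \<delta> h \<in> poly_ring N"
      unfolding apply_field_def using vf h
      by (intro poly_ring_sum poly_ring_closed partial_deriv_poly_ring) (auto simp: vector_fields_def)
    then have "g * h + apply_field N \<delta> h \<in> poly_ring N" using g h by blast
    moreover have "apply_field N \<delta> (f * h) = f * (g * h + apply_field N \<delta> h)"
      by (simp add: apply_field_derivation g algebra_simps)
    ultimately show ?thesis unfolding divisor_ideal_def by blast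
  qed
  then show "\<delta> \<in> log_fields N (divisor_ideal N f)"
    using vf by (auto simp: log_fields_def divisor_ideal_def)
qed

text \<open>By Cramer's rule the coefficients of \<open>\<chi>\<close> must be
  \<open>det (A k) / f\<close>. All rows of \<open>A k\<close> are logarithmic, so modulo
  \<open>f\<close> the matrix \<open>A k\<close> kills the gradient of \<open>f\<close>. Multiplying
  by the adjugate shows that \<open>f\<close> divides \<open>det (A k)\<close> times each partial
  derivative.\<close>

lemma fields_span: "log_fields N (divisor_ideal N f) \<subseteq> field_span N fields"
proof
  fix \<chi> assume \<chi>: "\<chi> \<in> log_fields N (divisor_ideal N f)"
  have vf: "\<And>i. i < N \<Longrightarrow> \<chi> i \<in> poly_ring N" "\<And>i. N \<le> i \<Longrightarrow> \<chi> i = 0"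
    using \<chi> by (auto simp: log_fields_def vector_fields_def)
  have "f * 1 \<in> divisor_ideal N f" unfolding divisor_ideal_def by blast
  then have "apply_field N \<chi> f \<in> divisor_ideal N f" using \<chi> by (simp add: log_fields_def)
  then obtain h where h: "apply_field N \<chi> f = f * h" by (auto simp: divisor_ideal_def)
  define A where "A k = replace_row \<Delta> k \<chi>" for k
  have A: "A k \<in> carrier_mat N N" for k by (simp add: A_def)
  have dvd: "f dvd det (A k)" if k: "k < N" for k
  proof (rule discriminant_dvd_if_gradient)
    fix i assume i: "i < N"
    have row: "f dvd (\<Sum>j<N. A k $$ (l, j) * partial_deriv j f)" if l: "l < N" for l
    proof (cases "l = k")
      case True
      then have "(\<Sum>j<N. A k $$ (l, j) * partial_deriv j f) = apply_field N \<chi> f"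
        using k by (auto simp: A_def replace_row_def apply_field_def intro!: sum.cong)
      then show ?thesis by (simp add: h)
    next
      case False
      then have "(\<Sum>j<N. A k $$ (l, j) * partial_deriv j f) = apply_field N (fields ! l) f"
        using l by (auto simp: A_def replace_row_def apply_field_def fields_nth intro!: sum.cong)
      then show ?thesis using action_field_discriminant[OF l] by auto
    qed
    have "det (A k) * partial_deriv i f
        = (\<Sum>j<N. (\<Sum>l<N. A k $$ (l, j) * cofactor (A k) l i) * partial_deriv j f)"
      using i by (simp add: cofactor_col_sum[OF A] if_distrib[of "\<lambda>x. x * _"] cong: if_cong)
    also have "\<dots> = (\<Sum>j<N. \<Sum>l<N. cofactor (A k) l i * (A k $$ (l, j) * partial_deriv j f))"
      by (simp add: sum_distrib_right sum_distrib_left mult_ac)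
    also have "\<dots> = (\<Sum>l<N. cofactor (A k) l i * (\<Sum>j<N. A k $$ (l, j) * partial_deriv j f))"
      by (subst sum.swap) (simp add: sum_distrib_left)
    also have "f dvd \<dots>" by (intro dvd_sum dvd_mult row) simp
    finally show "f dvd det (A k) * partial_deriv i f" .
  qed
  then have "\<forall>k. \<exists>c. k < N \<longrightarrow> det (A k) = f * c" by (metis dvdE)
  then obtain c where c: "\<And>k. k < N \<Longrightarrow> det (A k) = f * c k" by metis
  have "c k \<in> poly_ring N" if k: "k < N" for k
  proof (rule poly_ring_cancel[OF discriminant_poly_ring _ discriminant_nonzero])
    have "det (A k) \<in> poly_ring N"
      by (rule poly_ring_det[OF A]) (auto simp: A_def replace_row_def vf \<Delta>_poly_ring)
    then show "f * c k \<in> poly_ring N" by (simp add: c[OF k])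
  qed
  moreover have "\<chi> = combination c fields"
  proof
    fix j
    show "\<chi> j = combination c fields j"
    proof (cases "j < N")
      case True
      have "f * \<chi> j = (\<Sum>k<N. det (A k) * \<Delta> $$ (k, j))"
        unfolding A_def discriminant_det by (rule cramer_row[OF \<Delta>_carrier True, symmetric])
      also have "\<dots> = f * (\<Sum>k<N. c k * \<Delta> $$ (k, j))"
        by (simp add: c sum_distrib_left mult.assoc)
      finally have "\<chi> j = (\<Sum>k<N. c k * \<Delta> $$ (k, j))" using discriminant_nonzero by simp
      then show ?thesis using True by (simp add: combination_def length_fields fields_nth)
    next
      case False
      then show ?thesis by (simp add: combination_def length_fields fields_nth_0 vf)
    qed
  qed
  ultimately show "\<chi> \<in> field_span N fields" unfolding field_span_def length_fields by blast
qed

lemma fields_independent: "field_independent N fields"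
  unfolding field_independent_def length_fields
proof (intro allI impI; elim conjE)
  fix c l assume c: "combination c fields = (\<lambda>_. 0)" and l: "l < N"
  have 0: "(\<Sum>k<N. c k * \<Delta> $$ (k, j)) = 0" if "j < N" for j
    using fun_cong[OF c, of j] that by (simp add: combination_def length_fields fields_nth)
  have "0 = (\<Sum>j<N. (\<Sum>k<N. c k * \<Delta> $$ (k, j)) * cofactor \<Delta> l j)" by (simp add: 0)
  also have "\<dots> = det (replace_row \<Delta> l (\<lambda>j. \<Sum>k<N. c k * \<Delta> $$ (k, j)))"
    by (rule det_replace_row[OF \<Delta>_carrier l, symmetric])
  also have "\<dots> = c l * f"
    unfolding discriminant_det by (rule det_replace_row_combination[OF \<Delta>_carrier l])
  finally show "c l = 0" using discriminant_nonzero by simp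
qed

theorem linear_free_divisor_discriminant: "linear_free_divisor N f"
proof -
  have basis: "module_basis N (log_fields N (divisor_ideal N f)) fields"
    by (simp add: module_basis_def fields_log fields_independent fields_span)
  have "locally_free N N (log_fields N (divisor_ideal N f))"
    unfolding locally_free_def
  proof
    fix x
    have "poly_eval 1 x \<noteq> 0" by (simp add: poly_eval_def)
    moreover have "\<exists>n. (\<lambda>i. 1 ^ n * \<chi> i) \<in> field_span N fields"
      if "\<chi> \<in> log_fields N (divisor_ideal N f)" for \<chi>
      using that fields_span by auto
    ultimately show "\<exists>s\<in>poly_ring N. poly_eval s x \<noteq> 0 \<and> (\<exists>\<delta>s. length \<delta>s = N \<and>
        set \<delta>s \<subseteq> log_fields N (divisor_ideal N f) \<and> field_independent N \<delta>s \<and>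
        (\<forall>\<chi>\<in>log_fields N (divisor_ideal N f). \<exists>n. (\<lambda>i. s ^ n * \<chi> i) \<in> field_span N \<delta>s))"
      using fields_log fields_independent length_fields
      by (intro bexI[of _ 1] conjI exI[of _ fields] ballI) auto
  qed
  then show ?thesis
    unfolding linear_free_divisor_def free_divisor_def
    using basis linear_fields squarefree_discriminant discriminant_poly_ring discriminant_nonzero
      by blast
qed

end

section \<open>Roots of RTP-trees\<close>

text \<open>\<open>B\<close> with the identity added is a basis of the full matrix algebra. Index
  \<open>n\<close> of \<open>b\<close> stands for that identity, which is non-zero because
  \<open>a v0 \<ge> 1\<close>. The two inequalities are independence and spanning.\<close>

lemma length_pgl_basis:
  assumes fin: "finite V" and v0: "v0 \<in> V" "1 \<le> a v0" and B: "pgl_basis V a B"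
  shows "Suc (length B) = (\<Sum>v\<in>V. a v * a v)"
proof -
  define n where "n = length B"
  define G where "G = Sigma V (\<lambda>v. {..<a v} \<times> {..<a v})"
  define b where "b k = (\<lambda>(v, i, j). if k < n then (B ! k) v $$ (i, j) else
    if i = j then 1 else 0)" for k
  have finG: "finite G" using fin by (auto simp: G_def)
  have cardG: "card G = (\<Sum>v\<in>V. a v * a v)"
    unfolding G_def using fin by (subst card_SigmaI) (auto simp: card_cartesian_product)
  have comb: "gl_combination a c B v $$ (i, j) = (\<Sum>k<n. b k (v, i, j) * c k)"
    if "i < a v" "j < a v" for c v i j
    using that by (simp add: gl_combination_def b_def n_def mult.commute)
  have "\<not> card G < card {..<Suc n}"
  proof
    assume "card G < card {..<Suc n}"
    from underdetermined_system[OF finG finite_lessThan this, of "\<lambda>g k. b k g"]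
    obtain c where c: "\<exists>k\<in>{..<Suc n}. c k \<noteq> 0" "\<And>g. g \<in> G \<Longrightarrow> (\<Sum>k<Suc n. b k g * c k) = 0" by blast
    have "gl_combination a c B v = 0\<^sub>m (a v) (a v) + (- c n) \<cdot>\<^sub>m 1\<^sub>m (a v)" if v: "v \<in> V" for v
    proof (rule eq_matI)
      fix i j
      assume "i < dim_row (0\<^sub>m (a v) (a v) + (- c n) \<cdot>\<^sub>m 1\<^sub>m (a v) :: complex mat)"
        "j < dim_col (0\<^sub>m (a v) (a v) + (- c n) \<cdot>\<^sub>m 1\<^sub>m (a v) :: complex mat)"
      then have ij: "i < a v" "j < a v" by auto
      then have "(v, i, j) \<in> G" using v by (simp add: G_def)
      from c(2)[OF this] have "(\<Sum>k<n. b k (v, i, j) * c k) = - (b n (v, i, j) * c n)"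
        by (simp add: eq_neg_iff_add_eq_0)
      then show "gl_combination a c B v $$ (i, j) = (0\<^sub>m (a v) (a v) + (- c n) \<cdot>\<^sub>m 1\<^sub>m (a v)) $$
        (i, j)"
        using ij by (simp add: comb) (simp add: b_def)
    qed (simp_all add: gl_combination_def)
    then have "equal_mod_id V a (gl_combination a c B) (\<lambda>v. 0\<^sub>m (a v) (a v))"
      unfolding equal_mod_id_def by blast
    then have ck: "c k = 0" if "k < n" for k
      using B that unfolding pgl_basis_def n_def by blast
    have "(v0, 0, 0) \<in> G" using v0 by (simp add: G_def)
    from c(2)[OF this] have "c n = 0" by (simp add: ck) (simp add: b_def)
    then show False using c(1) ck by (auto simp: less_Suc_eq)
  qed
  moreover have "\<not> card {..<Suc n} < card G"
  proof
    assume "card {..<Suc n} < card G"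
    from underdetermined_system[OF finite_lessThan finG this, of b]
    obtain z where z: "\<exists>g\<in>G. z g \<noteq> 0" "\<And>k. k \<in> {..<Suc n} \<Longrightarrow> (\<Sum>g\<in>G. b k g * z g) = 0" by blast
    have "z g0 = 0" if g0: "g0 \<in> G" for g0
    proof -
      define U where "U = (\<lambda>v. mat (a v) (a v) (\<lambda>(i, j). if g0 = (v, i, j) then 1 else 0 :: complex))"
      have "U \<in> gl_algebra V a" by (simp add: gl_algebra_def U_def)
      then obtain c where "equal_mod_id V a U (gl_combination a c B)"
        using B unfolding pgl_basis_def by blast
      then obtain s where s: "\<And>v. v \<in> V \<Longrightarrow> U v = gl_combination a c B v + s \<cdot>\<^sub>m 1\<^sub>m (a v)"
        unfolding equal_mod_id_def by blast
      have "(if g0 = g then 1 else 0) = (\<Sum>k<n. c k * b k g) + s * b n g" if g: "g \<in> G" for g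
      proof -
        obtain v i j where g': "g = (v, i, j)" "v \<in> V" "i < a v" "j < a v" using g
          by (auto simp: G_def)
        then have "(if g0 = g then 1 else 0) = U v $$ (i, j)" by (simp add: U_def)
        also have "\<dots> = gl_combination a c B v $$ (i, j) + s * (if i = j then 1 else 0)"
          unfolding s[OF g'(2)] using g' by (simp add: gl_combination_def)
        finally show ?thesis using g' by (simp add: comb mult.commute) (simp add: b_def)
      qed
      then have "(\<Sum>g\<in>G. (if g0 = g then 1 else 0) * z g) = (\<Sum>g\<in>G. ((\<Sum>k<n. c k * b k g)
        + s * b n g) * z g)"
        by (intro sum.cong) auto
      also have "\<dots> = (\<Sum>g\<in>G. \<Sum>k<n. c k * (b k g * z g)) + s * (\<Sum>g\<in>G. b n g * z g)"
        by (simp add: distrib_right sum.distrib sum_distrib_right sum_distrib_left mult.assoc)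
      also have "(\<Sum>g\<in>G. \<Sum>k<n. c k * (b k g * z g)) = (\<Sum>k<n. c k * (\<Sum>g\<in>G. b k g * z g))"
        by (subst sum.swap) (simp add: sum_distrib_left)
      also have "\<dots> = 0" by (intro sum.neutral) (simp add: z(2))
      also have "0 + s * (\<Sum>g\<in>G. b n g * z g) = 0" using z(2)[of n] by simp
      finally show ?thesis using g0 finG by (simp add: if_distrib[of "\<lambda>x. x * _"] cong: if_cong)
    qed
    with z(1) show False by blast
  qed
  ultimately show ?thesis using cardG by (simp add: n_def)
qed

lemma intersection_self:
  assumes fin: "finite V" and E: "E \<subseteq> V \<times> V" "irrefl E" and Q: "orientation E Q"
  shows "intersection V E w Y Y = 2 * (\<Sum>(t, h)\<in>Q. Y h * Y t) - (\<Sum>v\<in>V. int (w v) * (Y v * Y v))"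
proof -
  have EQ: "E = Q \<union> Q\<inverse>" "Q \<inter> Q\<inverse> = {}" using Q by (auto simp: orientation_def)
  have finE: "finite E" using finite_subset[OF E(1)] fin by simp
  then have finQ: "finite Q" "finite (Q\<inverse>)" using EQ(1) by auto
  have "Y u * Y v * vertex_form E w u v
      = (if u = v then - (int (w v) * (Y v * Y v)) else 0) + (if (u, v) \<in> E then Y u * Y v else
        0)" for u v
    using E(2) by (auto simp: vertex_form_def irrefl_def)
  then have "intersection V E w Y Y = (\<Sum>u\<in>V. \<Sum>v\<in>V. if u = v then - (int (w v) * (Y v * Y v)) else 0)
      + (\<Sum>u\<in>V. \<Sum>v\<in>V. if (u, v) \<in> E then Y u * Y v else 0)"
    by (simp add: intersection_def sum.distrib)
  also have "(\<Sum>u\<in>V. \<Sum>v\<in>V. if u = v then - (int (w v) * (Y v * Y v)) else 0)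
    = - (\<Sum>v\<in>V. int (w v) * (Y v * Y v))"
    using fin by (simp add: sum_negf)
  also have "(\<Sum>u\<in>V. \<Sum>v\<in>V. if (u, v) \<in> E then Y u * Y v else 0) = (\<Sum>(u, v)\<in>V \<times> V.
    if (u, v) \<in> E then Y u * Y v else 0)"
    by (rule sum.cartesian_product)
  also have "\<dots> = (\<Sum>(u, v)\<in>E. Y u * Y v)"
    using E(1) fin by (intro sum.mono_neutral_cong_right) auto
  also have "\<dots> = (\<Sum>(u, v)\<in>Q. Y u * Y v) + (\<Sum>(u, v)\<in>Q\<inverse>. Y u * Y v)"
    unfolding EQ(1) by (rule sum.union_disjoint[OF finQ EQ(2)])
  also have "(\<Sum>(u, v)\<in>Q\<inverse>. Y u * Y v) = (\<Sum>(u, v)\<in>Q. Y u * Y v)"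
    by (rule sum.reindex_bij_witness[of _ prod.swap prod.swap]) (auto simp: mult.commute)
  finally show ?thesis by (simp add: mult.commute)
qed

text \<open>The genus condition for a sincere root forces a single vertex of weight \<open>3\<close>, at which the
  root is \<open>1\<close>; some weight is odd because \<open>(Z \<cdot> Z)\<close> is.  On the box below the root, the genus
  condition then says that the Tits form of the quiver is positive.\<close>

lemma sincere_root_tits_form:
  assumes rtp: "RTP_tree V E w" and Q: "orientation E Q" and sincere: "\<forall>v\<in>V. 1 \<le> a v"
    and root: "(\<lambda>v. int (a v)) \<in> triple_root_system V E w"
  shows "positive_box V Q a" "Suc (\<Sum>(t, h)\<in>Q. a h * a t) = (\<Sum>v\<in>V. a v * a v)"
proof -
  have tree: "finite V" "V \<noteq> {}" "E \<subseteq> V \<times> V" "irrefl E" and w2: "\<And>v. v \<in> V \<Longrightarrow> 2 \<le> w v"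
    using rtp by (auto simp: rational_tuple_tree_def weighted_tree_def finite_tree_def)
  have EQ: "E = Q \<union> Q\<inverse>" using Q by (auto simp: orientation_def)
  have finQ: "finite Q" and QV: "Q \<subseteq> V \<times> V"
    using tree(1,3) EQ finite_subset[of Q "V \<times> V"] by auto
  note self = intersection_self[OF tree(1,3,4) Q]
  have genus: "intersection V E w Y Y + (\<Sum>v\<in>V. Y v * (int (w v) - 2)) + 2 \<le> 0"
    if "positive_divisor V Y" for Y
  proof -
    define m where "m = intersection V E w Y Y + (\<Sum>v\<in>V. Y v * (int (w v) - 2))"
    have "of_int m / 2 + 1 \<le> (0 :: rat)"
      using rtp that unfolding rational_tuple_tree_def arithmetic_genus_def m_def by blast
    then have "of_int (m + 2) \<le> (0 :: rat)" by simp
    then have "m + 2 \<le> 0" by linarith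
    then show ?thesis by (simp add: m_def)
  qed
  obtain Z where Z: "intersection V E w Z Z = -3"
    using rtp by (auto simp: rational_tuple_tree_def)
  have "\<exists>v\<in>V. odd (w v)"
  proof (rule ccontr)
    assume "\<not> (\<exists>v\<in>V. odd (w v))"
    then have "even (\<Sum>v\<in>V. int (w v) * (Z v * Z v))" by (intro dvd_sum) auto
    then have "even (intersection V E w Z Z)" by (simp add: self)
    then show False by (simp add: Z)
  qed
  then obtain v0 where v0: "v0 \<in> V" "odd (w v0)" by blast
  have w3: "3 \<le> w v0" using w2[OF v0(1)] v0(2) by (cases "w v0 = 2") auto
  let ?a = "\<lambda>v. int (a v)"
  have off: "a v = 0" if "v \<notin> V" for v
    using root that by (auto simp: triple_root_system_def positive_divisor_def
      negative_divisor_def divisors_def)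
  have pos: "positive_divisor V (\<lambda>v. int (d v))" if "\<And>v. d v \<le> a v" "u \<in> V" "d u \<noteq> 0" for d u
    using that off by (auto simp: positive_divisor_def divisors_def fun_eq_iff) (metis le_zero_eq)
  have sum_le: "(\<Sum>v\<in>V. ?a v * (int (w v) - 2)) \<le> - 2 - intersection V E w ?a ?a"
    using genus[OF pos[of a v0]] sincere v0 by fastforce
  have nonneg: "0 \<le> ?a v * (int (w v) - 2)" if "v \<in> V" for v using w2[OF that] by simp
  have split: "(\<Sum>v\<in>V. ?a v * (int (w v) - 2))
      = ?a v0 * (int (w v0) - 2) + (\<Sum>v\<in>V - {v0}. ?a v * (int (w v) - 2))"
    using v0 tree(1) by (simp add: sum.remove)
  have rest: "0 \<le> (\<Sum>v\<in>V - {v0}. ?a v * (int (w v) - 2))" using nonneg by (intro sum_nonneg) auto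
  have a0: "1 \<le> a v0" using sincere v0 by blast
  have big: "?a v0 \<le> ?a v0 * (int (w v0) - 2)" "int (w v0) - 2 \<le> ?a v0 * (int (w v0) - 2)"
    using w3 a0 by (simp_all add: mult_le_cancel_left1 mult_le_cancel_right1)
  have self_a: "intersection V E w ?a ?a = -2 \<or> intersection V E w ?a ?a = -3"
    using root by (simp add: triple_root_system_def)
  \<comment> \<open>The genus condition bounds the weighted sum by 0 or by 1, according to the
    self-intersection -2 or -3, while \<open>v0\<close> alone contributes at least 1. Everything is
    therefore forced.\<close>
  have aa: "intersection V E w ?a ?a = -3" and av0: "a v0 = 1" and wv0: "w v0 = 3"
    and rest0: "(\<Sum>v\<in>V - {v0}. ?a v * (int (w v) - 2)) = 0"
    using self_a sum_le split rest big a0 w3 by linarith+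
  have w_other: "w v = 2" if v: "v \<in> V" "v \<noteq> v0" for v
  proof -
    have "?a v * (int (w v) - 2) = 0"
      using rest0 nonneg v tree(1) by (subst (asm) sum_nonneg_eq_0_iff) auto
    then show ?thesis using sincere v w2[of v] by fastforce
  qed
  have weights: "(\<Sum>v\<in>V. int (w v) * (Y v * Y v)) = 2 * (\<Sum>v\<in>V. Y v * Y v) + Y v0 * Y v0"
    "(\<Sum>v\<in>V. Y v * (int (w v) - 2)) = Y v0" for Y
  proof -
    have "(\<Sum>v\<in>V. int (w v) * (Y v * Y v)) = (\<Sum>v\<in>V. 2 * (Y v * Y v) + (if v
      = v0 then Y v0 * Y v0 else 0))"
      by (intro sum.cong) (auto simp: w_other wv0)
    then show "(\<Sum>v\<in>V. int (w v) * (Y v * Y v)) = 2 * (\<Sum>v\<in>V. Y v * Y v) + Y v0 * Y v0"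
      using v0 tree(1) by (simp add: sum.distrib sum_distrib_left)
    have "(\<Sum>v\<in>V. Y v * (int (w v) - 2)) = (\<Sum>v\<in>V. if v = v0 then Y v0 else 0)"
      by (intro sum.cong) (auto simp: w_other wv0)
    then show "(\<Sum>v\<in>V. Y v * (int (w v) - 2)) = Y v0" using v0 tree(1) by simp
  qed
  have cast: "(\<Sum>(t, h)\<in>Q. int (d h) * int (d t)) = int (\<Sum>(t, h)\<in>Q. d h * d t)"
    "(\<Sum>v\<in>V. int (d v) * int (d v)) = int (\<Sum>v\<in>V. d v * d v)" for d
    by (simp_all add: split_def)
  have "2 * int (\<Sum>(t, h)\<in>Q. a h * a t) - (2 * int (\<Sum>v\<in>V. a v * a v) + 1) = -3"
    using aa unfolding self weights cast by (simp add: av0)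
  then show "Suc (\<Sum>(t, h)\<in>Q. a h * a t) = (\<Sum>v\<in>V. a v * a v)" by linarith
  show "positive_box V Q a"
  proof
    fix d v assume d: "\<And>v. d v \<le> a v" "v \<in> V" "d v \<noteq> 0"
    have "2 * int (\<Sum>(t, h)\<in>Q. d h * d t) - (2 * int (\<Sum>v\<in>V. d v * d v) + int (d v0) * int (d v0))
      + int (d v0) + 2 \<le> 0"
      using genus[OF pos[OF d]] unfolding self weights cast .
    \<comment> \<open>The entry at \<open>v0\<close> equals its square, so the extra terms of the
      weight 3 vertex cancel and the genus condition reads \<open>q(d) \<ge> 1\<close> for the Tits
      form \<open>q\<close>.\<close>
    moreover
    have "d v0 = 0 \<or> d v0 = 1" using d(1)[of v0] av0 by linarith
    then have "int (d v0) * int (d v0) = int (d v0)" by auto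
    ultimately have "int (\<Sum>(t, h)\<in>Q. d h * d t) < int (\<Sum>v\<in>V. d v * d v)" by linarith
    then show "(\<Sum>(t, h)\<in>Q. d h * d t) < (\<Sum>v\<in>V. d v * d v)" by (simp only: of_nat_less_iff)
  qed (use tree(1) finQ QV off in auto)
qed

lemma rep_dim_sum:
  assumes "finite Q"
  shows "rep_dim Q a = (\<Sum>(t, h)\<in>Q. a h * a t)"
proof -
  have "rep_coords Q a = Sigma Q (\<lambda>(t, h). {..<a h} \<times> {..<a t})"
    by (auto simp: rep_coords_def)
  then show ?thesis
    unfolding rep_dim_def using assms
    by (simp, subst card_SigmaI) (auto simp: card_cartesian_product intro!: sum.cong)
qed

theorem theorem4p9:
  fixes V :: "'v set" and E Q :: "('v \<times> 'v) set" and w a :: "'v \<Rightarrow> nat"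
    and e :: "nat \<Rightarrow> ('v \<times> 'v) \<times> nat \<times> nat" and B :: "('v \<Rightarrow> complex mat) list"
  assumes "RTP_tree V E w"
    and "orientation E Q"
    and "\<forall>v\<in>V. 1 \<le> a v"
    and "(\<lambda>v. int (a v)) \<in> triple_root_system V E w"
    and "bij_betw e {..<rep_dim Q a} (rep_coords Q a)"
    and "pgl_basis V a B"
  shows "linear_free_divisor (rep_dim Q a) (discriminant Q a e B)"
proof -
  note box = sincere_root_tits_form[OF assms(1-4)]
  interpret positive_box V Q a by (rule box(1))
  have "V \<noteq> {}" using assms(1) by (simp add: rational_tuple_tree_def weighted_tree_def
    finite_tree_def)
  then obtain v0 where "v0 \<in> V" by blast
  with length_pgl_basis[OF fin(1) _ _ assms(6), of v0] assms(3)
  have "Suc (length B) = (\<Sum>v\<in>V. a v * a v)" by blast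
  \<comment> \<open>The Tits form takes the value 1 at the root; this 1 is the dimension of the
    scalars divided out of the matrix algebra.\<close>
  then have "length B = rep_dim Q a" using box(2) by (simp add: rep_dim_sum[OF fin(2)])
  then interpret square_box V Q a e B using assms(5,6) by unfold_locales
  show ?thesis by (rule linear_free_divisor_discriminant)
qed

end
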